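(* Let $M$ be an oriented $4$-manifold endowed with a Riemannian metric $g$ and a compatible almost-complex structure $\omega$ (with endomorphism $J$), which induce a $Spin^{\mathbb{C}}$-structure with spinor bundles $\mathcal{W}^{+}$ and $\mathcal{W}^{-}$. A. There are natural Hermitian bundle isomorphisms $$\mathcal{W}^{-}\cong(T_M,\omega),\qquad \mathcal{W}^{+}\cong(PSO^{+}(T_M),\omega).$$ B. Under these isomorphisms the Clifford multiplication $T_M\times\mathcal{W}^{+}\to\mathcal{W}^{-}$, $(v,\varphi)\mapsto v\bullet\varphi$, is identified with the evaluation map $T_M\times PSO^{+}(T_M)\to T_M$: $$v\bullet\varphi\equiv\varphi(v).$$ C. Under these isomorphisms the squaring map $\sigma:\mathcal{W}^{+}\to\Lambda^{+}$ is $$\sigma(\varphi)=\tfrac14\,\varphi^{*}\omega,\qquad (\varphi^{*}\omega)(v,w)=\omega(\varphi v,\varphi w).$$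
   Context: $T_M$ and $T_M^*$ are identified by $g$. A compatible almost-complex structure is a $g$-orthogonal $J:T_M\to T_M$, $J^2=-1$, inducing the given orientation, identified with the self-dual form $\omega(v,w)=g(Jv,w)$ of length $\sqrt2$. Groups. $\mathbb{H}=\mathbb{C}^2$ via $z_1+z_2j\leftrightarrow(z_1,z_2)$, with complex structure left multiplication by $i$; $\mathbb S^3$ is the unit sphere of $\mathbb H$. $SO(4)=\mathbb{S}^3\times\mathbb{S}^3/\pm1$ acts on $\mathbb{R}^4=\mathbb{H}$ by $[\xi_+,\xi_-]\cdot v=\xi_+v\xi_-^{-1}$; $U(2)=\mathbb{S}^1\times\mathbb{S}^3/\pm1$ acts on $\mathbb{C}^2=\mathbb{H}$ by $[\lambda,\xi]\cdot v=\lambda v\xi^{-1}$; $Spin^{\mathbb{C}}(4)=\mathbb{S}^1\times\mathbb{S}^3\times\mathbb{S}^3/\pm1$ maps to $SO(4)$ by $[\lambda,\xi_+,\xi_-]\mapsto[\xi_+,\xi_-]$ and to $U(2)$ in two ways by $[\lambda,\xi_+,\xi_-]\mapsto[\lambda,\xi_\pm]$. Spinor bundles. A $Spin^{\mathbb{C}}$-structure is a lift of an $SO(4)$-cocycle of $T_M$ to $Spin^{\mathbb{C}}(4)$; $\mathcal{W}^{\pm}$ are the Hermitian $\mathbb{C}^2$-bundles with the cocycles obtained via the two maps to $U(2)$. The almost-complex structure reduces the cocycle of $T_M$ to $U(2)$ (in charts where $J$ is left multiplication by $i$), and the induced $Spin^{\mathbb{C}}$-structure is obtained through $U(2)\to Spin^{\mathbb{C}}(4)$,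 $[\lambda,\xi]\mapsto[\lambda,\lambda,\xi]$. The Clifford multiplication $T_M\times\mathcal{W}^+\to\mathcal{W}^-$ (with companion $T_M\times\mathcal{W}^-\to\mathcal{W}^+$) is the one induced in charts by the $Spin^{\mathbb{C}}(4)$-equivariant model Clifford multiplication, satisfying $v\bullet(v\bullet\varphi)=-\|v\|^2\varphi$, with $v\,\bullet$ skew-adjoint on $\mathcal W^+\oplus\mathcal W^-$; the model is unique up to a unit complex constant. It extends to an action of the Clifford algebra bundle, hence of $\Lambda^2(T_M)$, with $(v\wedge w)\bullet\varphi=v\bullet(w\bullet\varphi)$ for $v\perp w$. Squaring map. For $\varphi\in\mathcal{W}^+$, $i\sigma(\varphi)$ is the element of $\Lambda^+\otimes\mathbb{C}\cong\mathrm{End}_0(\mathcal{W}^+)$ (isomorphism by Clifford action onto traceless endomorphisms) corresponding to $\varphi\otimes\varphi^*-\tfrac12\|\varphi\|^2\mathrm{id}$, where $\varphi\otimes\varphi^*=\langle\cdot,\varphi\rangle\varphi$; then $\sigma(\varphi)\in\Lambda^+$ is real, and $\sigma(\varphi)\bullet\varphi=-\tfrac{i}{2}\|\varphi\|^2\varphi$. $PSO^+(T_M)$ is the rank-$4$ real subbundle of $\mathrm{Hom}(T_M,T_M)$ of self-dual conformal transformations of the fibers: linear maps which, under an orientation-preserving isometry $T_M|_x\cong\mathbb{H}$ ($\mathbb H$ oriented by $1,i,j,k$), are left multiplication by a quaternion (zero included). Its fiber metric is normalized so that $g(\varphi v,\varphi w)=\|\varphi\|^2g(v,w)$, and $(PSO^+(T_M),\omega)$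 carries the complex structure $(i\varphi)(v)=J(\varphi(v))$; $(T_M,\omega)$ is $T_M$ with complex structure $J$ and metric $g$. *)

theory Defs
  imports "HOL-Analysis.Analysis"
begin

section \<open>Smooth functions between Euclidean spaces\<close>

text \<open>Meant for open \<open>S\<close> in a finite-dimensional space; there, existence and continuity of all
  iterated directional derivatives up to order \<open>k\<close> is the class $C^k$.\<close>

primrec Ck_on :: "nat \<Rightarrow> ('a::euclidean_space \<Rightarrow> 'b::euclidean_space) \<Rightarrow> 'a set \<Rightarrow> bool" where
  "Ck_on 0 f S \<longleftrightarrow> continuous_on S f"
| "Ck_on (Suc k) f S \<longleftrightarrow>
     (\<forall>x\<in>S. f differentiable (at x)) \<and>
     (\<forall>v. Ck_on k (\<lambda>x. frechet_derivative f (at x) v) S)"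

definition Cinf_on :: "('a::euclidean_space \<Rightarrow> 'b::euclidean_space) \<Rightarrow> 'a set \<Rightarrow> bool" where
  "Cinf_on f S \<longleftrightarrow> (\<forall>k. Ck_on k f S)"


section \<open>Quaternions and the groups $SO(4)$, $U(2)$, $Spin^{\bf C}(4)$\<close>

text \<open>The pair \<open>(z1, z2)\<close> is the quaternion $z_1 + z_2 j$, where $j z = \bar z j$ for complex
  \<open>z\<close>. The Euclidean norm and inner product are those of the product type.\<close>

type_synonym quat = "complex \<times> complex"

definition qmul :: "quat \<Rightarrow> quat \<Rightarrow> quat" where
  "qmul a b = (fst a * fst b - snd a * cnj (snd b), fst a * snd b + snd a * cnj (fst b))"

definition qconj :: "quat \<Rightarrow> quat" where
  "qconj a = (cnj (fst a), - snd a)"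

definition qinv :: "quat \<Rightarrow> quat" where
  "qinv a = (1 / (norm a)\<^sup>2) *\<^sub>R qconj a"

definition qof :: "complex \<Rightarrow> quat" where
  "qof z = (z, 0)"

definition q1 :: quat where "q1 = (1, 0)"
definition qi :: quat where "qi = (\<i>, 0)"
definition qj :: quat where "qj = (0, 1)"
definition qk :: quat where "qk = (0, \<i>)"

text \<open>The standard Hermitian product of ${\bf C}^2$, linear in the first argument; its real part is
  the Euclidean inner product.\<close>

definition qherm :: "quat \<Rightarrow> quat \<Rightarrow> complex" where
  "qherm a b = fst a * cnj (fst b) + snd a * cnj (snd b)"

text \<open>Elements of the quotient groups are the classes $\{t,-t\}$. All maps out of the quotients are
  images of such classes, respectively the common value on the class.\<close>

definition pm :: "'a::uminus \<Rightarrow> 'a set" where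
  "pm t = {t, - t}"

definition SO4 :: "(quat \<times> quat) set set" where
  "SO4 = {pm (p, m) |p m. norm p = 1 \<and> norm m = 1}"

definition U2 :: "(complex \<times> quat) set set" where
  "U2 = {pm (l, q) |l q. norm l = 1 \<and> norm q = 1}"

definition SpinC :: "(complex \<times> quat \<times> quat) set set" where
  "SpinC = {pm (l, p, m) |l p m. norm l = 1 \<and> norm p = 1 \<and> norm m = 1}"

definition SO4_act :: "(quat \<times> quat) set \<Rightarrow> quat \<Rightarrow> quat" where
  "SO4_act s v = the_elem ((\<lambda>(p, m). qmul (qmul p v) (qinv m)) ` s)"

definition U2_act :: "(complex \<times> quat) set \<Rightarrow> quat \<Rightarrow> quat" where
  "U2_act u v = the_elem ((\<lambda>(l, q). qmul (qmul (qof l) v) (qinv q)) ` u)"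

definition SpinC_to_SO4 :: "(complex \<times> quat \<times> quat) set \<Rightarrow> (quat \<times> quat) set" where
  "SpinC_to_SO4 s = (\<lambda>(l, p, m). (p, m)) ` s"

definition SpinC_to_U2_plus :: "(complex \<times> quat \<times> quat) set \<Rightarrow> (complex \<times> quat) set" where
  "SpinC_to_U2_plus s = (\<lambda>(l, p, m). (l, p)) ` s"

definition SpinC_to_U2_minus :: "(complex \<times> quat \<times> quat) set \<Rightarrow> (complex \<times> quat) set" where
  "SpinC_to_U2_minus s = (\<lambda>(l, p, m). (l, m)) ` s"

definition U2_to_SpinC :: "(complex \<times> quat) set \<Rightarrow> (complex \<times> quat \<times> quat) set" where
  "U2_to_SpinC u = (\<lambda>(l, q). (l, qof l, q)) ` u"


section \<open>The model Clifford multiplication\<close>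

text \<open>\<open>cp v\<close> maps $W^+$ to $W^-$ and \<open>cm v\<close> maps $W^-$ to $W^+$, where both
  model spaces are ${\bf C}^2 = {\bf H}$, acted upon through the two maps to $U(2)$. Complex scalars
  act on ${\bf H}$ by left multiplication.\<close>

definition clifford_model :: "(quat \<Rightarrow> quat \<Rightarrow> quat) \<Rightarrow> (quat \<Rightarrow> quat \<Rightarrow> quat) \<Rightarrow> bool" where
  "clifford_model cp cm \<longleftrightarrow>
     (\<forall>\<phi>. linear (\<lambda>v. cp v \<phi>)) \<and> (\<forall>\<psi>. linear (\<lambda>v. cm v \<psi>)) \<and>
     (\<forall>v. linear (cp v)) \<and> (\<forall>v. linear (cm v)) \<and>
     (\<forall>v z \<phi>. cp v (qmul (qof z) \<phi>) = qmul (qof z) (cp v \<phi>)) \<and>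
     (\<forall>v z \<psi>. cm v (qmul (qof z) \<psi>) = qmul (qof z) (cm v \<psi>)) \<and>
     (\<forall>s\<in>SpinC. \<forall>v \<phi>. cp (SO4_act (SpinC_to_SO4 s) v) (U2_act (SpinC_to_U2_plus s) \<phi>)
                      = U2_act (SpinC_to_U2_minus s) (cp v \<phi>)) \<and>
     (\<forall>s\<in>SpinC. \<forall>v \<psi>. cm (SO4_act (SpinC_to_SO4 s) v) (U2_act (SpinC_to_U2_minus s) \<psi>)
                      = U2_act (SpinC_to_U2_plus s) (cm v \<psi>)) \<and>
     (\<forall>v \<phi>. cm v (cp v \<phi>) = - (norm v)\<^sup>2 *\<^sub>R \<phi>) \<and>
     (\<forall>v \<psi>. cp v (cm v \<psi>) = - (norm v)\<^sup>2 *\<^sub>R \<psi>) \<and>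
     (\<forall>v \<phi> \<psi>. qherm (cp v \<phi>) \<psi> = - qherm \<phi> (cm v \<psi>))"


section \<open>Bundles glued from cocycles\<close>

text \<open>\<open>cc_tr C i j x\<close> turns the \<open>i\<close>-coordinates of an element of the fibre over \<open>x\<close> into its
  \<open>j\<close>-coordinates. The elements of the glued bundle are the classes of triples \<open>(x, i, u)\<close>
  modulo \<open>(x, i, u) \<sim> (x, j, cc_tr C i j x u)\<close>.\<close>

record ('i, 'm, 'f) cocycle =
  cc_idx :: "'i set"
  cc_dom :: "'i \<Rightarrow> 'm set"
  cc_tr :: "'i \<Rightarrow> 'i \<Rightarrow> 'm \<Rightarrow> 'f \<Rightarrow> 'f"

definition cls :: "('i, 'm, 'f) cocycle \<Rightarrow> 'i \<Rightarrow> 'm \<Rightarrow> 'f \<Rightarrow> ('m \<times> 'i \<times> 'f) set" where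
  "cls C i x u = {(x, j, cc_tr C i j x u) |j. j \<in> cc_idx C \<and> x \<in> cc_dom C j}"

definition fibre :: "('i, 'm, 'f) cocycle \<Rightarrow> 'm \<Rightarrow> ('m \<times> 'i \<times> 'f) set set" where
  "fibre C x = {cls C i x u |i u. i \<in> cc_idx C \<and> x \<in> cc_dom C i}"

definition coord :: "'i \<Rightarrow> ('m \<times> 'i \<times> 'f) set \<Rightarrow> 'f" where
  "coord i e = (THE u. \<exists>x. (x, i, u) \<in> e)"

definition idx_at :: "('i, 'm, 'f) cocycle \<Rightarrow> 'm \<Rightarrow> 'i" where
  "idx_at C x = (SOME i. i \<in> cc_idx C \<and> x \<in> cc_dom C i)"

text \<open>The linear operations on a fibre are computed in one trivialization over the point; for
  linear cocycles the choice is irrelevant.\<close>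

definition fplus :: "('i, 'm, 'f::real_vector) cocycle \<Rightarrow> 'm \<Rightarrow>
    ('m \<times> 'i \<times> 'f) set \<Rightarrow> ('m \<times> 'i \<times> 'f) set \<Rightarrow> ('m \<times> 'i \<times> 'f) set" where
  "fplus C x a b = cls C (idx_at C x) x (coord (idx_at C x) a + coord (idx_at C x) b)"

definition fscale :: "('i, 'm, 'f::real_vector) cocycle \<Rightarrow> 'm \<Rightarrow> real \<Rightarrow>
    ('m \<times> 'i \<times> 'f) set \<Rightarrow> ('m \<times> 'i \<times> 'f) set" where
  "fscale C x r a = cls C (idx_at C x) x (r *\<^sub>R coord (idx_at C x) a)"


section \<open>Oriented Riemannian four-manifolds with an almost-complex structure\<close>

type_synonym 'm chart = "'m set \<times> ('m \<Rightarrow> real^4)"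
type_synonym 'm tvec = "('m \<times> 'm chart \<times> (real^4)) set"

text \<open>\<open>metric\<close> and \<open>cplx\<close> are the metric $g$ and the endomorphism $J$, as functions of
  tangent vectors; only their values on vectors of a common tangent space matter.\<close>

record 'm ah_manifold =
  topo :: "'m topology"
  atlas :: "'m chart set"
  metric :: "'m tvec \<Rightarrow> 'm tvec \<Rightarrow> real"
  cplx :: "'m tvec \<Rightarrow> 'm tvec"

definition transition :: "'m chart \<Rightarrow> 'm chart \<Rightarrow> real^4 \<Rightarrow> real^4" where
  "transition c d = snd d \<circ> inv_into (fst c) (snd c)"

definition oriented_4manifold :: "'m ah_manifold \<Rightarrow> bool" where
  "oriented_4manifold M \<longleftrightarrow>
     Hausdorff_space (topo M) \<and> second_countable (topo M) \<and>
     (\<Union>c\<in>atlas M. fst c) = topspace (topo M) \<and>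
     (\<forall>c\<in>atlas M. openin (topo M) (fst c) \<and> open (snd c ` fst c) \<and>
        homeomorphic_map (subtopology (topo M) (fst c)) (top_of_set (snd c ` fst c)) (snd c)) \<and>
     (\<forall>c\<in>atlas M. \<forall>d\<in>atlas M.
        Cinf_on (transition c d) (snd c ` (fst c \<inter> fst d)) \<and>
        (\<forall>x\<in>fst c \<inter> fst d. det (matrix (frechet_derivative (transition c d) (at (snd c x)))) > 0))"

text \<open>The tangent bundle, glued from the Jacobians of the coordinate changes.\<close>

definition TM :: "'m ah_manifold \<Rightarrow> ('m chart, 'm, real^4) cocycle" where
  "TM M = \<lparr>cc_idx = atlas M, cc_dom = fst,
     cc_tr = (\<lambda>c d x. frechet_derivative (transition c d) (at (snd c x)))\<rparr>"

abbreviation tspace :: "'m ah_manifold \<Rightarrow> 'm \<Rightarrow> 'm tvec set" where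
  "tspace M \<equiv> fibre (TM M)"

definition smooth_fun :: "'m ah_manifold \<Rightarrow> 'm set \<Rightarrow> ('m \<Rightarrow> 'b::euclidean_space) \<Rightarrow> bool" where
  "smooth_fun M S f \<longleftrightarrow>
     (\<forall>c\<in>atlas M. Cinf_on (f \<circ> inv_into (fst c) (snd c)) (snd c ` (S \<inter> fst c)))"

text \<open>Smooth sections over the open set \<open>S\<close> of a glued bundle over \<open>M\<close>.\<close>

definition smooth_section :: "'m ah_manifold \<Rightarrow> ('i, 'm, 'f::euclidean_space) cocycle \<Rightarrow>
    'm set \<Rightarrow> ('m \<Rightarrow> ('m \<times> 'i \<times> 'f) set) \<Rightarrow> bool" where
  "smooth_section M C S s \<longleftrightarrow>
     (\<forall>x\<in>S. s x \<in> fibre C x) \<and>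
     (\<forall>i\<in>cc_idx C. smooth_fun M (S \<inter> cc_dom C i) (\<lambda>x. coord i (s x)))"

definition riemannian_metric :: "'m ah_manifold \<Rightarrow> bool" where
  "riemannian_metric M \<longleftrightarrow>
     (\<forall>x\<in>topspace (topo M). \<forall>u\<in>tspace M x. \<forall>v\<in>tspace M x. \<forall>w\<in>tspace M x. \<forall>r.
        metric M (fplus (TM M) x u v) w = metric M u w + metric M v w \<and>
        metric M (fscale (TM M) x r u) w = r * metric M u w \<and>
        metric M u v = metric M v u) \<and>
     (\<forall>c\<in>atlas M. \<forall>x\<in>fst c. \<forall>a. a \<noteq> 0 \<longrightarrow> metric M (cls (TM M) c x a) (cls (TM M) c x a) > 0) \<and>
     (\<forall>c\<in>atlas M. \<forall>a b. smooth_fun M (fst c)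
        (\<lambda>x. metric M (cls (TM M) c x a) (cls (TM M) c x b)))"

definition orient_det :: "'m chart \<Rightarrow> 'm tvec \<Rightarrow> 'm tvec \<Rightarrow> 'm tvec \<Rightarrow> 'm tvec \<Rightarrow> real" where
  "orient_det c t u v w = det (vector [coord c t, coord c u, coord c v, coord c w] :: real^4^4)"

text \<open>The last clause says that $J$ induces the given orientation: complex bases
  $(v, w)$ give positive real bases $(v, Jv, w, Jw)$.\<close>

definition compatible_complex :: "'m ah_manifold \<Rightarrow> bool" where
  "compatible_complex M \<longleftrightarrow>
     (\<forall>x\<in>topspace (topo M). \<forall>v\<in>tspace M x. \<forall>w\<in>tspace M x. \<forall>r.
        cplx M v \<in> tspace M x \<and>
        cplx M (fplus (TM M) x v w) = fplus (TM M) x (cplx M v) (cplx M w) \<and>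
        cplx M (fscale (TM M) x r v) = fscale (TM M) x r (cplx M v) \<and>
        cplx M (cplx M v) = fscale (TM M) x (- 1) v \<and>
        metric M (cplx M v) (cplx M w) = metric M v w) \<and>
     (\<forall>c\<in>atlas M. \<forall>a. smooth_section M (TM M) (fst c) (\<lambda>x. cplx M (cls (TM M) c x a))) \<and>
     (\<forall>c\<in>atlas M. \<forall>x\<in>fst c. \<forall>v\<in>tspace M x. \<forall>w\<in>tspace M x.
        orient_det c v (cplx M v) w (cplx M w) \<noteq> 0 \<longrightarrow>
        orient_det c v (cplx M v) w (cplx M w) > 0)"

definition almost_hermitian_4manifold :: "'m ah_manifold \<Rightarrow> bool" where
  "almost_hermitian_4manifold M \<longleftrightarrow>
     oriented_4manifold M \<and> riemannian_metric M \<and> compatible_complex M"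

definition omega :: "'m ah_manifold \<Rightarrow> 'm tvec \<Rightarrow> 'm tvec \<Rightarrow> real" where
  "omega M v w = metric M (cplx M v) w"

text \<open>Orientation-preserving linear isometries from ${\bf H}$ onto the tangent space at \<open>x\<close>.\<close>

definition oriented_isometry :: "'m ah_manifold \<Rightarrow> 'm \<Rightarrow> (quat \<Rightarrow> 'm tvec) \<Rightarrow> bool" where
  "oriented_isometry M x f \<longleftrightarrow>
     (\<forall>a. f a \<in> tspace M x) \<and>
     (\<forall>a b. f (a + b) = fplus (TM M) x (f a) (f b)) \<and>
     (\<forall>r a. f (r *\<^sub>R a) = fscale (TM M) x r (f a)) \<and>
     (\<forall>a b. metric M (f a) (f b) = inner a b) \<and>
     (\<forall>c\<in>atlas M. x \<in> fst c \<longrightarrow> orient_det c (f q1) (f qi) (f qj) (f qk) > 0)"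


section \<open>Hermitian bundles and their isomorphisms\<close>

text \<open>Smooth structures are encoded by the smooth local sections: \<open>hb_smooth E S s\<close> means that
  \<open>s\<close> is a smooth section over the open set \<open>S\<close>. A fibrewise linear map of vector bundles
  over the identity is smooth iff it maps smooth local sections to smooth local sections.\<close>

record ('m, 'e) hbundle =
  hb_fibre :: "'m \<Rightarrow> 'e set"
  hb_plus :: "'m \<Rightarrow> 'e \<Rightarrow> 'e \<Rightarrow> 'e"
  hb_scale :: "'m \<Rightarrow> complex \<Rightarrow> 'e \<Rightarrow> 'e"
  hb_herm :: "'m \<Rightarrow> 'e \<Rightarrow> 'e \<Rightarrow> complex"
  hb_smooth :: "'m set \<Rightarrow> ('m \<Rightarrow> 'e) \<Rightarrow> bool"

definition hermitian_bundle_iso ::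
    "'m topology \<Rightarrow> ('m, 'e) hbundle \<Rightarrow> ('m, 'f) hbundle \<Rightarrow> ('m \<Rightarrow> 'e \<Rightarrow> 'f) \<Rightarrow> bool" where
  "hermitian_bundle_iso X E F \<Phi> \<longleftrightarrow>
     (\<forall>x\<in>topspace X.
        bij_betw (\<Phi> x) (hb_fibre E x) (hb_fibre F x) \<and>
        (\<forall>a\<in>hb_fibre E x. \<forall>b\<in>hb_fibre E x.
           \<Phi> x (hb_plus E x a b) = hb_plus F x (\<Phi> x a) (\<Phi> x b) \<and>
           hb_herm F x (\<Phi> x a) (\<Phi> x b) = hb_herm E x a b) \<and>
        (\<forall>z. \<forall>a\<in>hb_fibre E x. \<Phi> x (hb_scale E x z a) = hb_scale F x z (\<Phi> x a))) \<and>
     (\<forall>S s. openin X S \<and> hb_smooth E S s \<longrightarrow> hb_smooth F S (\<lambda>x. \<Phi> x (s x))) \<and>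
     (\<forall>S t. openin X S \<and> hb_smooth F S t \<longrightarrow>
        hb_smooth E S (\<lambda>x. inv_into (hb_fibre E x) (\<Phi> x) (t x)))"

text \<open>$(T_M,\omega)$. The Hermitian form is linear in the first argument, with real part $g$.\<close>

definition T_omega :: "'m ah_manifold \<Rightarrow> ('m, 'm tvec) hbundle" where
  "T_omega M = \<lparr>hb_fibre = tspace M, hb_plus = fplus (TM M),
     hb_scale = (\<lambda>x z v. fplus (TM M) x (fscale (TM M) x (Re z) v)
                                          (fscale (TM M) x (Im z) (cplx M v))),
     hb_herm = (\<lambda>x v w. Complex (metric M v w) (- metric M (cplx M v) w)),
     hb_smooth = smooth_section M (TM M)\<rparr>"

text \<open>Endomorphisms of a tangent space are represented by functions that are \<open>undefined\<close>
  outside it, so that equality of functions is equality of endomorphisms.\<close>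

definition pso_fibre :: "'m ah_manifold \<Rightarrow> 'm \<Rightarrow> ('m tvec \<Rightarrow> 'm tvec) set" where
  "pso_fibre M x = {L \<in> extensional (tspace M x).
     \<exists>f a. oriented_isometry M x f \<and> (\<forall>v. L (f v) = f (qmul a v))}"

definition pso_plus :: "'m ah_manifold \<Rightarrow> 'm \<Rightarrow> ('m tvec \<Rightarrow> 'm tvec) \<Rightarrow>
    ('m tvec \<Rightarrow> 'm tvec) \<Rightarrow> ('m tvec \<Rightarrow> 'm tvec)" where
  "pso_plus M x L K = (\<lambda>v\<in>tspace M x. fplus (TM M) x (L v) (K v))"

definition pso_scale :: "'m ah_manifold \<Rightarrow> 'm \<Rightarrow> complex \<Rightarrow> ('m tvec \<Rightarrow> 'm tvec) \<Rightarrow>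
    ('m tvec \<Rightarrow> 'm tvec)" where
  "pso_scale M x z L = (\<lambda>v\<in>tspace M x. hb_scale (T_omega M) x z (L v))"

definition pso_norm :: "'m ah_manifold \<Rightarrow> 'm \<Rightarrow> ('m tvec \<Rightarrow> 'm tvec) \<Rightarrow> real" where
  "pso_norm M x L = (THE r. r \<ge> 0 \<and>
     (\<forall>v\<in>tspace M x. \<forall>w\<in>tspace M x. metric M (L v) (L w) = r\<^sup>2 * metric M v w))"

text \<open>The fibre metric, by polarization of the norm.\<close>

definition pso_inner :: "'m ah_manifold \<Rightarrow> 'm \<Rightarrow> ('m tvec \<Rightarrow> 'm tvec) \<Rightarrow>
    ('m tvec \<Rightarrow> 'm tvec) \<Rightarrow> real" where
  "pso_inner M x L K = ((pso_norm M x (pso_plus M x L K))\<^sup>2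
     - (pso_norm M x (pso_plus M x L (pso_scale M x (- 1) K)))\<^sup>2) / 4"

text \<open>A section is smooth iff it is smooth as a section of \<open>Hom(T_M, T_M)\<close>, i.e. iff its matrix
  in every chart is smooth.\<close>

definition PSO_omega :: "'m ah_manifold \<Rightarrow> ('m, 'm tvec \<Rightarrow> 'm tvec) hbundle" where
  "PSO_omega M = \<lparr>hb_fibre = pso_fibre M, hb_plus = pso_plus M, hb_scale = pso_scale M,
     hb_herm = (\<lambda>x L K. Complex (pso_inner M x L K) (- pso_inner M x (pso_scale M x \<i> L) K)),
     hb_smooth = (\<lambda>S s. (\<forall>x\<in>S. s x \<in> pso_fibre M x) \<and>
        (\<forall>c\<in>atlas M. \<forall>a. smooth_fun M (S \<inter> fst c) (\<lambda>x. coord c (s x (cls (TM M) c x a)))))\<rparr>"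


section \<open>The spinor bundles of the induced $Spin^{\bf C}$-structure\<close>

text \<open>A local frame over \<open>U\<close> is a family of isometries from ${\bf H}$ to the tangent spaces.\<close>

type_synonym 'm lframe = "'m set \<times> ('m \<Rightarrow> quat \<Rightarrow> 'm tvec)"
type_synonym 'm spinor = "('m \<times> 'm lframe \<times> quat) set"

text \<open>An open cover of \<open>M\<close> with smooth oriented orthonormal trivializations of the tangent bundle
  in which $J$ is left multiplication by $i$. The resulting $SO(4)$-cocycle takes values in $U(2)$.\<close>

definition unitary_frames :: "'m ah_manifold \<Rightarrow> 'm lframe set \<Rightarrow> bool" where
  "unitary_frames M A \<longleftrightarrow>
     (\<Union>F\<in>A. fst F) = topspace (topo M) \<and>
     (\<forall>F\<in>A. openin (topo M) (fst F) \<and>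
        (\<forall>x\<in>fst F. oriented_isometry M x (snd F x) \<and>
           (\<forall>a. snd F x (qmul qi a) = cplx M (snd F x a))) \<and>
        (\<forall>a. smooth_section M (TM M) (fst F) (\<lambda>x. snd F x a)))"

text \<open>The element \<open>u\<close> of $U(2)$ with $e = e' \circ u$.\<close>

definition U2_change :: "(quat \<Rightarrow> 't) \<Rightarrow> (quat \<Rightarrow> 't) \<Rightarrow> (complex \<times> quat) set" where
  "U2_change e e' = (THE u. u \<in> U2 \<and> (\<forall>a. e' (U2_act u a) = e a))"

definition spinc_cocycle :: "'m lframe \<Rightarrow> 'm lframe \<Rightarrow> 'm \<Rightarrow> (complex \<times> quat \<times> quat) set" where
  "spinc_cocycle F G x = U2_to_SpinC (U2_change (snd F x) (snd G x))"

definition Wplus :: "'m lframe set \<Rightarrow> ('m lframe, 'm, quat) cocycle" where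
  "Wplus A = \<lparr>cc_idx = A, cc_dom = fst,
     cc_tr = (\<lambda>F G x. U2_act (SpinC_to_U2_plus (spinc_cocycle F G x)))\<rparr>"

definition Wminus :: "'m lframe set \<Rightarrow> ('m lframe, 'm, quat) cocycle" where
  "Wminus A = \<lparr>cc_idx = A, cc_dom = fst,
     cc_tr = (\<lambda>F G x. U2_act (SpinC_to_U2_minus (spinc_cocycle F G x)))\<rparr>"

text \<open>The Hermitian bundle glued from a $U(2)$-cocycle.\<close>

definition spinor_bundle ::
    "'m ah_manifold \<Rightarrow> ('m lframe, 'm, quat) cocycle \<Rightarrow> ('m, 'm spinor) hbundle" where
  "spinor_bundle M C = \<lparr>hb_fibre = fibre C, hb_plus = fplus C,
     hb_scale = (\<lambda>x z \<phi>. cls C (idx_at C x) x (qmul (qof z) (coord (idx_at C x) \<phi>))),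
     hb_herm = (\<lambda>x \<phi> \<psi>. qherm (coord (idx_at C x) \<phi>) (coord (idx_at C x) \<psi>)),
     hb_smooth = smooth_section M C\<rparr>"

text \<open>A point \<open>x\<close> lies in the domain of one frame; any other one gives the same Clifford
  multiplication because the model is equivariant.\<close>

definition frame_at :: "'m lframe set \<Rightarrow> 'm \<Rightarrow> 'm lframe" where
  "frame_at A x = (SOME F. F \<in> A \<and> x \<in> fst F)"

definition clifford_plus :: "(quat \<Rightarrow> quat \<Rightarrow> quat) \<Rightarrow> 'm lframe set \<Rightarrow> 'm \<Rightarrow>
    'm tvec \<Rightarrow> 'm spinor \<Rightarrow> 'm spinor" where
  "clifford_plus cp A x v \<phi> = (let F = frame_at A x in
     cls (Wminus A) F x (cp (inv (snd F x) v) (coord F \<phi>)))"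

definition clifford_minus :: "(quat \<Rightarrow> quat \<Rightarrow> quat) \<Rightarrow> 'm lframe set \<Rightarrow> 'm \<Rightarrow>
    'm tvec \<Rightarrow> 'm spinor \<Rightarrow> 'm spinor" where
  "clifford_minus cm A x v \<psi> = (let F = frame_at A x in
     cls (Wplus A) F x (cm (inv (snd F x) v) (coord F \<psi>)))"


section \<open>The squaring map\<close>

text \<open>Complex-valued self-dual 2-forms at \<open>x\<close>, normalized to vanish on arguments that are not
  tangent vectors at \<open>x\<close>. The last clause is $*\eta = \eta$, evaluated in oriented orthonormal bases.\<close>

definition selfdual_form :: "'m ah_manifold \<Rightarrow> 'm \<Rightarrow> ('m tvec \<Rightarrow> 'm tvec \<Rightarrow> complex) \<Rightarrow> bool" where
  "selfdual_form M x \<eta> \<longleftrightarrow>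
     (\<forall>v w. v \<notin> tspace M x \<or> w \<notin> tspace M x \<longrightarrow> \<eta> v w = 0) \<and>
     (\<forall>u\<in>tspace M x. \<forall>v\<in>tspace M x. \<forall>w\<in>tspace M x. \<forall>r.
        \<eta> (fplus (TM M) x u v) w = \<eta> u w + \<eta> v w \<and>
        \<eta> (fscale (TM M) x r u) w = of_real r * \<eta> u w \<and>
        \<eta> v u = - \<eta> u v) \<and>
     (\<forall>f. oriented_isometry M x f \<longrightarrow>
        \<eta> (f q1) (f qi) = \<eta> (f qj) (f qk) \<and>
        \<eta> (f q1) (f qj) = \<eta> (f qk) (f qi) \<and>
        \<eta> (f q1) (f qk) = \<eta> (f qi) (f qj))"

text \<open>The Clifford action of 2-forms on the positive spinors. The metric identifies \<open>\<eta>\<close> with the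
  sum over \<open>a < b\<close> of $\eta(e_a,e_b)\, e_a\wedge e_b$ for an orthonormal basis $e$, and for \<open>a \<noteq> b\<close> the
  bivector $e_a \wedge e_b$ acts by $\varphi\mapsto e_a\bullet(e_b\bullet\varphi)$.\<close>

definition form_action :: "(quat \<Rightarrow> quat \<Rightarrow> quat) \<Rightarrow> (quat \<Rightarrow> quat \<Rightarrow> quat) \<Rightarrow> 'm lframe set \<Rightarrow> 'm \<Rightarrow>
    ('m tvec \<Rightarrow> 'm tvec \<Rightarrow> complex) \<Rightarrow> 'm spinor \<Rightarrow> 'm spinor" where
  "form_action cp cm A x \<eta> \<phi> =
     (let F = frame_at A x; e = (\<lambda>n. snd F x ([q1, qi, qj, qk] ! n)) in
      cls (Wplus A) F x (\<Sum>b<4. \<Sum>a<b. qmul (qof (\<eta> (e a) (e b)))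
        (coord F (clifford_minus cm A x (e a) (clifford_plus cp A x (e b) \<phi>)))))"

text \<open>The element $i\sigma(\varphi)$ of the complexification of $\Lambda^+$ that acts as
  $\langle\cdot,\varphi\rangle\varphi - \frac12\|\varphi\|^2$.\<close>

definition i_squaring :: "(quat \<Rightarrow> quat \<Rightarrow> quat) \<Rightarrow> (quat \<Rightarrow> quat \<Rightarrow> quat) \<Rightarrow> 'm ah_manifold \<Rightarrow>
    'm lframe set \<Rightarrow> 'm \<Rightarrow> 'm spinor \<Rightarrow> 'm tvec \<Rightarrow> 'm tvec \<Rightarrow> complex" where
  "i_squaring cp cm M A x \<phi> = (let W = spinor_bundle M (Wplus A) in
     THE \<eta>. selfdual_form M x \<eta> \<and>
       (\<forall>\<psi>\<in>hb_fibre W x. form_action cp cm A x \<eta> \<psi> =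
          hb_plus W x (hb_scale W x (hb_herm W x \<psi> \<phi>) \<phi>)
                      (hb_scale W x (- (1/2) * hb_herm W x \<phi> \<phi>) \<psi>)))"

definition squaring :: "(quat \<Rightarrow> quat \<Rightarrow> quat) \<Rightarrow> (quat \<Rightarrow> quat \<Rightarrow> quat) \<Rightarrow> 'm ah_manifold \<Rightarrow>
    'm lframe set \<Rightarrow> 'm \<Rightarrow> 'm spinor \<Rightarrow> 'm tvec \<Rightarrow> 'm tvec \<Rightarrow> complex" where
  "squaring cp cm M A x \<phi> v w = - \<i> * i_squaring cp cm M A x \<phi> v w"


section \<open>Structure-preserving maps and naturality\<close>

definition smooth_map :: "'m ah_manifold \<Rightarrow> 'm ah_manifold \<Rightarrow> ('m \<Rightarrow> 'm) \<Rightarrow> bool" where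
  "smooth_map M N h \<longleftrightarrow>
     continuous_map (topo M) (topo N) h \<and>
     (\<forall>c\<in>atlas M. \<forall>d\<in>atlas N. Cinf_on (snd d \<circ> h \<circ> inv_into (fst c) (snd c))
        (snd c ` {x \<in> fst c. h x \<in> fst d}))"

definition differential :: "'m ah_manifold \<Rightarrow> 'm ah_manifold \<Rightarrow> ('m \<Rightarrow> 'm) \<Rightarrow> 'm \<Rightarrow>
    'm tvec \<Rightarrow> 'm tvec" where
  "differential M N h x v = (let c = idx_at (TM M) x; d = idx_at (TM N) (h x) in
     cls (TM N) d (h x)
       (frechet_derivative (snd d \<circ> h \<circ> inv_into (fst c) (snd c)) (at (snd c x)) (coord c v)))"

text \<open>Smooth maps whose differential preserves metric and almost-complex structure: these include
  diffeomorphisms preserving the structures, inclusions of open subsets, coverings, and the identity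
  with two different atlases or frame covers.\<close>

definition ah_map :: "'m ah_manifold \<Rightarrow> 'm ah_manifold \<Rightarrow> ('m \<Rightarrow> 'm) \<Rightarrow> bool" where
  "ah_map M N h \<longleftrightarrow> smooth_map M N h \<and>
     (\<forall>x\<in>topspace (topo M). \<forall>v\<in>tspace M x. \<forall>w\<in>tspace M x.
        metric N (differential M N h x v) (differential M N h x w) = metric M v w \<and>
        differential M N h x (cplx M v) = cplx N (differential M N h x v))"

text \<open>In unitary frames the differential of such a map is given by an element of $U(2)$, which acts on
  spinors through $U(2) \to Spin^{\bf C}(4) \to U(2)$.\<close>

definition spinc_differential :: "'m ah_manifold \<Rightarrow> 'm ah_manifold \<Rightarrow> ('m \<Rightarrow> 'm) \<Rightarrow> 'm \<Rightarrow>
    'm lframe \<Rightarrow> 'm lframe \<Rightarrow> (complex \<times> quat \<times> quat) set" where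
  "spinc_differential M N h x F G =
     U2_to_SpinC (U2_change (\<lambda>a. differential M N h x (snd F x a)) (snd G (h x)))"

definition spinor_map_plus :: "'m ah_manifold \<Rightarrow> 'm lframe set \<Rightarrow> 'm ah_manifold \<Rightarrow> 'm lframe set \<Rightarrow>
    ('m \<Rightarrow> 'm) \<Rightarrow> 'm \<Rightarrow> 'm spinor \<Rightarrow> 'm spinor" where
  "spinor_map_plus M A N B h x \<phi> = (let F = frame_at A x; G = frame_at B (h x) in
     cls (Wplus B) G (h x)
       (U2_act (SpinC_to_U2_plus (spinc_differential M N h x F G)) (coord F \<phi>)))"

definition spinor_map_minus :: "'m ah_manifold \<Rightarrow> 'm lframe set \<Rightarrow> 'm ah_manifold \<Rightarrow> 'm lframe set \<Rightarrow>
    ('m \<Rightarrow> 'm) \<Rightarrow> 'm \<Rightarrow> 'm spinor \<Rightarrow> 'm spinor" where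
  "spinor_map_minus M A N B h x \<psi> = (let F = frame_at A x; G = frame_at B (h x) in
     cls (Wminus B) G (h x)
       (U2_act (SpinC_to_U2_minus (spinc_differential M N h x F G)) (coord F \<psi>)))"

text \<open>Commutation of \<open>\<Phi>m\<close> (from negative spinors to tangent vectors) and \<open>\<Phi>p\<close> (from positive
  spinors to endomorphisms of the tangent spaces) with the maps induced by all structure-preserving
  maps. On \<open>Hom(T_M, T_M)\<close> the induced map is conjugation by the differential.\<close>

definition natural_isos ::
    "('m ah_manifold \<Rightarrow> 'm lframe set \<Rightarrow> 'm \<Rightarrow> 'm spinor \<Rightarrow> 'm tvec) \<Rightarrow>
     ('m ah_manifold \<Rightarrow> 'm lframe set \<Rightarrow> 'm \<Rightarrow> 'm spinor \<Rightarrow> 'm tvec \<Rightarrow> 'm tvec) \<Rightarrow> bool" where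
  "natural_isos \<Phi>m \<Phi>p \<longleftrightarrow>
     (\<forall>M A N B h.
        almost_hermitian_4manifold M \<and> unitary_frames M A \<and>
        almost_hermitian_4manifold N \<and> unitary_frames N B \<and> ah_map M N h \<longrightarrow>
        (\<forall>x\<in>topspace (topo M).
           (\<forall>\<psi>\<in>fibre (Wminus A) x.
              \<Phi>m N B (h x) (spinor_map_minus M A N B h x \<psi>)
                = differential M N h x (\<Phi>m M A x \<psi>)) \<and>
           (\<forall>\<phi>\<in>fibre (Wplus A) x. \<forall>v\<in>tspace M x.
              \<Phi>p N B (h x) (spinor_map_plus M A N B h x \<phi>) (differential M N h x v)
                = differential M N h x (\<Phi>p M A x \<phi> v))))"

end

theory Submission
  imports Defs
begin

text \<open>Equivariance under $Spin^{\bf C}(4)$ forces the model Clifford multiplication to be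
  \<open>v \<bullet> \<phi> = k \<phi> v\<close> (a product of quaternions) for a unit complex number \<open>k\<close>. In a unitary frame
  the negative spinors have the transition functions of the tangent bundle, and the positive spinors
  transform by $\varphi \mapsto \lambda \varphi \lambda^{-1}$, which is the transformation of left multiplications.
  So \<open>\<psi>\<close> is sent to the tangent vector with coordinates \<open>k\<^sup>-\<^sup>1 \<psi>\<close> and \<open>\<phi>\<close> to the left
  multiplication by \<open>\<phi>\<close>. For the squaring map, a self-dual form acts on spinors by right
  multiplication with an imaginary quaternion with complex coefficients, and the claim becomes the identity
  $-\frac12 i \psi \bar\varphi i \varphi = \langle\psi,\varphi\rangle\varphi - \frac12 |\varphi|^2 \psi$.\<close>

text \<open>Members of \<open>pso_fibre\<close> and self-dual forms are defined through arbitrary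
  oriented isometries, not only unitary frames. What ties them to quaternions is that an
  orientation-preserving isometry \<open>R\<close> of the quaternions satisfies R(a b) = s(a) R(b)
  with an algebra automorphism \<open>s\<close>: left multiplications go to left multiplications, so
  a single frame describes them all. Orientation decides one sign, s(k) = s(i) s(j). The Clifford
  constant \<open>k\<close> cancels in the composite of \<open>cp\<close> and \<open>cm\<close>, so
  2-forms do not see it. The 1/4 of the squaring map arises because self-duality makes the six
  bivector terms pair up: a self-dual form acts with a factor -2, and i/4 becomes the -i/2 of the
  identity. The frame chosen at a point may jump from point to point. The maps are therefore first
  shown to be independent of the frame, and smoothness is then read in one chart and one frame,
  where only sums and bilinear products of smooth functions occur.\<close>

lemma quat_eq_iff:
  "(a::quat) = b \<longleftrightarrow> Re (fst a) = Re (fst b) \<and> Im (fst a) = Im (fst b) \<and>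
     Re (snd a) = Re (snd b) \<and> Im (snd a) = Im (snd b)"
  by (auto simp: prod_eq_iff complex_eq_iff)

lemma inner_quat:
  "inner (a::quat) b = Re (fst a) * Re (fst b) + Im (fst a) * Im (fst b)
     + Re (snd a) * Re (snd b) + Im (snd a) * Im (snd b)"
  by (simp add: inner_prod_def inner_complex_def)

lemmas quat_defs = qmul_def qconj_def qof_def q1_def qi_def qj_def qk_def

section \<open>Quaternion arithmetic\<close>

lemma qmul_assoc: "qmul (qmul a b) c = qmul a (qmul b c)"
  by (simp add: quat_defs algebra_simps)

lemma qmul_q1 [simp]: "qmul q1 a = a" "qmul a q1 = a"
  by (simp_all add: quat_defs)

lemma qconj_q1 [simp]: "qconj q1 = q1"
  by (simp add: quat_defs)

lemma qconj_qconj [simp]: "qconj (qconj a) = a"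
  by (simp add: quat_defs)

lemma qconj_qmul: "qconj (qmul a b) = qmul (qconj b) (qconj a)"
  by (simp add: quat_defs algebra_simps)

lemma qmul_qconj: "qmul a (qconj a) = (norm a)\<^sup>2 *\<^sub>R q1" "qmul (qconj a) a = (norm a)\<^sup>2 *\<^sub>R q1"
  unfolding power2_norm_eq_inner
  by (simp_all add: quat_eq_iff quat_defs inner_quat algebra_simps)

text \<open>Serves twice: as the source of the distributive rules \<open>qmul_simps\<close>, and as
  input to the product rule for smooth functions.\<close>

lemma bounded_bilinear_qmul: "bounded_bilinear qmul"
proof -
  have "bilinear qmul"
    unfolding bilinear_def
    by (intro conjI allI linearI; simp add: quat_eq_iff qmul_def; simp add: algebra_simps)
  then show ?thesis by (simp add: bilinear_conv_bounded_bilinear)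
qed

lemmas qmul_simps =
  bounded_bilinear.add_left[OF bounded_bilinear_qmul]
  bounded_bilinear.add_right[OF bounded_bilinear_qmul]
  bounded_bilinear.diff_left[OF bounded_bilinear_qmul]
  bounded_bilinear.diff_right[OF bounded_bilinear_qmul]
  bounded_bilinear.minus_left[OF bounded_bilinear_qmul]
  bounded_bilinear.minus_right[OF bounded_bilinear_qmul]
  bounded_bilinear.scaleR_left[OF bounded_bilinear_qmul]
  bounded_bilinear.scaleR_right[OF bounded_bilinear_qmul]

lemma linear_qmul: "linear (qmul a)" "linear (\<lambda>b. qmul b a)"
  by (rule linearI; simp add: qmul_simps)+

lemma inner_qmul_left: "inner (qmul a b) c = inner b (qmul (qconj a) c)"
  by (simp add: inner_quat quat_defs algebra_simps)

lemma inner_qmul_right: "inner (qmul a b) c = inner a (qmul c (qconj b))"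
  by (simp add: inner_quat quat_defs algebra_simps)

lemma inner_qmul_same: "inner (qmul a b) (qmul c b) = (norm b)\<^sup>2 * inner a c"
  unfolding power2_norm_eq_inner
  by (simp add: inner_quat quat_defs algebra_simps)

lemma inner_qmul_same_left: "inner (qmul a b) (qmul a c) = (norm a)\<^sup>2 * inner b c"
  unfolding power2_norm_eq_inner
  by (simp add: inner_quat quat_defs algebra_simps)

lemma norm_qmul [simp]: "norm (qmul a b) = norm a * norm b"
proof -
  have "(norm (qmul a b))\<^sup>2 = (norm a * norm b)\<^sup>2"
    unfolding power_mult_distrib power2_norm_eq_inner
    by (simp add: inner_quat quat_defs algebra_simps)
  then show ?thesis by simp
qed

lemma norm_qconj [simp]: "norm (qconj a) = norm a"
  by (simp add: qconj_def norm_prod_def)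

lemma norm_qof [simp]: "norm (qof z) = norm z"
  by (simp add: qof_def norm_prod_def)

lemma norm_qunits [simp]: "norm q1 = 1" "norm qi = 1" "norm qj = 1" "norm qk = 1"
  by (simp_all add: quat_defs norm_prod_def)

lemma qof_mult: "qmul (qof z) (qof w) = qof (z * w)"
  by (simp add: quat_defs)

lemma qof_1 [simp]: "qof 1 = q1"
  by (simp add: quat_defs)

lemma qof_i: "qof \<i> = qi"
  by (simp add: quat_defs)

text \<open>Reduces complex linearity to commutation with \<open>qi\<close>, which is what a unitary
  frame provides through J.\<close>

lemma qof_scale: "qmul (qof z) a = Re z *\<^sub>R a + Im z *\<^sub>R qmul qi a"
  by (simp add: quat_eq_iff quat_defs algebra_simps)

lemma qof_cnj_cancel:
  assumes "norm z = 1"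
  shows "qmul (qof (cnj z)) (qmul (qof z) a) = a" "qmul (qof z) (qmul (qof (cnj z)) a) = a"
proof -
  have "z * cnj z = 1" using assms by (simp add: complex_norm_square[symmetric])
  then show "qmul (qof (cnj z)) (qmul (qof z) a) = a" "qmul (qof z) (qmul (qof (cnj z)) a) = a"
    by (simp_all add: qmul_assoc[symmetric] qof_mult mult.commute)
qed

lemma qinv_unit: "norm a = 1 \<Longrightarrow> qinv a = qconj a"
  by (simp add: qinv_def)

lemma qmul_unit_cancel:
  assumes "norm a = 1"
  shows "qmul (qmul b a) (qconj a) = b" "qmul (qmul b (qconj a)) a = b"
    "qmul (qconj a) (qmul a b) = b" "qmul a (qmul (qconj a) b) = b"
  using assms by (simp_all add: qmul_assoc qmul_qconj qmul_simps)
    (simp_all add: qmul_assoc[symmetric] qmul_qconj qmul_simps)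

lemma qmul_right_cancel:
  assumes "a \<noteq> 0" "qmul b a = qmul c a"
  shows "b = c"
proof -
  have "qmul (qmul b a) (qconj a) = qmul (qmul c a) (qconj a)" using assms by simp
  then have "(norm a)\<^sup>2 *\<^sub>R b = (norm a)\<^sup>2 *\<^sub>R c" by (simp add: qmul_assoc qmul_qconj qmul_simps)
  then show ?thesis using assms by simp
qed

lemma quat_expand:
  "a = Re (fst a) *\<^sub>R q1 + Im (fst a) *\<^sub>R qi + Re (snd a) *\<^sub>R qj + Im (snd a) *\<^sub>R qk"
  by (simp add: quat_eq_iff quat_defs)

lemma linear_quat_eqI:
  fixes f g :: "quat \<Rightarrow> 'a::real_vector"
  assumes "linear f" "linear g" "f q1 = g q1" "f qi = g qi" "f qj = g qj" "f qk = g qk"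
  shows "f a = g a"
proof -
  have "f a = Re (fst a) *\<^sub>R f q1 + Im (fst a) *\<^sub>R f qi + Re (snd a) *\<^sub>R f qj + Im (snd a) *\<^sub>R f qk"
    by (subst quat_expand) (simp add: assms(1) linear_add linear_scale)
  also have "\<dots> = Re (fst a) *\<^sub>R g q1 + Im (fst a) *\<^sub>R g qi + Re (snd a) *\<^sub>R g qj + Im (snd a) *\<^sub>R g qk"
    using assms by simp
  also have "\<dots> = g a"
    by (subst (5) quat_expand) (simp add: assms(2) linear_add linear_scale)
  finally show ?thesis .
qed

lemma inner_quat_units:
  "inner a q1 = Re (fst a)" "inner a qi = Im (fst a)" "inner a qj = Re (snd a)" "inner a qk = Im (snd a)"
  by (simp_all add: inner_quat quat_defs)

text \<open>Since Im z = Re(-i z), a Hermitian form linear in the first argument is fixed by its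
  real part. \<open>T_omega\<close> and \<open>PSO_omega\<close> are built from this formula, so a
  complex linear isometry preserves their Hermitian forms.\<close>

lemma qherm_conv: "qherm a b = Complex (inner a b) (- inner (qmul qi a) b)"
  by (simp add: complex_eq_iff qherm_def inner_quat quat_defs)

lemma qherm_qof: "qherm (qmul (qof z) a) b = z * qherm a b"
  "qherm a (qmul (qof z) b) = cnj z * qherm a b"
  by (simp_all add: qherm_def quat_defs algebra_simps)

lemma qherm_self: "qherm a a = of_real ((norm a)\<^sup>2)"
  unfolding power2_norm_eq_inner by (simp add: complex_eq_iff qherm_def inner_quat)


section \<open>Isometries of the quaternions\<close>

lemma linear_isometry_bij:
  fixes R :: "'a::euclidean_space \<Rightarrow> 'a"
  assumes "linear R" "\<And>a b. inner (R a) (R b) = inner a b"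
  shows "bij R"
proof -
  have "norm (R a) = norm a" for a using assms(2) by (simp add: norm_eq_sqrt_inner)
  then have "inj R" using assms(1) by (metis linear_injective_0 norm_eq_zero)
  then show ?thesis using assms(1) by (simp add: bij_def linear_injective_imp_surjective)
qed

text \<open>Expansion along the first row, from splitting the sum over permutations one index at a
  time; it turns determinants into polynomials in the entries.\<close>

lemma det_4:
  "det (A::'a::comm_ring_1^4^4) =
    A$1$1 * (A$2$2 * (A$3$3 * A$4$4 - A$3$4 * A$4$3) - A$2$3 * (A$3$2 * A$4$4 - A$3$4 * A$4$2)
      + A$2$4 * (A$3$2 * A$4$3 - A$3$3 * A$4$2))
  - A$1$2 * (A$2$1 * (A$3$3 * A$4$4 - A$3$4 * A$4$3) - A$2$3 * (A$3$1 * A$4$4 - A$3$4 * A$4$1)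
      + A$2$4 * (A$3$1 * A$4$3 - A$3$3 * A$4$1))
  + A$1$3 * (A$2$1 * (A$3$2 * A$4$4 - A$3$4 * A$4$2) - A$2$2 * (A$3$1 * A$4$4 - A$3$4 * A$4$1)
      + A$2$4 * (A$3$1 * A$4$2 - A$3$2 * A$4$1))
  - A$1$4 * (A$2$1 * (A$3$2 * A$4$3 - A$3$3 * A$4$2) - A$2$2 * (A$3$1 * A$4$3 - A$3$3 * A$4$1)
      + A$2$3 * (A$3$1 * A$4$2 - A$3$2 * A$4$1))"
proof -
  have f1: "finite {2::4, 3, 4}" "1 \<notin> {2::4, 3, 4}" by auto
  have f2: "finite {3::4, 4}" "2 \<notin> {3::4, 4}" by auto
  have f3: "finite {4::4}" "3 \<notin> {4::4}" by auto
  show ?thesis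
    unfolding det_def UNIV_4
    unfolding sum_over_permutations_insert[OF f1]
    unfolding sum_over_permutations_insert[OF f2]
    unfolding sum_over_permutations_insert[OF f3]
    unfolding permutes_sing
    by (simp add: sign_swap_id permutation_swap_id sign_compose sign_id swap_id_eq permutation_compose)
       (simp add: algebra_simps)
qed

lemma vector_4:
  "(vector [a, b, c, d] :: 'a::zero^4) $ 1 = a" "(vector [a, b, c, d] :: 'a::zero^4) $ 2 = b"
  "(vector [a, b, c, d] :: 'a::zero^4) $ 3 = c" "(vector [a, b, c, d] :: 'a::zero^4) $ 4 = d"
  by (simp_all add: vector_def)

definition quat_vec :: "quat \<Rightarrow> real^4" where
  "quat_vec a = vector [Re (fst a), Im (fst a), Re (snd a), Im (snd a)]"

text \<open>The left entry of the inner product is twice the triple cross product of quaternions,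
  orthogonal to \<open>a\<close>, \<open>b\<close> and \<open>c\<close>. On \<open>q1\<close>,
  \<open>qi\<close>, \<open>qj\<close>, \<open>qk\<close> both sides equal 2.\<close>

lemma det_quat_vec:
  "2 * det (vector [quat_vec a, quat_vec b, quat_vec c, quat_vec d] :: real^4^4)
    = inner (qmul (qmul c (qconj b)) a - qmul (qmul a (qconj b)) c) d"
  by (simp add: det_4 vector_4 quat_vec_def inner_quat qmul_def qconj_def) (simp add: algebra_simps)

text \<open>The matrix of images factors through the images of the basis. This compares the chart
  determinants of two frames in any chart.\<close>

lemma det_linear_quat:
  fixes P :: "quat \<Rightarrow> real^4"
  assumes "linear P"
  shows "det (vector [P a, P b, P c, P d] :: real^4^4)
    = det (vector [quat_vec a, quat_vec b, quat_vec c, quat_vec d] :: real^4^4)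
      * det (vector [P q1, P qi, P qj, P qk] :: real^4^4)"
proof -
  have P: "P a = Re (fst a) *\<^sub>R P q1 + Im (fst a) *\<^sub>R P qi + Re (snd a) *\<^sub>R P qj + Im (snd a) *\<^sub>R P qk" for a
    by (subst quat_expand) (simp add: assms linear_add linear_scale)
  have "(vector [P a, P b, P c, P d] :: real^4^4)
    = vector [quat_vec a, quat_vec b, quat_vec c, quat_vec d] ** vector [P q1, P qi, P qj, P qk]"
    unfolding P[of a] P[of b] P[of c] P[of d]
    by (simp add: vec_eq_iff forall_4 matrix_matrix_mult_def sum_4 vector_4 quat_vec_def)
  then show ?thesis by (simp add: det_mul)
qed

lemma qunit_table:
  "qmul qi qi = - q1" "qmul qj qj = - q1" "qmul qk qk = - q1"
  "qmul qi qj = qk" "qmul qj qk = qi" "qmul qk qi = qj"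
  "qmul qj qi = - qk" "qmul qk qj = - qi" "qmul qi qk = - qj"
  by (simp_all add: quat_eq_iff quat_defs)

lemma inner_qunits:
  "inner qi q1 = 0" "inner qj q1 = 0" "inner qk q1 = 0" "inner qi qj = 0" "inner qi qk = 0"
  "inner qj qk = 0" "inner qi qi = 1" "inner qj qj = 1" "inner qk qk = 1" "inner q1 q1 = 1"
  "inner qj qi = 0" "inner qk qi = 0" "inner qk qj = 0"
  by (simp_all add: inner_quat quat_defs)

text \<open>Up to the factor \<open>R q1\<close>, a rotation of the quaternions that preserves the orientation is an
  algebra homomorphism.\<close>

lemma rotation_qmul:
  fixes R :: "quat \<Rightarrow> quat"
  assumes R: "linear R" and iso: "\<And>a b. inner (R a) (R b) = inner a b"
    and pos: "det (vector [quat_vec (R q1), quat_vec (R qi), quat_vec (R qj), quat_vec (R qk)] :: real^4^4) > 0"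
  shows "R (qmul a b) = qmul (qmul (R a) (qconj (R q1))) (R b)"
proof -
  have nR: "norm (R a) = norm a" for a by (simp add: norm_eq_sqrt_inner iso)
  \<comment> \<open>Dividing by \<open>R q1\<close> makes the map fix \<open>q1\<close>, a necessary
    property of an algebra homomorphism.\<close>
  define s where "s a = qmul (R a) (qconj (R q1))" for a
  have Rs: "R a = qmul (s a) (R q1)" for a
    by (simp add: s_def qmul_unit_cancel nR)
  have lin_s: "linear s"
    unfolding s_def using linear_compose[OF R linear_qmul(2)[of "qconj (R q1)"]] by (simp add: o_def)
  have s_iso: "inner (s a) (s b) = inner a b" for a b
    by (simp add: s_def inner_qmul_same nR iso)
  have s1: "s q1 = q1" by (simp add: s_def qmul_qconj nR)
  have im: "qconj (s a) = - s a" if "inner a q1 = 0" for a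
  proof -
    have "inner (s a) q1 = 0" using s_iso[of a q1] that s1 by simp
    then show ?thesis by (simp add: inner_quat_units quat_eq_iff qconj_def)
  qed
  \<comment> \<open>Polarizes the identity that a quaternion times its conjugate is its squared
    length; on imaginary quaternions conjugation is a sign.\<close>
  have anti: "qmul (s a) (s b) = - qmul (s b) (s a) - (2 * inner a b) *\<^sub>R q1"
    if "inner a q1 = 0" "inner b q1 = 0" for a b
  proof -
    have *: "qmul x (qconj y) + qmul y (qconj x) = (2 * inner x y) *\<^sub>R q1" for x y
      by (simp add: quat_eq_iff quat_defs inner_quat algebra_simps)
    have "- (qmul (s a) (s b) + qmul (s b) (s a)) = (2 * inner a b) *\<^sub>R q1"
      using *[of "s a" "s b"] that by (simp add: im qmul_simps s_iso)
    then have "qmul (s a) (s b) + qmul (s b) (s a) = - ((2 * inner a b) *\<^sub>R q1)"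
      by (metis minus_minus)
    then have "qmul (s a) (s b) = - ((2 * inner a b) *\<^sub>R q1) - qmul (s b) (s a)"
      by (metis add_diff_cancel_right')
    then show ?thesis by simp
  qed
  have sq: "qmul (s a) (s a) = - q1" if "inner a q1 = 0" "inner a a = 1" for a
  proof -
    have "qmul (s a) (qconj (s a)) = q1"
      using s_iso[of a a] that by (simp add: qmul_qconj power2_norm_eq_inner)
    then show ?thesis using that by (simp add: im qmul_simps) (metis minus_minus)
  qed
  have sji: "qmul (s qj) (s qi) = - qmul (s qi) (s qj)"
    using anti[of qj qi] by (simp add: inner_qunits)
  have sii: "qmul (s qi) (s qi) = - q1" "qmul (s qj) (s qj) = - q1"
    by (simp_all add: sq inner_qunits)
  \<comment> \<open>Orientation enters here: the product is a unit vector orthogonal to the images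
    of 1, i and j, hence plus or minus \<open>s qk\<close>, and the determinant selects
    plus.\<close>
  have sk: "s qk = qmul (s qi) (s qj)"
  proof -
    let ?n = "qmul (s qi) (s qj)"
    have "bij s" using lin_s s_iso by (rule linear_isometry_bij)
    then obtain m where m: "s m = ?n" by (metis bij_pointE)
    have "inner m q1 = 0"
      using s_iso[of m q1] s_iso[of qj qi]
      by (simp add: m s1 inner_qmul_left im inner_qunits)
    moreover have "inner m qi = 0"
      using s_iso[of m qi] s_iso[of qj q1]
      by (simp add: m s1 inner_qmul_left im inner_qunits qmul_simps sii)
    moreover have "inner m qj = 0"
      using s_iso[of m qj] s_iso[of qi q1]
      by (simp add: m s1 inner_qmul_right im inner_qunits qmul_simps sii)
    moreover have "norm m = 1"
    proof -
      have ns: "norm (s a) = norm a" for a by (simp add: norm_eq_sqrt_inner s_iso)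
      show ?thesis using ns[of m] by (simp add: m ns)
    qed
    ultimately have m0: "Re (fst m) = 0" "Im (fst m) = 0" "Re (snd m) = 0" "norm m = 1"
      by (simp_all only: inner_quat_units)
    then have pm: "m = Im (snd m) *\<^sub>R qk" "\<bar>Im (snd m)\<bar> = 1"
      by (auto simp: quat_eq_iff quat_defs norm_prod_def cmod_def)
    have "0 < 2 * det (vector [quat_vec (R q1), quat_vec (R qi), quat_vec (R qj), quat_vec (R qk)] :: real^4^4)"
      using pos by simp
    also have "\<dots> = 2 * inner ?n (s qk)"
    proof -
      have 1: "qmul (qmul (R qj) (qconj (R qi))) (R q1) = - qmul (qmul (s qj) (s qi)) (R q1)"
        by (subst Rs[of qj], subst Rs[of qi])
          (simp add: qconj_qmul im inner_qunits qmul_simps qmul_assoc qmul_unit_cancel nR)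
      have 2: "qmul (qmul (R q1) (qconj (R qi))) (R qj) = - qmul ?n (R q1)"
        by (subst Rs[of qj], subst Rs[of qi])
          (simp add: qconj_qmul im inner_qunits qmul_simps qmul_assoc qmul_unit_cancel nR)
      show ?thesis
        unfolding det_quat_vec 1 2 sji
        by (subst Rs[of qk]) (simp add: qmul_simps inner_diff_left inner_add_left inner_qmul_same nR)
    qed
    also have "\<dots> = 2 * Im (snd m)"
      by (simp add: m[symmetric] s_iso inner_quat_units)
    finally have "Im (snd m) = 1" using pm(2) by simp
    then show ?thesis using pm m by simp
  qed
  have sik: "qmul (s qi) (qmul (s qi) x) = - x" "qmul (s qj) (qmul (s qj) x) = - x"
    "qmul (s qj) (qmul (s qi) x) = - qmul (s qi) (qmul (s qj) x)" for x
    by (simp_all add: qmul_assoc[symmetric] sii sji qmul_simps)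
  have lin1: "linear (\<lambda>b. s (qmul a b))" "linear (\<lambda>b. s (qmul b a))"
     "linear (\<lambda>b. qmul (s a) (s b))" "linear (\<lambda>b. qmul (s b) (s a))" for a
    using linear_compose[OF linear_qmul(1) lin_s] linear_compose[OF linear_qmul(2) lin_s]
      linear_compose[OF lin_s linear_qmul(1)] linear_compose[OF lin_s linear_qmul(2)]
    by (simp_all add: o_def)
  have neg: "s (- a) = - s a" for a using lin_s by (rule linear_neg)
  \<comment> \<open>Both sides are bilinear, which leaves the sixteen products of basis
    units.\<close>
  have "s (qmul a b) = qmul (s a) (s b)"
    by (rule linear_quat_eqI[OF lin1(1,3)]; rule linear_quat_eqI[OF lin1(2,4)])
      (simp_all add: qunit_table s1 sk sii sji sik neg qmul_simps qmul_assoc)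
  then show ?thesis
    by (subst Rs) (simp add: s_def[symmetric] qmul_assoc Rs[symmetric])
qed

section \<open>Smooth functions\<close>

text \<open>Openness makes agreement on \<open>S\<close> sufficient: a derivative at a point of
  \<open>S\<close> depends only on a neighbourhood.\<close>

lemma Ck_on_cong:
  assumes "open S" "\<And>x. x \<in> S \<Longrightarrow> f x = g x" "Ck_on k f S"
  shows "Ck_on k g S"
  using assms(2,3)
proof (induction k arbitrary: f g)
  case 0
  from 0(2) have "continuous_on S f" unfolding Ck_on.simps .
  then have "continuous_on S g" by (rule continuous_on_eq) (rule 0(1))
  then show ?case unfolding Ck_on.simps .
next
  case (Suc k)
  have der: "(g has_derivative frechet_derivative f (at x)) (at x)" if "x \<in> S" for x
  proof (rule has_derivative_transform_within_open[OF _ assms(1) that])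
    show "(f has_derivative frechet_derivative f (at x)) (at x)"
      using Suc.prems(2) that by (auto simp: frechet_derivative_works[symmetric])
  qed (rule Suc.prems(1))
  then have eq: "frechet_derivative f (at x) v = frechet_derivative g (at x) v" if "x \<in> S" for x v
    using frechet_derivative_at[OF der[OF that]] by simp
  have "Ck_on k (\<lambda>x. frechet_derivative f (at x) v) S" for v
    using Suc.prems(2) unfolding Ck_on.simps by blast
  then have "Ck_on k (\<lambda>x. frechet_derivative g (at x) v) S" for v
    by (rule Suc.IH[rotated]) (rule eq)
  moreover have "g differentiable (at x)" if "x \<in> S" for x
    using der[OF that] by (rule differentiableI)
  ultimately show ?case unfolding Ck_on.simps by blast
qed

text \<open>The clause for \<open>Suc k\<close> does not mention continuity; at the bottom of the
  induction it comes from differentiability.\<close>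

lemma Ck_on_SucD: "Ck_on (Suc k) f S \<Longrightarrow> Ck_on k f S"
proof (induction k arbitrary: f)
  case 0
  then show ?case
    by (simp add: differentiable_imp_continuous_within continuous_on_eq_continuous_within
        continuous_at_imp_continuous_within)
next
  case (Suc k)
  then show ?case by (metis Ck_on.simps(2))
qed

lemma Ck_on_subset: "Ck_on k f S \<Longrightarrow> T \<subseteq> S \<Longrightarrow> Ck_on k f T"
  by (induction k arbitrary: f) (auto intro: continuous_on_subset)

text \<open>Differentiability at a point is already local; openness of the pieces is what glues
  continuity.\<close>

lemma Ck_on_Union:
  "(\<And>T. T \<in> \<T> \<Longrightarrow> open T \<and> Ck_on k f T) \<Longrightarrow> Ck_on k f (\<Union>\<T>)"
proof (induction k arbitrary: f)
  case 0
  then show ?case using continuous_on_open_Union[of \<T> f] by simp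
next
  case (Suc k)
  then show ?case by simp
qed

lemma Ck_on_const: "Ck_on k (\<lambda>x. c) S"
  by (induction k arbitrary: c) simp_all

text \<open>Lets inductions on the order use an explicit derivative formula in place of
  \<open>frechet_derivative\<close>.\<close>

lemma Ck_on_SucI:
  assumes "open S" "\<And>x. x \<in> S \<Longrightarrow> (f has_derivative f' x) (at x)"
    "\<And>v. Ck_on k (\<lambda>x. f' x v) S"
  shows "Ck_on (Suc k) f S"
proof -
  have "f' x v = frechet_derivative f (at x) v" if "x \<in> S" for x v
    using frechet_derivative_at[OF assms(2)[OF that]] by simp
  then have "Ck_on k (\<lambda>x. frechet_derivative f (at x) v) S" for v
    by (rule Ck_on_cong[OF assms(1) _ assms(3)])
  then show ?thesis using assms(2) by (auto simp: differentiable_def)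
qed

lemma Ck_on_add:
  assumes "open S" "Ck_on k f S" "Ck_on k g S"
  shows "Ck_on k (\<lambda>x. f x + g x) S"
  using assms(2,3)
proof (induction k arbitrary: f g)
  case 0
  then show ?case by (simp add: continuous_on_add)
next
  case (Suc k)
  show ?case
  proof (rule Ck_on_SucI[OF assms(1)])
    show "((\<lambda>x. f x + g x) has_derivative
        (\<lambda>v. frechet_derivative f (at x) v + frechet_derivative g (at x) v)) (at x)"
      if "x \<in> S" for x
      using Suc.prems that by (intro has_derivative_add) (simp_all add: frechet_derivative_works[symmetric])
  qed (use Suc in auto)
qed

text \<open>Leibniz rule: the derivative is a sum of two expressions of the same bilinear kind, so
  the induction runs over both functions at once, the undifferentiated factor being lowered by one
  order.\<close>

lemma Ck_on_bilinear:
  assumes "open S" "bounded_bilinear h" "Ck_on k f S" "Ck_on k g S"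
  shows "Ck_on k (\<lambda>x. h (f x) (g x)) S"
  using assms(3,4)
proof (induction k arbitrary: f g)
  case 0
  then show ?case by (simp add: bounded_bilinear.continuous_on[OF assms(2)])
next
  case (Suc k)
  show ?case
  proof (rule Ck_on_SucI[OF assms(1)])
    show "((\<lambda>x. h (f x) (g x)) has_derivative
        (\<lambda>v. h (f x) (frechet_derivative g (at x) v) + h (frechet_derivative f (at x) v) (g x))) (at x)"
      if "x \<in> S" for x
      using Suc.prems that
      by (intro bounded_bilinear.FDERIV[OF assms(2)]) (simp_all add: frechet_derivative_works[symmetric])
    show "Ck_on k (\<lambda>x. h (f x) (frechet_derivative g (at x) v)
        + h (frechet_derivative f (at x) v) (g x)) S" for v
      using Suc.prems Suc.prems[THEN Ck_on_SucD] by (intro Ck_on_add assms(1) Suc.IH) auto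
  qed
qed

lemma Cinf_on_differentiable: "Cinf_on f S \<Longrightarrow> x \<in> S \<Longrightarrow> f differentiable (at x)"
  unfolding Cinf_on_def by (metis Ck_on.simps(2))

lemma homeomorphic_map_open_image:
  assumes "homeomorphic_map (subtopology X U) (top_of_set (f ` U)) f" "open (f ` U)"
    "openin X U" "openin X S"
  shows "open (f ` (S \<inter> U))"
proof -
  have "openin (subtopology X U) (S \<inter> U)"
    using assms(4) by (auto simp: openin_subtopology)
  then have "openin (top_of_set (f ` U)) (f ` (S \<inter> U))"
    using homeomorphic_imp_open_map[OF assms(1)] by (simp add: open_map_def)
  then show ?thesis using assms(2) openin_open_eq by blast
qed

section \<open>Smooth functions on a 4-manifold\<close>

locale manifold4 =
  fixes M :: "'m ah_manifold"
  assumes manifold: "oriented_4manifold M"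
begin

lemma chart_openin: "c \<in> atlas M \<Longrightarrow> openin (topo M) (fst c)"
  and chart_cover: "(\<Union>c\<in>atlas M. fst c) = topspace (topo M)"
  using manifold by (auto simp: oriented_4manifold_def)

lemma chart_open_image: "c \<in> atlas M \<Longrightarrow> openin (topo M) S \<Longrightarrow> open (snd c ` (S \<inter> fst c))"
  using manifold by (auto simp: oriented_4manifold_def intro!: homeomorphic_map_open_image)

lemma chart_inj:
  assumes "c \<in> atlas M" shows "inj_on (snd c) (fst c)"
proof -
  have "homeomorphic_map (subtopology (topo M) (fst c)) (top_of_set (snd c ` fst c)) (snd c)"
    using manifold assms by (auto simp: oriented_4manifold_def)
  then have "inj_on (snd c) (topspace (topo M) \<inter> fst c)"
    by (auto dest: homeomorphic_imp_injective_map)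
  moreover have "topspace (topo M) \<inter> fst c = fst c" using chart_cover assms by blast
  ultimately show ?thesis by simp
qed

lemma chart_inv [simp]: "c \<in> atlas M \<Longrightarrow> y \<in> fst c \<Longrightarrow> inv_into (fst c) (snd c) (snd c y) = y"
  using chart_inj by (rule inv_into_f_f)

lemma smooth_fun_cong:
  assumes "openin (topo M) S" "\<And>x. x \<in> S \<Longrightarrow> f x = g x" "smooth_fun M S f"
  shows "smooth_fun M S g"
  unfolding smooth_fun_def Cinf_on_def
proof (intro ballI allI)
  fix c k assume c: "c \<in> atlas M"
  show "Ck_on k (g \<circ> inv_into (fst c) (snd c)) (snd c ` (S \<inter> fst c))"
  proof (rule Ck_on_cong[OF chart_open_image[OF c assms(1)]])
    show "Ck_on k (f \<circ> inv_into (fst c) (snd c)) (snd c ` (S \<inter> fst c))"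
      using assms(3) c by (simp add: smooth_fun_def Cinf_on_def)
  qed (use c assms(2) in auto)
qed

lemma smooth_fun_const: "smooth_fun M S (\<lambda>x. c)"
  by (simp add: smooth_fun_def Cinf_on_def o_def Ck_on_const)

lemma smooth_fun_add:
  assumes "openin (topo M) S" "smooth_fun M S f" "smooth_fun M S g"
  shows "smooth_fun M S (\<lambda>x. f x + g x)"
  using assms unfolding smooth_fun_def Cinf_on_def o_def
  by (intro ballI allI Ck_on_add chart_open_image) simp_all

lemma smooth_fun_bilinear:
  assumes "bounded_bilinear h" "openin (topo M) S" "smooth_fun M S f" "smooth_fun M S g"
  shows "smooth_fun M S (\<lambda>x. h (f x) (g x))"
  unfolding smooth_fun_def Cinf_on_def
proof (intro ballI allI)
  fix c k assume c: "c \<in> atlas M"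
  show "Ck_on k ((\<lambda>x. h (f x) (g x)) \<circ> inv_into (fst c) (snd c)) (snd c ` (S \<inter> fst c))"
    using Ck_on_bilinear[OF chart_open_image[OF c assms(2)] assms(1),
        of k "f \<circ> inv_into (fst c) (snd c)" "g \<circ> inv_into (fst c) (snd c)"] assms(3,4) c
    by (simp add: smooth_fun_def Cinf_on_def o_def)
qed

lemma smooth_fun_sum:
  assumes S: "openin (topo M) S" and I: "finite I" "\<And>i. i \<in> I \<Longrightarrow> smooth_fun M S (f i)"
  shows "smooth_fun M S (\<lambda>x. \<Sum>i\<in>I. f i x)"
  using I
proof (induction I rule: finite_induct)
  case empty
  show ?case unfolding sum.empty by (rule smooth_fun_const)
next
  case (insert i I)
  have "smooth_fun M S (\<lambda>x. f i x + (\<Sum>i\<in>I. f i x))"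
    by (intro smooth_fun_add S insert.IH insert.prems) simp_all
  then show ?case unfolding sum.insert[OF insert.hyps] .
qed

lemma smooth_fun_subset:
  assumes "smooth_fun M S f" "T \<subseteq> S"
  shows "smooth_fun M T f"
  unfolding smooth_fun_def Cinf_on_def
proof (intro ballI allI)
  fix c k assume "c \<in> atlas M"
  then have "Ck_on k (f \<circ> inv_into (fst c) (snd c)) (snd c ` (S \<inter> fst c))"
    using assms(1) by (simp add: smooth_fun_def Cinf_on_def)
  then show "Ck_on k (f \<circ> inv_into (fst c) (snd c)) (snd c ` (T \<inter> fst c))"
    by (rule Ck_on_subset) (use assms(2) in blast)
qed

text \<open>Charts carry the open pieces to open sets, where the class C^k is local.\<close>

lemma smooth_fun_local:
  assumes "\<And>T. T \<in> \<T> \<Longrightarrow> openin (topo M) T \<and> smooth_fun M T f"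
  shows "smooth_fun M (\<Union>\<T>) f"
  unfolding smooth_fun_def Cinf_on_def
proof (intro ballI allI)
  fix c k assume c: "c \<in> atlas M"
  have "snd c ` (\<Union>\<T> \<inter> fst c) = \<Union>((\<lambda>T. snd c ` (T \<inter> fst c)) ` \<T>)" by blast
  moreover have "Ck_on k (f \<circ> inv_into (fst c) (snd c)) (\<Union>((\<lambda>T. snd c ` (T \<inter> fst c)) ` \<T>))"
  proof (rule Ck_on_Union, elim imageE, hypsubst)
    fix T assume "T \<in> \<T>"
    with assms c show "open (snd c ` (T \<inter> fst c)) \<and>
        Ck_on k (f \<circ> inv_into (fst c) (snd c)) (snd c ` (T \<inter> fst c))"
      by (meson Cinf_on_def smooth_fun_def chart_open_image)
  qed
  ultimately show "Ck_on k (f \<circ> inv_into (fst c) (snd c)) (snd c ` (\<Union>\<T> \<inter> fst c))"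
    by simp
qed

lemma smooth_fun_chartwise:
  assumes "openin (topo M) S" "\<And>c. c \<in> atlas M \<Longrightarrow> smooth_fun M (S \<inter> fst c) f"
  shows "smooth_fun M S f"
proof -
  have "\<Union>((\<lambda>c. S \<inter> fst c) ` atlas M) = S"
    using chart_cover openin_subset[OF assms(1)] by auto
  moreover have "smooth_fun M (\<Union>((\<lambda>c. S \<inter> fst c) ` atlas M)) f"
    using assms by (intro smooth_fun_local) (auto intro: chart_openin)
  ultimately show ?thesis by simp
qed

end

section \<open>Fibres of glued bundles\<close>

text \<open>All fibrewise algebra happens over one base point, so the cocycle laws are demanded
  there only; the tangent bundle and both spinor bundles are instances.\<close>

locale linear_cocycle_at =
  fixes C :: "('i, 'm, 'f::real_vector) cocycle" and x :: 'm
  assumes idx_ex: "\<exists>i\<in>cc_idx C. x \<in> cc_dom C i"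
    and tr_self: "\<And>i u. i \<in> cc_idx C \<Longrightarrow> x \<in> cc_dom C i \<Longrightarrow> cc_tr C i i x u = u"
    and tr_trans: "\<And>i j k u. i \<in> cc_idx C \<Longrightarrow> x \<in> cc_dom C i \<Longrightarrow> j \<in> cc_idx C \<Longrightarrow> x \<in> cc_dom C j \<Longrightarrow>
      k \<in> cc_idx C \<Longrightarrow> x \<in> cc_dom C k \<Longrightarrow> cc_tr C j k x (cc_tr C i j x u) = cc_tr C i k x u"
    and tr_linear: "\<And>i j. i \<in> cc_idx C \<Longrightarrow> x \<in> cc_dom C i \<Longrightarrow> j \<in> cc_idx C \<Longrightarrow> x \<in> cc_dom C j \<Longrightarrow>
      linear (cc_tr C i j x)"
begin

abbreviation valid :: "'i \<Rightarrow> bool" where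
  "valid i \<equiv> i \<in> cc_idx C \<and> x \<in> cc_dom C i"

lemma valid_idx_at: "valid (idx_at C x)"
  unfolding idx_at_def by (rule someI_ex) (use idx_ex in blast)

text \<open>A class contains exactly one triple for each valid index, which is what the definite
  description in \<open>coord\<close> asks for.\<close>

lemma coord_cls: "valid i \<Longrightarrow> coord i (cls C j x u) = cc_tr C j i x u"
  unfolding coord_def cls_def by auto

lemma coord_cls_same [simp]: "valid i \<Longrightarrow> coord i (cls C i x u) = u"
  by (simp add: coord_cls tr_self)

lemma cls_in_fibre [simp]: "valid i \<Longrightarrow> cls C i x u \<in> fibre C x"
  by (auto simp: fibre_def)

lemma cls_change: "valid i \<Longrightarrow> valid j \<Longrightarrow> cls C j x (cc_tr C i j x u) = cls C i x u"
  by (auto simp: cls_def tr_trans)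

lemma cls_coord:
  assumes "valid i" "e \<in> fibre C x"
  shows "cls C i x (coord i e) = e"
proof -
  obtain j u where "e = cls C j x u" "valid j" using assms(2) by (auto simp: fibre_def)
  then show ?thesis using assms(1) by (simp add: coord_cls cls_change)
qed

lemma fibre_eq_iff: "valid i \<Longrightarrow> e \<in> fibre C x \<Longrightarrow> e' \<in> fibre C x \<Longrightarrow> e = e' \<longleftrightarrow> coord i e = coord i e'"
  using cls_coord by metis

lemma coord_change:
  assumes "valid i" "valid j" "e \<in> fibre C x"
  shows "coord j e = cc_tr C i j x (coord i e)"
  using coord_cls[OF assms(2), of i "coord i e"] cls_coord[OF assms(1,3)] by simp

lemma fplus_in_fibre [simp]: "fplus C x a b \<in> fibre C x"
  and fscale_in_fibre [simp]: "fscale C x r a \<in> fibre C x"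
  using valid_idx_at by (simp_all add: fplus_def fscale_def)

text \<open>\<open>fplus\<close> computes in the trivialization \<open>idx_at\<close>; linearity of
  the transition maps carries the result to any other trivialization.\<close>

lemma coord_fplus:
  assumes "valid i" "a \<in> fibre C x" "b \<in> fibre C x"
  shows "coord i (fplus C x a b) = coord i a + coord i b"
  using valid_idx_at assms
  by (simp add: fplus_def coord_cls linear_add[OF tr_linear] coord_change[symmetric])

lemma coord_fscale:
  assumes "valid i" "a \<in> fibre C x"
  shows "coord i (fscale C x r a) = r *\<^sub>R coord i a"
  using valid_idx_at assms
  by (simp add: fscale_def coord_cls linear_scale[OF tr_linear] coord_change[symmetric])

lemma cls_add: "valid i \<Longrightarrow> fplus C x (cls C i x u) (cls C i x v) = cls C i x (u + v)"
  by (subst fibre_eq_iff[of i]) (simp_all add: coord_fplus)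

lemma cls_scale: "valid i \<Longrightarrow> fscale C x r (cls C i x u) = cls C i x (r *\<^sub>R u)"
  by (subst fibre_eq_iff[of i]) (simp_all add: coord_fscale)

end


section \<open>The tangent bundle\<close>

context manifold4 begin

lemma transition_differentiable:
  assumes "c \<in> atlas M" "d \<in> atlas M" "x \<in> fst c" "x \<in> fst d"
  shows "transition c d differentiable (at (snd c x))"
  using manifold assms
  by (intro Cinf_on_differentiable[of _ "snd c ` (fst c \<inter> fst d)"]) (auto simp: oriented_4manifold_def)

text \<open>The cocycle law is the chain rule for coordinate changes.\<close>

lemma linear_TM:
  assumes x: "x \<in> topspace (topo M)"
  shows "linear_cocycle_at (TM M) x"
proof (rule linear_cocycle_at.intro)
  show "\<exists>i\<in>cc_idx (TM M). x \<in> cc_dom (TM M) i"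
    using x chart_cover by (auto simp: TM_def)
  fix c assume c: "c \<in> cc_idx (TM M)" "x \<in> cc_dom (TM M) c"
  then have cM: "c \<in> atlas M" "x \<in> fst c" by (auto simp: TM_def)
  have "open (snd c ` fst c)"
    using chart_open_image[OF cM(1) chart_openin[OF cM(1)]] by simp
  \<comment> \<open>The transition from a chart to itself is the identity only on the image of the
    chart, so the derivative is compared on that open set.\<close>
  then have "(transition c c has_derivative (\<lambda>u. u)) (at (snd c x))"
    by (rule has_derivative_transform_within_open[OF has_derivative_ident])
      (use cM in \<open>auto simp: transition_def\<close>)
  then show "cc_tr (TM M) c c x u = u" for u
    by (simp add: TM_def frechet_derivative_at[symmetric])
  fix d assume d: "d \<in> cc_idx (TM M)" "x \<in> cc_dom (TM M) d"
  then have dM: "d \<in> atlas M" "x \<in> fst d" by (auto simp: TM_def)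
  have cd: "transition c d differentiable (at (snd c x))"
    using cM dM by (intro transition_differentiable)
  then show "linear (cc_tr (TM M) c d x)"
    by (simp add: TM_def linear_frechet_derivative)
  fix e u assume e: "e \<in> cc_idx (TM M)" "x \<in> cc_dom (TM M) e"
  then have eM: "e \<in> atlas M" "x \<in> fst e" by (auto simp: TM_def)
  have cdx: "transition c d (snd c x) = snd d x" using cM by (simp add: transition_def)
  have de: "transition d e differentiable (at (transition c d (snd c x)))"
    unfolding cdx using dM eM by (intro transition_differentiable)
  let ?S = "snd c ` (fst d \<inter> fst e \<inter> fst c)"
  have "open ?S" by (intro chart_open_image openin_Int chart_openin cM dM eM)
  \<comment> \<open>Likewise, the composite agrees with the direct transition only over the triple
    overlap.\<close>
  then have "frechet_derivative (transition d e \<circ> transition c d) (at (snd c x))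
      = frechet_derivative (transition c e) (at (snd c x))"
    by (rule frechet_derivative_transform_within_open[OF differentiable_chain_at[OF cd de]])
      (use cM dM eM in \<open>auto simp: transition_def\<close>)
  then show "cc_tr (TM M) d e x (cc_tr (TM M) c d x u) = cc_tr (TM M) c e x u"
    by (simp add: TM_def frechet_derivative_compose[OF cd de] cdx[symmetric] fun_eq_iff)
qed

end

lemma TM_sel [simp]: "cc_idx (TM M) = atlas M" "cc_dom (TM M) = fst"
  by (simp_all add: TM_def)

locale almost_hermitian4 =
  fixes M :: "'m ah_manifold"
  assumes ah: "almost_hermitian_4manifold M"

sublocale almost_hermitian4 \<subseteq> manifold4
  using ah by unfold_locales (simp add: almost_hermitian_4manifold_def)

locale almost_hermitian4_at = almost_hermitian4 +
  fixes x :: 'm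
  assumes x: "x \<in> topspace (topo M)"

sublocale almost_hermitian4_at \<subseteq> T: linear_cocycle_at "TM M" x
  using x by (rule linear_TM)

context almost_hermitian4_at begin

lemma metric_simps:
  assumes "u \<in> tspace M x" "v \<in> tspace M x" "w \<in> tspace M x"
  shows "metric M (fplus (TM M) x u v) w = metric M u w + metric M v w"
    "metric M (fscale (TM M) x r u) w = r * metric M u w"
    "metric M w (fplus (TM M) x u v) = metric M w u + metric M w v"
    "metric M w (fscale (TM M) x r u) = r * metric M w u"
    "metric M u v = metric M v u"
proof -
  have *: "metric M (fplus (TM M) x u v) w = metric M u w + metric M v w \<and>
        metric M (fscale (TM M) x r u) w = r * metric M u w \<and>
        metric M u v = metric M v u" if "u \<in> tspace M x" "v \<in> tspace M x" "w \<in> tspace M x" for u v w r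
    using ah that x unfolding almost_hermitian_4manifold_def riemannian_metric_def by blast
  show "metric M (fplus (TM M) x u v) w = metric M u w + metric M v w"
    "metric M (fscale (TM M) x r u) w = r * metric M u w" "metric M u v = metric M v u"
    using *[OF assms] by blast+
  show "metric M w (fplus (TM M) x u v) = metric M w u + metric M w v"
    "metric M w (fscale (TM M) x r u) = r * metric M w u"
    using *[OF assms] *[OF assms(3) T.fplus_in_fibre assms(1)] *[OF assms(3) T.fscale_in_fibre assms(1)]
      *[OF assms(3,1,2)] *[OF assms(3,2,1)] by metis+
qed

end

declare split_paired_All [simp del] split_paired_Ex [simp del]

section \<open>The group $U(2)$\<close>

lemma qinv_uminus: "qinv (- a) = - qinv a"
  by (simp add: qinv_def qconj_def prod_eq_iff)

lemma qof_uminus: "qof (- z) = - qof z"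
  by (simp add: qof_def)

text \<open>Changing the signs of both \<open>l\<close> and \<open>q\<close> leaves the product
  unchanged, so the image of the class is a singleton and \<open>the_elem\<close> returns its
  member.\<close>

lemma U2_act_pm:
  assumes "norm q = 1"
  shows "U2_act (pm (l, q)) v = qmul (qmul (qof l) v) (qconj q)"
  using assms by (simp add: U2_act_def pm_def qinv_uminus qof_uminus qmul_simps qinv_unit)

text \<open>This is why negative spinors are glued by the unitary cocycle of the tangent bundle
  itself.\<close>

lemma SpinC_to_U2_minus_U2 [simp]: "SpinC_to_U2_minus (U2_to_SpinC u) = u"
  by (auto simp: SpinC_to_U2_minus_def U2_to_SpinC_def image_image case_prod_unfold)

lemma SpinC_to_U2_plus_U2: "SpinC_to_U2_plus (U2_to_SpinC (pm (l, q))) = pm (l, qof l)"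
  by (simp add: SpinC_to_U2_plus_def U2_to_SpinC_def pm_def qof_uminus)

lemma U2_cases:
  assumes "u \<in> U2"
  obtains l q where "u = pm (l, q)" "norm l = 1" "norm q = 1"
  using assms by (auto simp: U2_def)

lemma qconj_qof: "qconj (qof z) = qof (cnj z)"
  by (simp add: qconj_def qof_def)

lemma qj_qof: "qmul qj (qof z) = qmul (qof (cnj z)) qj"
  by (simp add: quat_defs)

text \<open>With u = [l, q] the middle factors cancel: (l \<phi> l^-1)(l w q^-1) = l (\<phi> w)
  q^-1. Evaluation is thus equivariant; both the gluing of positive spinors and naturality rest on
  this.\<close>

lemma U2_plus_qmul:
  assumes "u \<in> U2"
  shows "qmul (U2_act (SpinC_to_U2_plus (U2_to_SpinC u)) \<phi>) (U2_act u w) = U2_act u (qmul \<phi> w)"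
proof -
  obtain l q where "u = pm (l, q)" "norm l = 1" "norm q = 1"
    using assms by (rule U2_cases)
  then show ?thesis
    by (simp add: SpinC_to_U2_plus_U2 U2_act_pm qmul_assoc qconj_qof qof_cnj_cancel)
qed

text \<open>A complex linear map is determined by its values on the complex basis \<open>q1\<close>,
  \<open>qj\<close>. Their quotient fixes \<open>l\<close> up to sign, and the value at
  \<open>q1\<close> then fixes \<open>q\<close>.\<close>

lemma U2_act_exists:
  assumes R: "linear R" and iso: "\<And>a b. inner (R a) (R b) = inner a b"
    and Ri: "\<And>a. R (qmul qi a) = qmul qi (R a)"
  shows "\<exists>u\<in>U2. U2_act u = R"
proof -
  have nR: "norm (R a) = norm a" for a by (simp add: norm_eq_sqrt_inner iso)
  \<comment> \<open>The quotient of the two values is orthogonal to 1 and i, hence a unit complex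
    multiple of j.\<close>
  define t where "t = qmul (R qj) (qconj (R q1))"
  have "inner t q1 = 0"
    using iso[of qj q1] by (simp add: t_def inner_qmul_right inner_qunits)
  moreover have "inner t qi = 0"
    using iso[of qj qi] Ri[of q1] by (simp add: t_def inner_qmul_right inner_qunits)
  moreover have nt: "norm t = 1" by (simp add: t_def nR)
  ultimately have "Re (fst t) = 0" "Im (fst t) = 0"
    by (simp_all only: inner_quat_units)
  moreover define \<mu> where "\<mu> = snd t"
  ultimately have t: "t = qmul (qof \<mu>) qj"
    by (simp add: quat_eq_iff quat_defs)
  have nm: "norm \<mu> = 1" using nt by (simp add: t)
  \<comment> \<open>A square root, because l j l^-1 = l^2 j for unit l; the two roots give the two
    members of one class.\<close>
  define l where "l = csqrt \<mu>"
  have nl: "norm l = 1" by (simp add: l_def nm)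
  have ll: "l * l = \<mu>" by (simp add: l_def power2_eq_square[symmetric])
  define q where "q = qconj (qmul (qof (cnj l)) (R q1))"
  have nq: "norm q = 1" by (simp add: q_def nl nR)
  let ?f = "U2_act (pm (l, q))"
  have f: "?f v = qmul (qmul (qof l) v) (qmul (qof (cnj l)) (R q1))" for v
    unfolding U2_act_pm[OF nq] by (simp add: q_def)
  have f1: "?f q1 = R q1" by (simp add: f qof_cnj_cancel nl)
  have fi: "?f (qmul qi v) = qmul qi (?f v)" for v
    by (simp add: f qof_i[symmetric] qmul_assoc[symmetric] qof_mult mult.commute)
  have "?f qj = qmul (qmul (qof l) (qmul qj (qof (cnj l)))) (R q1)"
    by (simp add: f qmul_assoc)
  also have "\<dots> = qmul t (R q1)"
    unfolding t by (simp add: qj_qof qmul_assoc[symmetric] qof_mult ll)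
  also have "\<dots> = R qj" by (simp add: t_def qmul_unit_cancel nR)
  finally have fj: "?f qj = R qj" .
  have "linear ?f"
    by (rule linearI) (simp_all only: f qmul_simps)
  moreover have "?f qi = R qi" using f1 fi[of q1] Ri[of q1] by simp
  moreover have "?f qk = R qk" using fj fi[of qj] Ri[of qj] by (simp add: qunit_table)
  ultimately have "?f a = R a" for a
    using linear_quat_eqI[OF _ R f1 _ fj] by blast
  moreover have "pm (l, q) \<in> U2" using nl nq by (auto simp: U2_def)
  ultimately show ?thesis by blast
qed

text \<open>Agreement at \<open>q1\<close> and \<open>qj\<close> makes the quotient \<open>m\<close>
  of the two complex factors commute with j; being real of length 1, it is a sign. The definite
  description in \<open>U2_change\<close> relies on this uniqueness.\<close>

lemma U2_act_inj:
  assumes "u \<in> U2" "u' \<in> U2" "U2_act u = U2_act u'"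
  shows "u = u'"
proof -
  obtain l q where u: "u = pm (l, q)" and n: "norm l = 1" "norm q = 1"
    using assms(1) by (rule U2_cases)
  obtain l' q' where u': "u' = pm (l', q')" and n': "norm l' = 1" "norm q' = 1"
    using assms(2) by (rule U2_cases)
  have eq: "qmul (qmul (qof l) v) (qconj q) = qmul (qmul (qof l') v) (qconj q')" for v
    using assms(3) by (simp add: u u' fun_eq_iff U2_act_pm n n')
  define m where "m = cnj l' * l"
  have q': "qmul v (qconj q') = qmul (qmul (qof m) v) (qconj q)" for v
    using arg_cong[OF eq[of v], of "qmul (qof (cnj l'))"]
    by (simp add: qmul_assoc qof_cnj_cancel n') (simp add: m_def qof_mult[symmetric] qmul_assoc)
  have "qmul qj (qconj q') = qmul qj (qmul (qof m) (qconj q))" using q'[of q1] by simp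
  then have "qmul (qmul (qof m) qj) (qconj q) = qmul (qmul qj (qof m)) (qconj q)"
    using q'[of qj] by (simp add: qmul_assoc)
  moreover have "qconj q \<noteq> 0" using n by (metis norm_qconj norm_zero zero_neq_one)
  ultimately have "qmul (qof m) qj = qmul (qof (cnj m)) qj"
    unfolding qj_qof using qmul_right_cancel by blast
  then have "Im m = 0" by (simp add: quat_eq_iff quat_defs)
  moreover have "norm m = 1" by (simp add: m_def norm_mult n n')
  ultimately have m: "m = 1 \<or> m = -1" by (auto simp: complex_eq_iff cmod_def)
  have lm: "l = l' * m"
    using n' by (simp add: m_def mult.assoc[symmetric] complex_norm_square[symmetric])
  have "qconj q' = qmul (qof m) (qconj q)" using q'[of q1] by simp
  then have qm: "q' = qmul q (qof (cnj m))" by (metis qconj_qconj qconj_qmul qconj_qof)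
  show ?thesis using m
  proof
    assume "m = 1"
    then show ?thesis using lm qm by (simp add: u u')
  next
    assume "m = -1"
    then show ?thesis using lm qm by (auto simp add: u u' pm_def qof_uminus qmul_simps)
  qed
qed

lemma U2_change:
  assumes "inj e'" "\<And>a. e' (R a) = e a"
    and "linear R" "\<And>a b. inner (R a) (R b) = inner a b" "\<And>a. R (qmul qi a) = qmul qi (R a)"
  shows "U2_change e e' \<in> U2" "U2_act (U2_change e e') = R"
proof -
  obtain u where u: "u \<in> U2" "U2_act u = R" using U2_act_exists[OF assms(3-5)] by blast
  have "U2_change e e' = u"
    unfolding U2_change_def
  proof (rule the_equality)
    show "u \<in> U2 \<and> (\<forall>a. e' (U2_act u a) = e a)" using u assms(2) by simp
    fix u' assume u': "u' \<in> U2 \<and> (\<forall>a. e' (U2_act u' a) = e a)"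
    then have "U2_act u' = U2_act u"
      using u(2) assms(1,2) by (auto simp: fun_eq_iff inj_eq[OF assms(1), symmetric])
    then show "u' = u" using u' u(1) U2_act_inj by blast
  qed
  then show "U2_change e e' \<in> U2" "U2_act (U2_change e e') = R" using u by simp_all
qed

lemma commute_qof:
  assumes "linear R" "\<And>a. R (qmul qi a) = qmul qi (R a)"
  shows "R (qmul (qof z) a) = qmul (qof z) (R a)"
  using assms by (simp add: qof_scale linear_add linear_scale)

lemma linear_U2_act:
  assumes "u \<in> U2"
  shows "linear (U2_act u)"
proof -
  obtain l q where "u = pm (l, q)" "norm l = 1" "norm q = 1"
    using assms by (rule U2_cases)
  then show ?thesis
    by (intro linearI) (simp_all add: U2_act_pm qmul_simps)
qed


section \<open>Isometric frames of the tangent spaces\<close>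

lemma linear_injective_surj:
  fixes f :: "'a::euclidean_space \<Rightarrow> 'b::euclidean_space"
  assumes "linear f" "inj f" "DIM('a) = DIM('b)"
  shows "surj f"
proof -
  have "dim (range f) = DIM('b)"
    using dim_image_eq[OF assms(1), of UNIV] assms(2,3) by simp
  moreover have "span (range f) = range f"
    using linear_span_image[OF assms(1), of UNIV] by simp
  ultimately show ?thesis by (metis dim_eq_full)
qed

context almost_hermitian4_at begin

context
  fixes f :: "quat \<Rightarrow> 'm tvec"
  assumes f: "oriented_isometry M x f"
begin

lemma iso_in: "f a \<in> tspace M x"
  using f by (simp add: oriented_isometry_def)

lemma iso_add: "f (a + b) = fplus (TM M) x (f a) (f b)"
  using f by (simp add: oriented_isometry_def)

lemma iso_scale: "f (r *\<^sub>R a) = fscale (TM M) x r (f a)"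
  using f by (simp add: oriented_isometry_def)

lemma iso_metric: "metric M (f a) (f b) = inner a b"
  using f by (simp add: oriented_isometry_def)

lemma iso_coord_linear: "T.valid c \<Longrightarrow> linear (\<lambda>a. coord c (f a))"
  by (rule linearI) (simp_all add: iso_add iso_scale iso_in T.coord_fplus T.coord_fscale)

text \<open>Expands |a - b|^2 by pairing \<open>f a\<close> and \<open>f b\<close> separately with
  \<open>f (a - b)\<close>, which avoids a difference in the fibre.\<close>

lemma iso_eq_iff: "f a = f b \<longleftrightarrow> a = b"
proof
  assume eq: "f a = f b"
  have "inner (a - b) (a - b) = metric M (f a) (f (a - b)) - metric M (f b) (f (a - b))"
    by (simp add: iso_metric inner_diff_left)
  then show "a = b" using eq by simp
qed simp

lemma iso_inj: "inj f"
  by (simp add: inj_def iso_eq_iff)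

text \<open>A dimension count: in chart coordinates the isometry is an injective linear map between
  spaces of dimension four.\<close>

lemma range_iso: "range f = tspace M x"
proof
  show "tspace M x \<subseteq> range f"
  proof
    fix v assume v: "v \<in> tspace M x"
    have c: "T.valid (idx_at (TM M) x)" by (rule T.valid_idx_at)
    let ?g = "\<lambda>a. coord (idx_at (TM M) x) (f a)"
    have "inj ?g"
      unfolding inj_def using T.fibre_eq_iff[OF c iso_in iso_in] iso_eq_iff by blast
    then have "surj ?g"
      by (intro linear_injective_surj iso_coord_linear c) simp_all
    then obtain a where "coord (idx_at (TM M) x) v = ?g a" by (rule surjE)
    then have "f a = v" unfolding T.fibre_eq_iff[OF c iso_in v] by (rule sym)
    then show "v \<in> range f" by blast
  qed
qed (use iso_in in auto)

lemma iso_inv: "inv f (f a) = a" "v \<in> tspace M x \<Longrightarrow> f (inv f v) = v"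
  by (simp_all add: iso_inj range_iso f_inv_into_f)

lemma iso_inv_add: "u \<in> tspace M x \<Longrightarrow> v \<in> tspace M x \<Longrightarrow>
    inv f (fplus (TM M) x u v) = inv f u + inv f v"
  using iso_inv(1)[of "inv f u + inv f v"] by (simp add: iso_add iso_inv(2))

lemma iso_inv_scale: "u \<in> tspace M x \<Longrightarrow> inv f (fscale (TM M) x r u) = r *\<^sub>R inv f u"
  using iso_inv(1)[of "r *\<^sub>R inv f u"] by (simp add: iso_scale iso_inv(2))

lemma metric_iso_inv:
  "u \<in> tspace M x \<Longrightarrow> v \<in> tspace M x \<Longrightarrow> metric M u v = inner (inv f u) (inv f v)"
  using iso_metric[of "inv f u" "inv f v"] by (simp add: iso_inv(2))

end

lemma iso_change:
  assumes f: "oriented_isometry M x f" and f': "oriented_isometry M x f'"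
  shows "linear (\<lambda>a. inv f (f' a))" "inner (inv f (f' a)) (inv f (f' b)) = inner a b"
    "f (inv f (f' a)) = f' a"
proof -
  show "linear (\<lambda>a. inv f (f' a))"
    by (rule linearI) (simp_all add: iso_add[OF f'] iso_scale[OF f'] iso_inv_add[OF f]
        iso_inv_scale[OF f] iso_in[OF f'])
  show "inner (inv f (f' a)) (inv f (f' b)) = inner a b"
    using metric_iso_inv[OF f iso_in[OF f'] iso_in[OF f']] iso_metric[OF f'] by simp
  show "f (inv f (f' a)) = f' a" by (rule iso_inv(2)[OF f iso_in[OF f']])
qed

text \<open>A change of oriented frame turns left multiplication by \<open>a\<close> into left
  multiplication by another quaternion, the same for every \<open>b\<close>. Frame independence on
  the endomorphism side comes from here.\<close>

lemma iso_change_qmul: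
  assumes f: "oriented_isometry M x f" and f': "oriented_isometry M x f'"
  shows "inv f (f' (qmul a b)) = qmul (qmul (inv f (f' a)) (qconj (inv f (f' q1)))) (inv f (f' b))"
proof -
  define R where "R a = inv f (f' a)" for a
  have lin: "linear R" and iso: "\<And>a b. inner (R a) (R b) = inner a b"
    unfolding R_def by (rule iso_change(1)[OF f f'], rule iso_change(2)[OF f f'])
  obtain c where c: "T.valid c" using T.valid_idx_at by blast
  define P where "P a = coord c (f a)" for a
  have P: "linear P" unfolding P_def using f c by (rule iso_coord_linear)
  have "coord c (f' a) = P (R a)" for a
    unfolding P_def R_def iso_change(3)[OF f f'] ..
  \<comment> \<open>The chart determinants of the two frames differ by the determinant of
    \<open>R\<close>; both are positive, hence so is that factor.\<close>
  then have det: "orient_det c (f' q1) (f' qi) (f' qj) (f' qk)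
      = det (vector [quat_vec (R q1), quat_vec (R qi), quat_vec (R qj), quat_vec (R qk)] :: real^4^4)
        * orient_det c (f q1) (f qi) (f qj) (f qk)"
    unfolding orient_det_def
    by (simp only: P_def[symmetric] det_linear_quat[OF P, of "R q1" "R qi" "R qj" "R qk"])
  have "orient_det c (f' q1) (f' qi) (f' qj) (f' qk) > 0"
    "orient_det c (f q1) (f qi) (f qj) (f qk) > 0"
    using f f' c unfolding oriented_isometry_def TM_sel by blast+
  then have "0 < det (vector [quat_vec (R q1), quat_vec (R qi), quat_vec (R qj), quat_vec (R qk)] :: real^4^4)"
    unfolding det by (rule zero_less_mult_pos2)
  then have "R (qmul a b) = qmul (qmul (R a) (qconj (R q1))) (R b)"
    by (rule rotation_qmul[OF lin iso])
  then show ?thesis unfolding R_def .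
qed

end

section \<open>The spinor bundles\<close>

lemma W_sel [simp]: "cc_idx (Wplus A) = A" "cc_dom (Wplus A) = fst"
  "cc_idx (Wminus A) = A" "cc_dom (Wminus A) = fst"
  by (simp_all add: Wplus_def Wminus_def)

text \<open>The fibre operations and the Clifford multiplication thereby compute in the same
  frame.\<close>

lemma idx_at_W: "idx_at (Wplus A) x = frame_at A x" "idx_at (Wminus A) x = frame_at A x"
  by (simp_all add: idx_at_def frame_at_def)

locale unitary4 = almost_hermitian4 M for M :: "'m ah_manifold" +
  fixes A :: "'m lframe set"
  assumes uf: "unitary_frames M A"

locale unitary4_at = unitary4 M A + almost_hermitian4_at M x for M :: "'m ah_manifold" and A x
begin

lemma frame_iso: "F \<in> A \<and> x \<in> fst F \<Longrightarrow> oriented_isometry M x (snd F x)"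
  using uf unfolding unitary_frames_def by blast

lemma frame_J: "F \<in> A \<and> x \<in> fst F \<Longrightarrow> snd F x (qmul qi a) = cplx M (snd F x a)"
  using uf unfolding unitary_frames_def by blast

lemma frame_ex: "\<exists>F\<in>A. x \<in> fst F"
proof -
  have "(\<Union>F\<in>A. fst F) = topspace (topo M)"
    using uf unfolding unitary_frames_def by blast
  then show ?thesis using x by blast
qed

lemma frame_at: "frame_at A x \<in> A \<and> x \<in> fst (frame_at A x)"
  unfolding frame_at_def by (rule someI_ex) (use frame_ex in blast)

lemma frame_qof:
  assumes F: "F \<in> A \<and> x \<in> fst F"
  shows "hb_scale (T_omega M) x z (snd F x a) = snd F x (qmul (qof z) a)"
  by (simp add: T_omega_def qof_scale iso_add[OF frame_iso[OF F]] iso_scale[OF frame_iso[OF F]]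
      frame_J[OF F])

context
  fixes F G
  assumes F: "F \<in> A \<and> x \<in> fst F" and G: "G \<in> A \<and> x \<in> fst G"
begin

lemma frame_change_qi:
  "inv (snd G x) (snd F x (qmul qi a)) = qmul qi (inv (snd G x) (snd F x a))"
proof -
  have "snd G x (qmul qi (inv (snd G x) (snd F x a))) = snd F x (qmul qi a)"
    unfolding frame_J[OF G] iso_change(3)[OF frame_iso[OF G] frame_iso[OF F]] frame_J[OF F] ..
  then show ?thesis using iso_inv(1)[OF frame_iso[OF G]] by metis
qed

lemma frame_change_U2:
  "U2_change (snd F x) (snd G x) \<in> U2"
  "U2_act (U2_change (snd F x) (snd G x)) = (\<lambda>a. inv (snd G x) (snd F x a))"
proof -
  have *: "inj (snd G x)" "snd G x (inv (snd G x) (snd F x a)) = snd F x a"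
    "linear (\<lambda>a. inv (snd G x) (snd F x a))"
    "inner (inv (snd G x) (snd F x a)) (inv (snd G x) (snd F x b)) = inner a b"
    "inv (snd G x) (snd F x (qmul qi a)) = qmul qi (inv (snd G x) (snd F x a))" for a b
    using iso_inj[OF frame_iso[OF G]] iso_change[OF frame_iso[OF G] frame_iso[OF F]]
      frame_change_qi by blast+
  show "U2_change (snd F x) (snd G x) \<in> U2"
    by (rule U2_change(1)[OF *])
  show "U2_act (U2_change (snd F x) (snd G x)) = (\<lambda>a. inv (snd G x) (snd F x a))"
    by (rule U2_change(2)[OF *])
qed

lemma Wminus_tr: "cc_tr (Wminus A) F G x a = inv (snd G x) (snd F x a)"
  by (simp add: Wminus_def spinc_cocycle_def frame_change_U2)

text \<open>Describes the transition map through evaluation rather than by its complex factor, which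
  is known only up to sign. A suitable \<open>w\<close> recovers the map itself.\<close>

lemma Wplus_tr:
  "qmul (cc_tr (Wplus A) F G x \<phi>) (inv (snd G x) (snd F x w)) = inv (snd G x) (snd F x (qmul \<phi> w))"
  using U2_plus_qmul[OF frame_change_U2(1), of \<phi> w]
  by (simp add: Wplus_def spinc_cocycle_def frame_change_U2)

lemma linear_Wplus_tr: "linear (cc_tr (Wplus A) F G x)"
proof -
  obtain l q where "U2_change (snd F x) (snd G x) = pm (l, q)" "norm l = 1" "norm q = 1"
    using frame_change_U2(1) by (rule U2_cases)
  then have "SpinC_to_U2_plus (spinc_cocycle F G x) \<in> U2"
    unfolding spinc_cocycle_def U2_def by (auto simp: SpinC_to_U2_plus_U2 intro!: exI[of _ l] exI[of _ "qof l"])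
  then show ?thesis
    by (simp add: Wplus_def linear_U2_act)
qed

end

lemma linear_Wminus: "linear_cocycle_at (Wminus A) x"
proof (rule linear_cocycle_at.intro; (unfold W_sel)?)
  show "\<exists>F\<in>A. x \<in> fst F" by (rule frame_ex)
next
  fix F u assume "F \<in> A" "x \<in> fst F"
  then have F: "F \<in> A \<and> x \<in> fst F" by simp
  then show "cc_tr (Wminus A) F F x u = u"
    unfolding Wminus_tr[OF F F] by (intro iso_inv(1) frame_iso)
next
  fix F G H u assume "F \<in> A" "x \<in> fst F" "G \<in> A" "x \<in> fst G" "H \<in> A" "x \<in> fst H"
  then have F: "F \<in> A \<and> x \<in> fst F" and G: "G \<in> A \<and> x \<in> fst G" and H: "H \<in> A \<and> x \<in> fst H"
    by simp_all
  show "cc_tr (Wminus A) G H x (cc_tr (Wminus A) F G x u) = cc_tr (Wminus A) F H x u"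
    unfolding Wminus_tr[OF F G] Wminus_tr[OF G H] Wminus_tr[OF F H]
      iso_change(3)[OF frame_iso[OF G] frame_iso[OF F]] ..
next
  fix F G assume "F \<in> A" "x \<in> fst F" "G \<in> A" "x \<in> fst G"
  then have F: "F \<in> A \<and> x \<in> fst F" and G: "G \<in> A \<and> x \<in> fst G" by simp_all
  show "linear (cc_tr (Wminus A) F G x)"
    using iso_change(1)[OF frame_iso[OF G] frame_iso[OF F]]
    by (simp add: Wminus_tr[OF F G, abs_def])
qed

lemma linear_Wplus: "linear_cocycle_at (Wplus A) x"
proof (rule linear_cocycle_at.intro; (unfold W_sel)?)
  show "\<exists>F\<in>A. x \<in> fst F" by (rule frame_ex)
next
  fix F u assume "F \<in> A" "x \<in> fst F"
  then have F: "F \<in> A \<and> x \<in> fst F" by simp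
  show "cc_tr (Wplus A) F F x u = u"
    using Wplus_tr[OF F F, of u q1] by (simp add: iso_inv(1)[OF frame_iso[OF F]])
next
  fix F G H u assume "F \<in> A" "x \<in> fst F" "G \<in> A" "x \<in> fst G" "H \<in> A" "x \<in> fst H"
  then have F: "F \<in> A \<and> x \<in> fst F" and G: "G \<in> A \<and> x \<in> fst G" and H: "H \<in> A \<and> x \<in> fst H"
    by simp_all
  \<comment> \<open>Chosen to have coordinates \<open>q1\<close> in the frame \<open>H\<close>, so
    that \<open>Wplus_tr\<close> yields the bare transition value.\<close>
  define w where "w = inv (snd F x) (snd H x q1)"
  have w: "inv (snd H x) (snd F x w) = q1"
    by (simp add: w_def iso_inv(1)[OF frame_iso[OF H]] iso_change(3)[OF frame_iso[OF F] frame_iso[OF H]])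
  note ch = iso_change(3)[OF frame_iso[OF G] frame_iso[OF F]]
  show "cc_tr (Wplus A) G H x (cc_tr (Wplus A) F G x u) = cc_tr (Wplus A) F H x u"
    using Wplus_tr[OF G H, of "cc_tr (Wplus A) F G x u" "inv (snd G x) (snd F x w)"]
      Wplus_tr[OF F H, of u w]
    by (simp add: ch w Wplus_tr[OF F G])
next
  fix F G assume "F \<in> A" "x \<in> fst F" "G \<in> A" "x \<in> fst G"
  then show "linear (cc_tr (Wplus A) F G x)" by (intro linear_Wplus_tr conjI)
qed

end

sublocale unitary4_at \<subseteq> Wm: linear_cocycle_at "Wminus A" x
  by (rule linear_Wminus)

sublocale unitary4_at \<subseteq> Wp: linear_cocycle_at "Wplus A" x
  by (rule linear_Wplus)


section \<open>Self-dual conformal maps\<close>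

definition mult_map :: "'m ah_manifold \<Rightarrow> 'm \<Rightarrow> (quat \<Rightarrow> 'm tvec) \<Rightarrow> quat \<Rightarrow> 'm tvec \<Rightarrow> 'm tvec" where
  "mult_map M x f a = (\<lambda>v\<in>tspace M x. f (qmul a (inv f v)))"

context almost_hermitian4_at begin

context
  fixes f :: "quat \<Rightarrow> 'm tvec"
  assumes f: "oriented_isometry M x f"
begin

lemma mult_map_iso: "mult_map M x f a (f w) = f (qmul a w)"
  by (simp add: mult_map_def iso_in[OF f] iso_inv(1)[OF f])

lemma ext_on_iso:
  assumes "L \<in> extensional (tspace M x)" "K \<in> extensional (tspace M x)" "\<And>w. L (f w) = K (f w)"
  shows "L = K"
proof (rule extensionalityI[OF assms(1,2)])
  fix v assume "v \<in> tspace M x"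
  then show "L v = K v" using assms(3)[of "inv f v"] by (simp add: iso_inv(2)[OF f])
qed

lemma mult_map_extensional: "mult_map M x f a \<in> extensional (tspace M x)"
  by (simp add: mult_map_def)

text \<open>The existential over isometries in \<open>pso_fibre\<close> collapses to one isometry,
  since by \<open>iso_change_qmul\<close> a left multiplication seen through another one is again a
  left multiplication.\<close>

lemma pso_fibre_eq: "pso_fibre M x = range (mult_map M x f)"
proof (intro equalityI subsetI)
  fix L assume "L \<in> pso_fibre M x"
  then obtain f' a where L: "L \<in> extensional (tspace M x)" and f': "oriented_isometry M x f'"
    and La: "\<And>v. L (f' v) = f' (qmul a v)"
    by (auto simp: pso_fibre_def)
  \<comment> \<open>The image of \<open>a\<close> under the algebra automorphism attached to the
    frame change.\<close>
  let ?b = "qmul (inv f (f' a)) (qconj (inv f (f' q1)))"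
  have "L (f w) = f (qmul ?b w)" for w
  proof -
    have "L (f w) = f' (qmul a (inv f' (f w)))"
      using La[of "inv f' (f w)"] by (simp add: iso_change(3)[OF f' f])
    also have "\<dots> = f (inv f (f' (qmul a (inv f' (f w)))))"
      by (simp add: iso_change(3)[OF f f'])
    also have "\<dots> = f (qmul ?b w)"
      unfolding iso_change_qmul[OF f f'] by (simp add: iso_change(3)[OF f' f] iso_inv(1)[OF f])
    finally show ?thesis .
  qed
  then have "L = mult_map M x f ?b"
    by (intro ext_on_iso L mult_map_extensional) (simp add: mult_map_iso)
  then show "L \<in> range (mult_map M x f)" by blast
next
  fix L assume "L \<in> range (mult_map M x f)"
  then show "L \<in> pso_fibre M x"
    using f mult_map_iso mult_map_extensional unfolding pso_fibre_def by blast
qed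

lemma mult_map_inj: "inj (mult_map M x f)"
proof (rule injI)
  fix a b assume "mult_map M x f a = mult_map M x f b"
  then have "f (qmul a q1) = f (qmul b q1)" using mult_map_iso by metis
  then show "a = b" by (simp add: iso_eq_iff[OF f])
qed

lemma pso_plus_mult_map:
  "pso_plus M x (mult_map M x f a) (mult_map M x f b) = mult_map M x f (a + b)"
  by (rule ext_on_iso)
    (simp_all add: pso_plus_def mult_map_extensional mult_map_iso iso_in[OF f] iso_add[OF f] qmul_simps)

text \<open>Left multiplication scales inner products by the squared norm; the unit vector
  \<open>f q1\<close> shows that no other factor is possible.\<close>

lemma pso_norm_mult_map: "pso_norm M x (mult_map M x f a) = norm a"
  unfolding pso_norm_def
proof (rule the_equality)
  show "0 \<le> norm a \<and> (\<forall>v\<in>tspace M x. \<forall>w\<in>tspace M x.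
      metric M (mult_map M x f a v) (mult_map M x f a w) = (norm a)\<^sup>2 * metric M v w)"
    by (simp add: mult_map_def metric_iso_inv[OF f] iso_in[OF f] iso_inv(1)[OF f] inner_qmul_same_left)
  fix r assume r: "0 \<le> r \<and> (\<forall>v\<in>tspace M x. \<forall>w\<in>tspace M x.
      metric M (mult_map M x f a v) (mult_map M x f a w) = r\<^sup>2 * metric M v w)"
  then have "metric M (mult_map M x f a (f q1)) (mult_map M x f a (f q1)) = r\<^sup>2 * metric M (f q1) (f q1)"
    using iso_in[OF f] by blast
  then have "(norm a)\<^sup>2 = r\<^sup>2"
    by (simp add: mult_map_iso iso_metric[OF f] inner_qunits power2_norm_eq_inner)
  then show "r = norm a" using r by simp
qed

end

end

context unitary4_at begin

context
  fixes F
  assumes F: "F \<in> A \<and> x \<in> fst F"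
begin

text \<open>In a unitary frame J is left multiplication by i, so composing with J multiplies the
  quaternion on the left.\<close>

lemma pso_scale_mult_map:
  "pso_scale M x z (mult_map M x (snd F x) a) = mult_map M x (snd F x) (qmul (qof z) a)"
  by (rule ext_on_iso[OF frame_iso[OF F]])
    (simp_all add: pso_scale_def mult_map_extensional[OF frame_iso[OF F]]
      mult_map_iso[OF frame_iso[OF F]] iso_in[OF frame_iso[OF F]] frame_qof[OF F] qmul_assoc)

lemma pso_inner_mult_map:
  "pso_inner M x (mult_map M x (snd F x) a) (mult_map M x (snd F x) b) = inner a b"
proof -
  have "qmul (qof (- 1)) b = - b" by (simp add: qof_uminus qmul_simps)
  then show ?thesis
    by (simp add: pso_inner_def pso_scale_mult_map pso_plus_mult_map[OF frame_iso[OF F]]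
        pso_norm_mult_map[OF frame_iso[OF F]] power2_norm_eq_inner inner_simps inner_commute)
qed

end

end

section \<open>The Clifford multiplication\<close>

lemma SO4_act_SpinC:
  assumes "norm m = 1"
  shows "SO4_act (SpinC_to_SO4 (pm (l, p, m))) v = qmul (qmul p v) (qconj m)"
  using assms by (simp add: SO4_act_def SpinC_to_SO4_def pm_def qinv_uminus qmul_simps qinv_unit)

lemma SpinC_to_U2_pm:
  "SpinC_to_U2_plus (pm (l, p, m)) = pm (l, p)" "SpinC_to_U2_minus (pm (l, p, m)) = pm (l, m)"
  by (simp_all add: SpinC_to_U2_plus_def SpinC_to_U2_minus_def pm_def)

text \<open>The group moves the pair (1, 1) of vector and spinor to every pair of unit quaternions,
  so equivariance leaves the single value \<open>cp q1 q1\<close> free, and the stabilizer of the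
  pair makes it complex. Adjointness and the Clifford relations then fix its length and
  \<open>cm\<close>.\<close>

lemma clifford_model_unique:
  assumes "clifford_model cp cm"
  obtains c where "norm c = 1" "\<And>v \<phi>. cp v \<phi> = qmul (qof c) (qmul \<phi> v)"
    "\<And>v \<psi>. cm v \<psi> = - qmul (qof (cnj c)) (qmul \<psi> (qconj v))"
proof -
  note D = assms[unfolded clifford_model_def]
  note D2 = D[THEN conjunct2, THEN conjunct2, THEN conjunct2, THEN conjunct2, THEN conjunct2, THEN conjunct2]
  note D3 = D2[THEN conjunct2, THEN conjunct2]
  have lin: "\<And>\<phi>. linear (\<lambda>v. cp v \<phi>)" "\<And>\<psi>. linear (\<lambda>v. cm v \<psi>)" "\<And>v. linear (cp v)"
    using D by simp_all
  have equiv: "cp (SO4_act (SpinC_to_SO4 s) v) (U2_act (SpinC_to_U2_plus s) \<phi>)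
        = U2_act (SpinC_to_U2_minus s) (cp v \<phi>)" if "s \<in> SpinC" for s v \<phi>
    using D2[THEN conjunct1] that by blast
  have cpcm: "\<And>v \<psi>. cp v (cm v \<psi>) = - (norm v)\<^sup>2 *\<^sub>R \<psi>"
    and cmcp: "\<And>v \<phi>. cm v (cp v \<phi>) = - (norm v)\<^sup>2 *\<^sub>R \<phi>"
    and skew: "\<And>v \<phi> \<psi>. qherm (cp v \<phi>) \<psi> = - qherm \<phi> (cm v \<psi>)"
    using D3 by blast+
  have eq: "cp (qmul (qmul p v) (qconj m)) (qmul (qmul (qof l) \<phi>) (qconj p))
      = qmul (qmul (qof l) (cp v \<phi>)) (qconj m)"
    if "norm l = 1" "norm p = 1" "norm m = 1" for l p m v \<phi>
  proof -
    have "pm (l, p, m) \<in> SpinC" using that by (auto simp: SpinC_def)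
    from equiv[OF this, of v \<phi>] show ?thesis
      by (simp add: SO4_act_SpinC SpinC_to_U2_pm U2_act_pm that)
  qed
  define d where "d = cp q1 q1"
  define c where "c = fst d"
  \<comment> \<open>The element [i, i, i] fixes the vector 1 and the spinor 1, so \<open>d\<close>
    commutes with i.\<close>
  have "qmul qi (qconj qi) = q1" by (simp add: qmul_qconj)
  then have "d = qmul (qmul qi d) (qconj qi)"
    using eq[of \<i> qi qi q1 q1] by (simp add: d_def qof_i)
  then have d: "d = qof c"
    by (simp add: c_def quat_eq_iff quat_defs)
  \<comment> \<open>[1, \<phi>^-1, \<phi>^-1] fixes the vector 1 and takes the spinor 1 to
    \<phi>.\<close>
  have unit: "cp q1 \<phi> = qmul d \<phi>" if "norm \<phi> = 1" for \<phi>
    using eq[of 1 "qconj \<phi>" "qconj \<phi>" q1 q1] that by (simp add: d_def qmul_qconj)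
  have cp1: "cp q1 \<phi> = qmul d \<phi>" for \<phi>
    by (rule linear_quat_eqI[OF lin(3) linear_qmul(1)]) (simp_all add: unit)
  \<comment> \<open>[1, v, 1] takes the vector 1 to v and the spinor \<phi> v to \<phi>, and acts
    trivially on negative spinors.\<close>
  have cpu: "cp v \<phi> = qmul (qof c) (qmul \<phi> v)" if "norm v = 1" for v \<phi>
    using eq[of 1 v q1 q1 "qmul \<phi> v"] that
    by (simp add: cp1 d qmul_unit_cancel)
  have cp: "cp v \<phi> = qmul (qof c) (qmul \<phi> v)" for v \<phi>
  proof (rule linear_quat_eqI[OF lin(1)])
    show "linear (\<lambda>v. qmul (qof c) (qmul \<phi> v))"
      using linear_compose[OF linear_qmul(1) linear_qmul(1)] by (simp add: o_def)
  qed (simp_all add: cpu)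
  have nc: "norm c = 1"
  proof -
    have "qherm d d = - qherm q1 (cm q1 (cp q1 q1))" using skew by (simp add: d_def)
    also have "\<dots> = 1" unfolding cmcp by (simp add: qherm_def quat_defs)
    finally have "(norm d)\<^sup>2 = 1" unfolding qherm_self by (metis of_real_eq_1_iff)
    then show ?thesis using norm_ge_zero[of c] by (auto simp: d power2_eq_1_iff)
  qed
  have cmu: "cm v \<psi> = - qmul (qof (cnj c)) (qmul \<psi> (qconj v))" if "norm v = 1" for v \<psi>
  proof -
    have "qmul (qof c) (qmul (cm v \<psi>) v) = - \<psi>" using cpcm[of v \<psi>] that by (simp add: cp)
    then have "qmul (qof (cnj c)) (qmul (qmul (qof c) (qmul (cm v \<psi>) v)) (qconj v))
        = - qmul (qof (cnj c)) (qmul \<psi> (qconj v))" by (simp add: qmul_simps)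
    then show ?thesis by (simp add: qmul_assoc qmul_qconj qof_cnj_cancel nc that)
  qed
  have "linear (\<lambda>v. - qmul (qof (cnj c)) (qmul \<psi> (qconj v)))" for \<psi>
  proof (rule linearI)
    have q: "qconj (a + b) = qconj a + qconj b" "qconj (r *\<^sub>R a) = r *\<^sub>R qconj a" for a b r
      by (simp_all add: qconj_def prod_eq_iff)
    show "- qmul (qof (cnj c)) (qmul \<psi> (qconj (a + b)))
        = - qmul (qof (cnj c)) (qmul \<psi> (qconj a)) + - qmul (qof (cnj c)) (qmul \<psi> (qconj b))" for a b
      by (simp add: q qmul_simps)
    show "- qmul (qof (cnj c)) (qmul \<psi> (qconj (r *\<^sub>R a)))
        = r *\<^sub>R - qmul (qof (cnj c)) (qmul \<psi> (qconj a))" for r a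
      by (simp add: q qmul_simps)
  qed
  then have cm: "cm v \<psi> = - qmul (qof (cnj c)) (qmul \<psi> (qconj v))" for v \<psi>
    using linear_quat_eqI[OF lin(2)] cmu norm_qunits by (metis (no_types, lifting))
  show ?thesis by (rule that[OF nc cp cm])
qed


section \<open>The isomorphisms\<close>

text \<open>For a unit \<open>c\<close>, the factor \<open>cnj c\<close> undoes the constant in
  \<open>cp\<close>; placing it here lets positive spinors act by plain left multiplication.\<close>

definition spinor_to_T :: "complex \<Rightarrow> 'm lframe set \<Rightarrow> 'm \<Rightarrow> 'm spinor \<Rightarrow> 'm tvec" where
  "spinor_to_T c A x \<psi> = snd (frame_at A x) x (qmul (qof (cnj c)) (coord (frame_at A x) \<psi>))"

definition spinor_to_PSO :: "'m ah_manifold \<Rightarrow> 'm lframe set \<Rightarrow> 'm \<Rightarrow> 'm spinor \<Rightarrow> 'm tvec \<Rightarrow> 'm tvec" where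
  "spinor_to_PSO M A x \<phi> = mult_map M x (snd (frame_at A x) x) (coord (frame_at A x) \<phi>)"

context unitary4_at begin

text \<open>Smoothness can be tested only after the pointwise choice \<open>frame_at\<close> is
  replaced by a frame that stays fixed on an open set.\<close>

lemma spinor_to_T_frame:
  assumes F: "F \<in> A \<and> x \<in> fst F" and \<psi>: "\<psi> \<in> fibre (Wminus A) x"
  shows "spinor_to_T c A x \<psi> = snd F x (qmul (qof (cnj c)) (coord F \<psi>))"
proof -
  let ?G = "frame_at A x"
  note G = frame_at
  have "coord F \<psi> = inv (snd F x) (snd ?G x (coord ?G \<psi>))"
    using Wm.coord_change[of ?G F \<psi>] F G \<psi> by (simp add: Wminus_tr[OF G F])
  then have "qmul (qof (cnj c)) (coord F \<psi>)
      = inv (snd F x) (snd ?G x (qmul (qof (cnj c)) (coord ?G \<psi>)))"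
    using commute_qof[OF iso_change(1)[OF frame_iso[OF F] frame_iso[OF G]] frame_change_qi[OF G F]]
    by simp
  then show ?thesis
    by (simp add: spinor_to_T_def iso_change(3)[OF frame_iso[OF F] frame_iso[OF G]])
qed

text \<open>The endomorphisms are compared on the vectors of the chosen frame, where
  \<open>Wplus_tr\<close> states their equality.\<close>

lemma spinor_to_PSO_frame:
  assumes F: "F \<in> A \<and> x \<in> fst F" and \<phi>: "\<phi> \<in> fibre (Wplus A) x"
  shows "spinor_to_PSO M A x \<phi> = mult_map M x (snd F x) (coord F \<phi>)"
proof (rule ext_on_iso[OF frame_iso[OF frame_at]])
  let ?G = "frame_at A x"
  note G = frame_at
  note iF = frame_iso[OF F] and iG = frame_iso[OF G]
  fix w
  have "coord F \<phi> = cc_tr (Wplus A) ?G F x (coord ?G \<phi>)"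
    using Wp.coord_change[of ?G F \<phi>] F G \<phi> by simp
  then have "snd F x (qmul (coord F \<phi>) (inv (snd F x) (snd ?G x w))) = snd ?G x (qmul (coord ?G \<phi>) w)"
    by (simp add: Wplus_tr[OF G F] iso_change(3)[OF iF iG])
  then show "spinor_to_PSO M A x \<phi> (snd ?G x w) = mult_map M x (snd F x) (coord F \<phi>) (snd ?G x w)"
    by (simp add: spinor_to_PSO_def mult_map_iso[OF iG]) (simp add: mult_map_def iso_in[OF iG])
qed (simp_all add: spinor_to_PSO_def mult_map_def)

lemma bij_coord:
  assumes "linear_cocycle_at C x" "i \<in> cc_idx C \<and> x \<in> cc_dom C i"
  shows "bij_betw (coord i) (fibre C x) UNIV"
  by (rule bij_betw_byWitness[where f' = "cls C i x"])
    (use assms in \<open>auto simp: linear_cocycle_at.cls_coord linear_cocycle_at.coord_cls_same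
      linear_cocycle_at.cls_in_fibre\<close>)

lemma bij_qof: "norm c = 1 \<Longrightarrow> bij (qmul (qof (cnj c)))"
  by (rule bij_betw_byWitness[where f' = "qmul (qof c)"]) (simp_all add: qof_cnj_cancel)

lemma bij_spinor_to_T:
  assumes c: "norm c = 1"
  shows "bij_betw (spinor_to_T c A x) (fibre (Wminus A) x) (tspace M x)"
proof -
  note iF = frame_iso[OF frame_at]
  have "bij_betw (snd (frame_at A x) x) UNIV (tspace M x)"
    using iso_inj[OF iF] range_iso[OF iF] by (rule bij_betw_imageI)
  moreover have "bij_betw (coord (frame_at A x)) (fibre (Wminus A) x) UNIV"
    using frame_at by (intro bij_coord Wm.linear_cocycle_at_axioms) simp
  ultimately have "bij_betw (snd (frame_at A x) x \<circ> (qmul (qof (cnj c)) \<circ> coord (frame_at A x)))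
      (fibre (Wminus A) x) (tspace M x)"
    using bij_qof[OF c] by (intro bij_betw_trans)
  then show ?thesis by (simp add: spinor_to_T_def o_def cong: bij_betw_cong)
qed

lemma bij_spinor_to_PSO:
  "bij_betw (spinor_to_PSO M A x) (fibre (Wplus A) x) (pso_fibre M x)"
proof -
  note iF = frame_iso[OF frame_at]
  have "bij_betw (mult_map M x (snd (frame_at A x) x)) UNIV (pso_fibre M x)"
    using mult_map_inj[OF iF] pso_fibre_eq[OF iF, symmetric] by (rule bij_betw_imageI)
  moreover have "bij_betw (coord (frame_at A x)) (fibre (Wplus A) x) UNIV"
    using frame_at by (intro bij_coord Wp.linear_cocycle_at_axioms) simp
  ultimately have "bij_betw (mult_map M x (snd (frame_at A x) x) \<circ> coord (frame_at A x))
      (fibre (Wplus A) x) (pso_fibre M x)"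
    by (intro bij_betw_trans)
  then show ?thesis by (simp add: spinor_to_PSO_def o_def cong: bij_betw_cong)
qed

lemma spinor_to_T_hermitian:
  assumes c: "norm c = 1" and a: "a \<in> fibre (Wminus A) x" and b: "b \<in> fibre (Wminus A) x"
  shows "spinor_to_T c A x (hb_plus (spinor_bundle M (Wminus A)) x a b)
      = hb_plus (T_omega M) x (spinor_to_T c A x a) (spinor_to_T c A x b)"
    and "hb_herm (T_omega M) x (spinor_to_T c A x a) (spinor_to_T c A x b)
      = hb_herm (spinor_bundle M (Wminus A)) x a b"
    and "spinor_to_T c A x (hb_scale (spinor_bundle M (Wminus A)) x z a)
      = hb_scale (T_omega M) x z (spinor_to_T c A x a)"
proof -
  note F = frame_at and iF = frame_iso[OF frame_at]
  show "spinor_to_T c A x (hb_plus (spinor_bundle M (Wminus A)) x a b)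
      = hb_plus (T_omega M) x (spinor_to_T c A x a) (spinor_to_T c A x b)"
    using F a b by (simp add: spinor_to_T_def spinor_bundle_def T_omega_def Wm.coord_fplus
        qmul_simps iso_add[OF iF])
  show "spinor_to_T c A x (hb_scale (spinor_bundle M (Wminus A)) x z a)
      = hb_scale (T_omega M) x z (spinor_to_T c A x a)"
    using F by (simp add: spinor_to_T_def spinor_bundle_def frame_qof idx_at_W
        qmul_assoc[symmetric] qof_mult mult.commute)
  have "hb_herm (T_omega M) x (snd (frame_at A x) x p) (snd (frame_at A x) x q) = qherm p q" for p q
    using F by (simp add: T_omega_def frame_J[symmetric] iso_metric[OF iF] qherm_conv)
  moreover have "c * cnj c = 1"
    using c by (simp add: complex_norm_square[symmetric])
  ultimately show "hb_herm (T_omega M) x (spinor_to_T c A x a) (spinor_to_T c A x b)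
      = hb_herm (spinor_bundle M (Wminus A)) x a b"
    by (simp add: spinor_to_T_def spinor_bundle_def idx_at_W qherm_qof mult.assoc[symmetric] mult.commute)
qed

lemma spinor_to_PSO_hermitian:
  assumes a: "a \<in> fibre (Wplus A) x" and b: "b \<in> fibre (Wplus A) x"
  shows "spinor_to_PSO M A x (hb_plus (spinor_bundle M (Wplus A)) x a b)
      = hb_plus (PSO_omega M) x (spinor_to_PSO M A x a) (spinor_to_PSO M A x b)"
    and "hb_herm (PSO_omega M) x (spinor_to_PSO M A x a) (spinor_to_PSO M A x b)
      = hb_herm (spinor_bundle M (Wplus A)) x a b"
    and "spinor_to_PSO M A x (hb_scale (spinor_bundle M (Wplus A)) x z a)
      = hb_scale (PSO_omega M) x z (spinor_to_PSO M A x a)"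
  using frame_at a b
  by (simp_all add: spinor_to_PSO_def spinor_bundle_def PSO_omega_def Wp.coord_fplus idx_at_W
      pso_plus_mult_map[OF frame_iso[OF frame_at]] pso_scale_mult_map pso_inner_mult_map qof_i qherm_conv)

lemma spinor_to_T_clifford:
  assumes c: "norm c = 1" and cp: "\<And>v \<phi>. cp v \<phi> = qmul (qof c) (qmul \<phi> v)"
    and v: "v \<in> tspace M x"
  shows "spinor_to_T c A x (clifford_plus cp A x v \<phi>) = spinor_to_PSO M A x \<phi> v"
  using frame_at v
  by (simp add: spinor_to_T_def clifford_plus_def Let_def cp qof_cnj_cancel[OF c]
      spinor_to_PSO_def mult_map_def)

end

section \<open>The squaring map\<close>

lemma sum_pairs_4:
  "(\<Sum>b<4. \<Sum>a<b. g a b) = g 0 1 + (g 0 2 + g 1 2) + (g 0 3 + g 1 3 + g (2::nat) (3::nat))"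
  for g :: "nat \<Rightarrow> nat \<Rightarrow> 'a::comm_monoid_add"
  by (simp add: eval_nat_numeral lessThan_Suc ac_simps)

lemma bilinear_quat_eqI:
  fixes f g :: "quat \<Rightarrow> quat \<Rightarrow> 'a::real_vector"
  assumes "\<And>b. linear (\<lambda>a. f a b)" "\<And>a. linear (f a)" "\<And>b. linear (\<lambda>a. g a b)" "\<And>a. linear (g a)"
    and "\<And>a b. a \<in> {q1, qi, qj, qk} \<Longrightarrow> b \<in> {q1, qi, qj, qk} \<Longrightarrow> f a b = g a b"
  shows "f a b = g a b"
proof -
  have "f a b = g a b" if "a \<in> {q1, qi, qj, qk}" for a b
    by (rule linear_quat_eqI[OF assms(2,4)]) (use assms(5)[OF that] in simp_all)
  then have *: "f q1 b = g q1 b" "f qi b = g qi b" "f qj b = g qj b" "f qk b = g qk b"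
    by simp_all
  show ?thesis by (rule linear_quat_eqI[OF assms(1,3) *])
qed

text \<open>Since right multiplication by \<open>qi\<close>, \<open>qj\<close>, \<open>qk\<close> commutes with complex scalars, the images
  of \<open>q1\<close> and \<open>qj\<close> determine the coefficients.\<close>

lemma right_coefficients_eq:
  assumes "\<And>\<psi>. qmul (qof p) (qmul \<psi> qi) + qmul (qof q) (qmul \<psi> qj) + qmul (qof r) (qmul \<psi> qk)
    = qmul (qof p') (qmul \<psi> qi) + qmul (qof q') (qmul \<psi> qj) + qmul (qof r') (qmul \<psi> qk)"
  shows "p = p'" "q = q'" "r = r'"
proof -
  have eq: "p * \<i> = p' * \<i>" "q + r * \<i> = q' + r' * \<i>" "r * \<i> - q = r' * \<i> - q'"
    using arg_cong[OF assms[of q1], of fst] arg_cong[OF assms[of q1], of snd]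
      arg_cong[OF assms[of qj], of fst] by (simp_all add: quat_defs)
  show "p = p'" using eq(1) by simp
  have "2 * q = (q + r * \<i>) - (r * \<i> - q)" by simp
  also have "\<dots> = 2 * q'" unfolding eq(2,3) by simp
  finally show q: "q = q'" by simp
  show "r = r'" using eq(2) by (simp add: q)
qed

text \<open>\<open>p\<close> represents the pullback of \<omega>: the inner product of i \<phi> v
  with \<phi> w is that of p v with w. As \<open>p\<close> is imaginary, the left side collects to
  -1/2 i \<psi> p.\<close>

lemma squaring_identity:
  fixes \<phi> \<psi> :: quat
  defines "p \<equiv> qmul (qconj \<phi>) (qmul qi \<phi>)"
  shows "- 2 *\<^sub>R (qmul (qof (\<i> * of_real (inner p qi / 4))) (qmul \<psi> qi)
      + qmul (qof (\<i> * of_real (inner p qj / 4))) (qmul \<psi> qj)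
      + qmul (qof (\<i> * of_real (inner p qk / 4))) (qmul \<psi> qk))
    = qmul (qof (qherm \<psi> \<phi>)) \<phi> + qmul (qof (- (1/2) * qherm \<phi> \<phi>)) \<psi>"
proof -
  have "inner p q1 = 0"
    by (simp add: p_def inner_quat quat_defs algebra_simps)
  then have p: "p = inner p qi *\<^sub>R qi + inner p qj *\<^sub>R qj + inner p qk *\<^sub>R qk"
    using quat_expand[of p] by (simp add: inner_quat_units)
  have q: "qof (\<i> * of_real r / 4) = (r / 4) *\<^sub>R qi" for r
    by (simp add: quat_eq_iff quat_defs)
  have "- 2 *\<^sub>R (qmul (qof (\<i> * of_real (inner p qi / 4))) (qmul \<psi> qi)
      + qmul (qof (\<i> * of_real (inner p qj / 4))) (qmul \<psi> qj)
      + qmul (qof (\<i> * of_real (inner p qk / 4))) (qmul \<psi> qk))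
    = - (1/2) *\<^sub>R qmul qi (qmul \<psi> p)"
    by (subst (4) p) (simp add: q qmul_simps scaleR_add_right)
  also have "\<dots> = - (1/2) *\<^sub>R qmul (qmul qi (qmul (qmul \<psi> (qconj \<phi>)) qi)) \<phi>"
    by (simp add: p_def qmul_assoc)
  \<comment> \<open>Placing a quaternion between two factors i negates its complex part and keeps
    the rest; the complex part of \<psi> times the conjugate of \<phi> is their Hermitian
    product.\<close>
  also have "qmul qi (qmul (qmul \<psi> (qconj \<phi>)) qi)
      = qmul \<psi> (qconj \<phi>) - 2 *\<^sub>R qof (qherm \<psi> \<phi>)"
    by (simp add: quat_eq_iff quat_defs qherm_def)
  also have "- (1/2) *\<^sub>R qmul (qmul \<psi> (qconj \<phi>) - 2 *\<^sub>R qof (qherm \<psi> \<phi>)) \<phi>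
      = qmul (qof (qherm \<psi> \<phi>)) \<phi> - (1/2 * (norm \<phi>)\<^sup>2) *\<^sub>R \<psi>"
    by (simp add: qmul_simps qmul_assoc qmul_qconj scaleR_diff_right)
  also have "(1/2 * (norm \<phi>)\<^sup>2) *\<^sub>R \<psi> = - qmul (qof (- (1/2) * qherm \<phi> \<phi>)) \<psi>"
    unfolding qherm_self by (simp add: quat_eq_iff quat_defs)
  finally show ?thesis by simp
qed

section \<open>Self-dual forms at a point\<close>

context almost_hermitian4_at begin

text \<open>The right-hand side depends on \<open>b\<close> only through its norm, which gives the self-duality
  equations in every oriented isometric frame.\<close>

lemma selfdual_pullback:
  assumes f: "oriented_isometry M x f" and f': "oriented_isometry M x f'"
  shows "inner (qmul p (inv f (f' b))) (inv f (f' (qmul a b)))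
    = (norm b)\<^sup>2 * inner p (qmul (inv f (f' a)) (qconj (inv f (f' q1))))"
  unfolding iso_change_qmul[OF f f'] inner_qmul_same
  using iso_change(2)[OF f f', of b b] by (simp add: norm_eq_sqrt_inner)

lemma selfdual_formD:
  assumes \<eta>: "selfdual_form M x \<eta>"
    and uvw: "u \<in> tspace M x" "v \<in> tspace M x" "w \<in> tspace M x"
  shows "\<eta> (fplus (TM M) x u v) w = \<eta> u w + \<eta> v w"
    "\<eta> (fscale (TM M) x r u) w = of_real r * \<eta> u w" "\<eta> v u = - \<eta> u v"
  using \<eta>[unfolded selfdual_form_def, THEN conjunct2, THEN conjunct1,
      THEN bspec, OF uvw(1), THEN bspec, OF uvw(2), THEN bspec, OF uvw(3), THEN spec, of r]
  by blast+

lemma selfdual_form_units: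
  assumes \<eta>: "selfdual_form M x \<eta>" and f: "oriented_isometry M x f"
  shows "\<eta> (f qj) (f qk) = \<eta> (f q1) (f qi)" "\<eta> (f qi) (f qj) = \<eta> (f q1) (f qk)"
    "\<eta> (f qi) (f qk) = - \<eta> (f q1) (f qj)" "\<eta> (f a) (f b) = - \<eta> (f b) (f a)"
proof -
  have sd: "\<eta> (f q1) (f qi) = \<eta> (f qj) (f qk)" "\<eta> (f q1) (f qj) = \<eta> (f qk) (f qi)"
        "\<eta> (f q1) (f qk) = \<eta> (f qi) (f qj)"
    using \<eta>[unfolded selfdual_form_def, THEN conjunct2, THEN conjunct2, rule_format, OF f]
    by blast+
  show ab: "\<eta> (f a) (f b) = - \<eta> (f b) (f a)" for a b
    by (rule selfdual_formD(3)[OF \<eta> iso_in[OF f] iso_in[OF f] iso_in[OF f]])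
  show "\<eta> (f qj) (f qk) = \<eta> (f q1) (f qi)" "\<eta> (f qi) (f qj) = \<eta> (f q1) (f qk)"
    "\<eta> (f qi) (f qk) = - \<eta> (f q1) (f qj)"
    by (simp_all only: sd ab[of qi qk])
qed

text \<open>Self-dual forms have rank three: antisymmetry and duality supply the remaining pairs of
  basis vectors, and the normalization covers arguments outside the tangent space.\<close>

lemma selfdual_form_eqI:
  assumes \<eta>: "selfdual_form M x \<eta>" and \<theta>: "selfdual_form M x \<theta>" and f: "oriented_isometry M x f"
    and eq: "\<eta> (f q1) (f qi) = \<theta> (f q1) (f qi)" "\<eta> (f q1) (f qj) = \<theta> (f q1) (f qj)"
      "\<eta> (f q1) (f qk) = \<theta> (f q1) (f qk)"
  shows "\<eta> = \<theta>"
proof -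
  have lin: "linear (\<lambda>a. \<zeta> (f a) (f b))" "linear (\<lambda>a. \<zeta> (f b) (f a))" if "selfdual_form M x \<zeta>" for \<zeta> b
  proof -
    note z = selfdual_formD[OF that]
    show l: "linear (\<lambda>a. \<zeta> (f a) (f b))" for b
      by (rule linearI)
        (simp_all only: iso_add[OF f] iso_scale[OF f] z(1,2)[OF iso_in[OF f] iso_in[OF f] iso_in[OF f]]
          scaleR_conv_of_real)
    have "(\<lambda>a. \<zeta> (f b) (f a)) = (\<lambda>a. - \<zeta> (f a) (f b))"
      by (intro ext selfdual_form_units(4)[OF that f])
    then show "linear (\<lambda>a. \<zeta> (f b) (f a))"
      using linear_compose_neg[OF l[of b]] by simp
  qed
  have zero: "\<zeta> (f a) (f a) = 0" if "selfdual_form M x \<zeta>" for \<zeta> a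
    using selfdual_form_units(4)[OF that f, of a a] by simp
  note u\<eta> = selfdual_form_units[OF \<eta> f] and u\<theta> = selfdual_form_units[OF \<theta> f]
  have "\<eta> (f a) (f b) = \<theta> (f a) (f b)" for a b
  proof (rule bilinear_quat_eqI[where f = "\<lambda>a b. \<eta> (f a) (f b)" and g = "\<lambda>a b. \<theta> (f a) (f b)"])
    have up: "\<eta> (f q1) (f qi) = \<theta> (f q1) (f qi)" "\<eta> (f q1) (f qj) = \<theta> (f q1) (f qj)"
      "\<eta> (f q1) (f qk) = \<theta> (f q1) (f qk)" "\<eta> (f qi) (f qj) = \<theta> (f qi) (f qj)"
      "\<eta> (f qi) (f qk) = \<theta> (f qi) (f qk)" "\<eta> (f qj) (f qk) = \<theta> (f qj) (f qk)"
      by (simp_all add: u\<eta>(1-3) u\<theta>(1-3) eq)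
    have rev: "\<eta> (f b) (f a) = \<theta> (f b) (f a)" if "\<eta> (f a) (f b) = \<theta> (f a) (f b)" for a b
      using that by (subst u\<eta>(4), subst u\<theta>(4)) simp
    show "\<eta> (f a) (f b) = \<theta> (f a) (f b)"
      if "a \<in> {q1, qi, qj, qk}" "b \<in> {q1, qi, qj, qk}" for a b
      using that up up[THEN rev] by (elim insertE emptyE) (simp_all add: zero[OF \<eta>] zero[OF \<theta>])
  qed (rule lin[OF \<eta>] lin[OF \<theta>])+
  then have *: "\<eta> (f (inv f v)) (f (inv f w)) = \<theta> (f (inv f v)) (f (inv f w))" for v w .
  show ?thesis
  proof (intro ext)
    fix v w
    show "\<eta> v w = \<theta> v w"
    proof (cases "v \<in> tspace M x \<and> w \<in> tspace M x")
      case True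
      then show ?thesis using *[of v w] by (simp add: iso_inv(2)[OF f])
    next
      case False
      then have "\<eta> v w = 0" "\<theta> v w = 0" using \<eta> \<theta> unfolding selfdual_form_def by blast+
      then show ?thesis by simp
    qed
  qed
qed

end

context unitary4_at begin

text \<open>The Clifford constant cancels in the composite, which sends \<psi> to minus \<psi> b
  times the conjugate of a. Self-duality then makes the six terms pair up equally, whence the factor
  -2.\<close>

lemma form_action_selfdual:
  assumes c: "norm c = 1" and cp: "\<And>v \<phi>. cp v \<phi> = qmul (qof c) (qmul \<phi> v)"
    and cm: "\<And>v \<psi>. cm v \<psi> = - qmul (qof (cnj c)) (qmul \<psi> (qconj v))"
    and \<eta>: "selfdual_form M x \<eta>"
  defines "F \<equiv> frame_at A x"
  defines "f \<equiv> snd F x"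
  shows "form_action cp cm A x \<eta> \<psi> = cls (Wplus A) F x
    (- 2 *\<^sub>R (qmul (qof (\<eta> (f q1) (f qi))) (qmul (coord F \<psi>) qi)
      + qmul (qof (\<eta> (f q1) (f qj))) (qmul (coord F \<psi>) qj)
      + qmul (qof (\<eta> (f q1) (f qk))) (qmul (coord F \<psi>) qk)))"
proof -
  have F: "F \<in> A \<and> x \<in> fst F" unfolding F_def by (rule frame_at)
  have f: "oriented_isometry M x f" unfolding f_def by (rule frame_iso[OF F])
  have act: "coord F (clifford_minus cm A x (f a) (clifford_plus cp A x (f b) \<psi>))
      = - qmul (coord F \<psi>) (qmul b (qconj a))" for a b
    using F unfolding clifford_minus_def clifford_plus_def Let_def F_def[symmetric] f_def[symmetric]
    by (simp add: iso_inv(1)[OF f] cp cm qmul_assoc qof_cnj_cancel[OF c])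
  have units: "qmul qi (qconj q1) = qi" "qmul qj (qconj q1) = qj" "qmul qk (qconj q1) = qk"
    "qmul qj (qconj qi) = qk" "qmul qk (qconj qi) = - qj" "qmul qk (qconj qj) = qi"
    by (simp_all add: quat_eq_iff quat_defs)
  have "form_action cp cm A x \<eta> \<psi> = cls (Wplus A) F x (\<Sum>b<4. \<Sum>a<b.
      - qmul (qof (\<eta> (f ([q1, qi, qj, qk] ! a)) (f ([q1, qi, qj, qk] ! b))))
        (qmul (coord F \<psi>) (qmul ([q1, qi, qj, qk] ! b) (qconj ([q1, qi, qj, qk] ! a)))))"
    unfolding form_action_def Let_def F_def[symmetric] f_def[symmetric] act by (simp add: qmul_simps)
  also have "\<dots> = cls (Wplus A) F x
    (- 2 *\<^sub>R (qmul (qof (\<eta> (f q1) (f qi))) (qmul (coord F \<psi>) qi)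
      + qmul (qof (\<eta> (f q1) (f qj))) (qmul (coord F \<psi>) qj)
      + qmul (qof (\<eta> (f q1) (f qk))) (qmul (coord F \<psi>) qk)))"
    unfolding sum_pairs_4
    by (simp add: units selfdual_form_units(1-3)[OF \<eta> f] qof_uminus qmul_simps scaleR_2 algebra_simps)
  finally show ?thesis .
qed

text \<open>The definite description in \<open>i_squaring\<close> is met by exhibiting i/4 times the
  pullback of \<omega> and showing that its action on spinors determines a self-dual form.\<close>

lemma squaring_eq:
  assumes c: "norm c = 1" and cp: "\<And>v \<phi>. cp v \<phi> = qmul (qof c) (qmul \<phi> v)"
    and cm: "\<And>v \<psi>. cm v \<psi> = - qmul (qof (cnj c)) (qmul \<psi> (qconj v))"
    and v: "v \<in> tspace M x" and w: "w \<in> tspace M x"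
  shows "squaring cp cm M A x \<phi> v w
    = of_real (1/4 * omega M (spinor_to_PSO M A x \<phi> v) (spinor_to_PSO M A x \<phi> w))"
proof -
  define F where "F = frame_at A x"
  define f where "f = snd F x"
  define q where "q = coord F \<phi>"
  define p where "p = qmul (qconj q) (qmul qi q)"
  have F: "F \<in> A \<and> x \<in> fst F" unfolding F_def by (rule frame_at)
  have f: "oriented_isometry M x f" unfolding f_def by (rule frame_iso[OF F])
  have pc: "qconj p = - p" unfolding p_def by (simp add: quat_eq_iff quat_defs)
  \<comment> \<open>This is i/4 times the pullback of \<omega>, written with \<open>p\<close>; the
    value 0 elsewhere is the normalization in \<open>selfdual_form\<close>.\<close>
  define \<theta> :: "'m tvec \<Rightarrow> 'm tvec \<Rightarrow> complex" where
    "\<theta> v w = (if v \<in> tspace M x \<and> w \<in> tspace M x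
      then \<i> * of_real (inner (qmul p (inv f v)) (inv f w) / 4) else 0)" for v w
  have \<theta>f: "\<theta> (f a) (f b) = \<i> * of_real (inner (qmul p a) b / 4)" for a b
    by (simp add: \<theta>_def iso_in[OF f] iso_inv(1)[OF f])
  have \<theta>: "selfdual_form M x \<theta>"
    unfolding selfdual_form_def
  proof (intro conjI ballI allI impI)
    fix v w assume "v \<notin> tspace M x \<or> w \<notin> tspace M x"
    then show "\<theta> v w = 0" by (auto simp: \<theta>_def)
  next
    fix u v w r assume uvw: "u \<in> tspace M x" "v \<in> tspace M x" "w \<in> tspace M x"
    then show "\<theta> (fplus (TM M) x u v) w = \<theta> u w + \<theta> v w"
      by (simp add: \<theta>_def iso_inv_add[OF f] qmul_simps inner_simps add_divide_distrib distrib_left)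
    from uvw show "\<theta> (fscale (TM M) x r u) w = of_real r * \<theta> u w"
      by (simp add: \<theta>_def iso_inv_scale[OF f] qmul_simps)
    have "inner (qmul p a) b = - inner (qmul p b) a" for a b
      by (simp add: inner_qmul_left[of p a] pc qmul_simps inner_commute[of a])
    from this[of "inv f v" "inv f u"] uvw show "\<theta> v u = - \<theta> u v" by (simp add: \<theta>_def)
  next
    fix f' assume f': "oriented_isometry M x f'"
    \<comment> \<open>For unit \<open>b\<close> the value depends on \<open>a\<close> only. Each
      duality equation compares \<open>b = q1\<close> with another basis unit for the same
      \<open>a\<close>.\<close>
    have *: "\<theta> (f' b) (f' (qmul a b))
        = \<i> * of_real (inner p (qmul (inv f (f' a)) (qconj (inv f (f' q1)))) / 4)"
      if "norm b = 1" for a b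
      using that by (simp add: \<theta>_def iso_in[OF f'] selfdual_pullback[OF f f'])
    show "\<theta> (f' q1) (f' qi) = \<theta> (f' qj) (f' qk)"
      unfolding *[OF norm_qunits(1), of qi, unfolded qmul_q1]
        *[OF norm_qunits(3), of qi, unfolded qunit_table] ..
    show "\<theta> (f' q1) (f' qj) = \<theta> (f' qk) (f' qi)"
      unfolding *[OF norm_qunits(1), of qj, unfolded qmul_q1]
        *[OF norm_qunits(4), of qj, unfolded qunit_table] ..
    show "\<theta> (f' q1) (f' qk) = \<theta> (f' qi) (f' qj)"
      unfolding *[OF norm_qunits(1), of qk, unfolded qmul_q1]
        *[OF norm_qunits(2), of qk, unfolded qunit_table] ..
  qed
  note act = form_action_selfdual[OF c cp cm, folded F_def f_def]
  let ?W = "spinor_bundle M (Wplus A)"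
  have rhs: "hb_plus ?W x (hb_scale ?W x (hb_herm ?W x \<psi> \<phi>) \<phi>)
      (hb_scale ?W x (- (1/2) * hb_herm ?W x \<phi> \<phi>) \<psi>)
      = cls (Wplus A) F x (qmul (qof (qherm (coord F \<psi>) q)) q + qmul (qof (- (1/2) * qherm q q)) (coord F \<psi>))"
    for \<psi>
    using F unfolding spinor_bundle_def hbundle.simps fplus_def idx_at_W F_def[symmetric] q_def[symmetric]
    by simp
  have \<theta>act: "form_action cp cm A x \<theta> \<psi> = hb_plus ?W x (hb_scale ?W x (hb_herm ?W x \<psi> \<phi>) \<phi>)
      (hb_scale ?W x (- (1/2) * hb_herm ?W x \<phi> \<phi>) \<psi>)" for \<psi>
    unfolding rhs act[OF \<theta>] \<theta>f qmul_q1 p_def squaring_identity ..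
  have "i_squaring cp cm M A x \<phi> = \<theta>"
    unfolding i_squaring_def Let_def
  proof (rule the_equality)
    show "selfdual_form M x \<theta> \<and> (\<forall>\<psi>\<in>hb_fibre ?W x. form_action cp cm A x \<theta> \<psi>
      = hb_plus ?W x (hb_scale ?W x (hb_herm ?W x \<psi> \<phi>) \<phi>)
          (hb_scale ?W x (- (1/2) * hb_herm ?W x \<phi> \<phi>) \<psi>))"
      using \<theta> \<theta>act by blast
    fix \<eta> assume \<eta>: "selfdual_form M x \<eta> \<and> (\<forall>\<psi>\<in>hb_fibre ?W x. form_action cp cm A x \<eta> \<psi>
      = hb_plus ?W x (hb_scale ?W x (hb_herm ?W x \<psi> \<phi>) \<phi>)
          (hb_scale ?W x (- (1/2) * hb_herm ?W x \<phi> \<phi>) \<psi>))"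
    then have sd: "selfdual_form M x \<eta>" by blast
    let ?r = "\<lambda>\<eta> a. qmul (qof (\<eta> (f q1) (f qi))) (qmul a qi)
      + qmul (qof (\<eta> (f q1) (f qj))) (qmul a qj) + qmul (qof (\<eta> (f q1) (f qk))) (qmul a qk)"
    \<comment> \<open>The spinor with coordinate \<open>a\<close> is arbitrary, so equal actions
      give an identity in \<open>a\<close>, from which the three coefficients are read off.\<close>
    have r: "?r \<eta> a = ?r \<theta> a" for a
    proof -
      have "cls (Wplus A) F x a \<in> hb_fibre ?W x"
        using F by (simp add: spinor_bundle_def)
      then have "form_action cp cm A x \<eta> (cls (Wplus A) F x a) = form_action cp cm A x \<theta> (cls (Wplus A) F x a)"
        using \<eta> \<theta>act by simp
      then have "coord F (cls (Wplus A) F x (- 2 *\<^sub>R ?r \<eta> a)) = coord F (cls (Wplus A) F x (- 2 *\<^sub>R ?r \<theta> a))"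
        unfolding act[OF sd] act[OF \<theta>] using F by simp
      then show ?thesis using F by simp
    qed
    show "\<eta> = \<theta>"
      by (rule selfdual_form_eqI[OF sd \<theta> f]; rule right_coefficients_eq[OF r])
  qed
  moreover have "omega M (spinor_to_PSO M A x \<phi> v) (spinor_to_PSO M A x \<phi> w)
      = inner (qmul p (inv f v)) (inv f w)"
    unfolding spinor_to_PSO_def F_def[symmetric] f_def[symmetric] q_def[symmetric] omega_def mult_map_def
    using v w by (simp add: frame_J[OF F, folded f_def, symmetric] iso_metric[OF f] p_def qmul_assoc
        inner_qmul_left[of "qconj q"])
  ultimately show ?thesis
    using v w by (simp add: squaring_def \<theta>_def)
qed

end

section \<open>Smoothness of the isomorphisms\<close>

lemma linear_basis_sum:
  fixes f :: "'a::euclidean_space \<Rightarrow> 'b::real_vector"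
  assumes "linear f"
  shows "f y = (\<Sum>i\<in>Basis. inner y i *\<^sub>R f i)"
  by (subst euclidean_representation[symmetric, of y])
    (simp only: linear_sum[OF assms] linear_scale[OF assms])

context manifold4 begin

text \<open>Expanding the argument in a basis reduces evaluation of a linear family to sums of
  products of smooth functions.\<close>

lemma smooth_fun_linear_family:
  fixes L :: "'m \<Rightarrow> 'a::euclidean_space \<Rightarrow> 'b::euclidean_space"
  assumes U: "openin (topo M) U" and lin: "\<And>x. x \<in> U \<Longrightarrow> linear (L x)"
    and L: "\<And>b. smooth_fun M U (\<lambda>x. L x b)" and a: "smooth_fun M U a"
  shows "smooth_fun M U (\<lambda>x. L x (a x))"
proof (rule smooth_fun_cong[OF U])
  show "(\<Sum>i\<in>Basis. inner (a x) i *\<^sub>R L x i) = L x (a x)" if "x \<in> U" for x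
    by (rule linear_basis_sum[OF lin[OF that], symmetric])
  show "smooth_fun M U (\<lambda>x. \<Sum>i\<in>Basis. inner (a x) i *\<^sub>R L x i)"
  proof (rule smooth_fun_sum[OF U finite_Basis])
    fix i :: 'a
    have "smooth_fun M U (\<lambda>x. inner (a x) i)"
      by (rule smooth_fun_bilinear[OF bounded_bilinear_inner U a smooth_fun_const])
    then show "smooth_fun M U (\<lambda>x. inner (a x) i *\<^sub>R L x i)"
      by (rule smooth_fun_bilinear[OF bounded_bilinear_scaleR U _ L])
  qed
qed

end

context unitary4 begin

lemma at: "x \<in> topspace (topo M) \<Longrightarrow> unitary4_at M A x"
  by unfold_locales

lemma frame_openin: "F \<in> A \<Longrightarrow> openin (topo M) (fst F)"
  using uf unfolding unitary_frames_def by blast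

lemma smooth_fun_framewise:
  assumes "openin (topo M) S" "\<And>F. F \<in> A \<Longrightarrow> smooth_fun M (S \<inter> fst F) f"
  shows "smooth_fun M S f"
proof -
  have "(\<Union>F\<in>A. fst F) = topspace (topo M)"
    using uf unfolding unitary_frames_def by blast
  then have "\<Union>((\<lambda>F. S \<inter> fst F) ` A) = S"
    using openin_subset[OF assms(1)] by auto
  moreover have "smooth_fun M (\<Union>((\<lambda>F. S \<inter> fst F) ` A)) f"
    using assms by (intro smooth_fun_local) (auto intro: frame_openin)
  ultimately show ?thesis by simp
qed

section \<open>Smoothness over one chart and one frame\<close>

context
  fixes U c F
  assumes c: "c \<in> atlas M" and F: "F \<in> A" and U: "openin (topo M) U" "U \<subseteq> fst c" "U \<subseteq> fst F"
begin

lemma local_at: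
  assumes "x \<in> U"
  shows "unitary4_at M A x" "c \<in> cc_idx (TM M) \<and> x \<in> cc_dom (TM M) c" "F \<in> A \<and> x \<in> fst F"
    "oriented_isometry M x (snd F x)" "linear_cocycle_at (TM M) x" "almost_hermitian4_at M x"
proof -
  show at: "unitary4_at M A x" using assms U openin_subset by (intro at) blast
  show "c \<in> cc_idx (TM M) \<and> x \<in> cc_dom (TM M) c" using c U assms by auto
  show F': "F \<in> A \<and> x \<in> fst F" using F U assms by auto
  interpret unitary4_at M A x by (rule at)
  show "oriented_isometry M x (snd F x)" using F' by (rule frame_iso)
  show "linear_cocycle_at (TM M) x" "almost_hermitian4_at M x"
    by (rule T.linear_cocycle_at_axioms, rule almost_hermitian4_at_axioms)
qed

lemma smooth_frame_apply:
  assumes "smooth_fun M U a"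
  shows "smooth_fun M U (\<lambda>x. coord c (snd F x (a x)))"
proof (rule smooth_fun_linear_family[OF U(1) _ _ assms])
  show "linear (\<lambda>q. coord c (snd F x q))" if "x \<in> U" for x
    by (rule almost_hermitian4_at.iso_coord_linear[OF local_at(6)[OF that] local_at(4)[OF that] local_at(2)[OF that]])
  have "smooth_fun M (fst F \<inter> fst c) (\<lambda>x. coord c (snd F x b))" for b
  proof -
    have "smooth_section M (TM M) (fst F) (\<lambda>x. snd F x b)"
      using uf[unfolded unitary_frames_def, THEN conjunct2] F by blast
    then show ?thesis using c by (simp add: smooth_section_def)
  qed
  then show "smooth_fun M U (\<lambda>x. coord c (snd F x b))" for b
    by (rule smooth_fun_subset) (use U in blast)
qed

text \<open>\<open>riemannian_metric\<close> grants smoothness on constant chart vectors;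
  bilinearity extends it to smooth ones, one argument at a time.\<close>

lemma smooth_metric:
  assumes y: "smooth_fun M U y" and z: "smooth_fun M U z"
  shows "smooth_fun M U (\<lambda>x. metric M (cls (TM M) c x (y x)) (cls (TM M) c x (z x)))"
proof -
  have lin: "linear (\<lambda>u. metric M (cls (TM M) c x u) (cls (TM M) c x w))"
      "linear (\<lambda>u. metric M (cls (TM M) c x w) (cls (TM M) c x u))" if "x \<in> U" for x w
  proof -
    interpret unitary4_at M A x by (rule local_at(1)[OF that])
    note v = local_at(2)[OF that]
    note t = T.cls_in_fibre[OF v]
    show "linear (\<lambda>u. metric M (cls (TM M) c x u) (cls (TM M) c x w))"
      "linear (\<lambda>u. metric M (cls (TM M) c x w) (cls (TM M) c x u))"
      by (auto intro!: linearI simp: T.cls_add[OF v, symmetric] T.cls_scale[OF v, symmetric]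
          metric_simps(1-4)[OF t t t])
  qed
  have "riemannian_metric M" using ah by (simp add: almost_hermitian_4manifold_def)
  then have "smooth_fun M (fst c) (\<lambda>x. metric M (cls (TM M) c x a) (cls (TM M) c x b))" for a b
    using c by (simp add: riemannian_metric_def)
  then have ab: "smooth_fun M U (\<lambda>x. metric M (cls (TM M) c x a) (cls (TM M) c x b))" for a b
    by (rule smooth_fun_subset) (use U in blast)
  have az: "smooth_fun M U (\<lambda>x. metric M (cls (TM M) c x a) (cls (TM M) c x (z x)))" for a
    by (rule smooth_fun_linear_family[where L = "\<lambda>x u. metric M (cls (TM M) c x a) (cls (TM M) c x u)",
          OF U(1) lin(2) ab z])
  show ?thesis
    by (rule smooth_fun_linear_family[where L = "\<lambda>x u. metric M (cls (TM M) c x u) (cls (TM M) c x (z x))",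
          OF U(1) lin(1) az y])
qed

text \<open>No matrix is inverted: the frame is orthonormal, so the coordinates of a vector are its
  inner products with the frame vectors.\<close>

lemma smooth_frame_inv:
  assumes y: "smooth_fun M U y"
  shows "smooth_fun M U (\<lambda>x. inv (snd F x) (cls (TM M) c x (y x)))"
proof (rule smooth_fun_cong[OF U(1)])
  show "(\<Sum>i\<in>Basis. metric M (cls (TM M) c x (y x)) (cls (TM M) c x (coord c (snd F x i))) *\<^sub>R i)
      = inv (snd F x) (cls (TM M) c x (y x))" if "x \<in> U" for x
  proof -
    interpret unitary4_at M A x by (rule local_at(1)[OF that])
    note v = local_at(2)[OF that] and iF = local_at(4)[OF that]
    have "metric M (cls (TM M) c x (y x)) (cls (TM M) c x (coord c (snd F x i)))
        = inner (inv (snd F x) (cls (TM M) c x (y x))) i" for i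
      by (simp add: T.cls_coord[OF v iso_in[OF iF]] metric_iso_inv[OF iF T.cls_in_fibre[OF v] iso_in[OF iF]]
          iso_inv(1)[OF iF])
    then show ?thesis by (simp add: euclidean_representation)
  qed
  show "smooth_fun M U (\<lambda>x. \<Sum>i\<in>Basis.
      metric M (cls (TM M) c x (y x)) (cls (TM M) c x (coord c (snd F x i))) *\<^sub>R i)"
    by (rule smooth_fun_sum[OF U(1) finite_Basis])
      (rule smooth_fun_bilinear[OF bounded_bilinear_scaleR U(1)
          smooth_metric[OF y smooth_frame_apply[OF smooth_fun_const]] smooth_fun_const])
qed

end

lemma hermitian_iso_spinor_to_T:
  assumes k: "norm k = 1"
  shows "hermitian_bundle_iso (topo M) (spinor_bundle M (Wminus A)) (T_omega M) (spinor_to_T k A)"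
  unfolding hermitian_bundle_iso_def
proof (intro conjI ballI allI impI)
  fix x assume "x \<in> topspace (topo M)"
  then interpret unitary4_at M A x by (rule at)
  show "bij_betw (spinor_to_T k A x) (hb_fibre (spinor_bundle M (Wminus A)) x) (hb_fibre (T_omega M) x)"
    using bij_spinor_to_T[OF k] by (simp add: spinor_bundle_def T_omega_def)
  fix a assume "a \<in> hb_fibre (spinor_bundle M (Wminus A)) x"
  then have a: "a \<in> fibre (Wminus A) x" by (simp add: spinor_bundle_def)
  show "spinor_to_T k A x (hb_scale (spinor_bundle M (Wminus A)) x z a)
      = hb_scale (T_omega M) x z (spinor_to_T k A x a)" for z
    by (rule spinor_to_T_hermitian(3)[OF k a a])
  fix b assume "b \<in> hb_fibre (spinor_bundle M (Wminus A)) x"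
  then have b: "b \<in> fibre (Wminus A) x" by (simp add: spinor_bundle_def)
  show "spinor_to_T k A x (hb_plus (spinor_bundle M (Wminus A)) x a b)
      = hb_plus (T_omega M) x (spinor_to_T k A x a) (spinor_to_T k A x b)"
    "hb_herm (T_omega M) x (spinor_to_T k A x a) (spinor_to_T k A x b)
      = hb_herm (spinor_bundle M (Wminus A)) x a b"
    by (rule spinor_to_T_hermitian(1)[OF k a b], rule spinor_to_T_hermitian(2)[OF k a b])
next
  fix S s assume *: "openin (topo M) S \<and> hb_smooth (spinor_bundle M (Wminus A)) S s"
  then have S: "openin (topo M) S" and s: "\<And>x. x \<in> S \<Longrightarrow> s x \<in> fibre (Wminus A) x"
    and sm: "\<And>F. F \<in> A \<Longrightarrow> smooth_fun M (S \<inter> fst F) (\<lambda>x. coord F (s x))"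
    by (simp_all add: spinor_bundle_def smooth_section_def)
  have top: "x \<in> topspace (topo M)" if "x \<in> S" for x using S that openin_subset by blast
  have "spinor_to_T k A x (s x) \<in> tspace M x" if "x \<in> S" for x
    using bij_betwE[OF unitary4_at.bij_spinor_to_T[OF at[OF top[OF that]] k]] s[OF that] by blast
  moreover have "smooth_fun M (S \<inter> fst c) (\<lambda>x. coord c (spinor_to_T k A x (s x)))"
    if c: "c \<in> atlas M" for c
  proof (rule smooth_fun_framewise)
    show "openin (topo M) (S \<inter> fst c)" using S chart_openin[OF c] by (rule openin_Int)
    fix F assume F: "F \<in> A"
    let ?U = "S \<inter> fst c \<inter> fst F"
    have U: "openin (topo M) ?U" by (intro openin_Int S chart_openin[OF c] frame_openin[OF F])
    show "smooth_fun M ?U (\<lambda>x. coord c (spinor_to_T k A x (s x)))"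
    proof (rule smooth_fun_cong[OF U])
      show "coord c (snd F x (qmul (qof (cnj k)) (coord F (s x)))) = coord c (spinor_to_T k A x (s x))"
        if "x \<in> ?U" for x
        using unitary4_at.spinor_to_T_frame[OF at[OF top], of x F "s x"] F s that by simp
      have "smooth_fun M ?U (\<lambda>x. coord F (s x))"
        by (rule smooth_fun_subset[OF sm[OF F]]) blast
      then show "smooth_fun M ?U (\<lambda>x. coord c (snd F x (qmul (qof (cnj k)) (coord F (s x)))))"
        by (intro smooth_frame_apply[OF c F U]
            smooth_fun_bilinear[OF bounded_bilinear_qmul U smooth_fun_const]) auto
    qed
  qed
  ultimately show "hb_smooth (T_omega M) S (\<lambda>x. spinor_to_T k A x (s x))"
    by (simp add: T_omega_def smooth_section_def)
next
  fix S t assume *: "openin (topo M) S \<and> hb_smooth (T_omega M) S t"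
  then have S: "openin (topo M) S" and t: "\<And>x. x \<in> S \<Longrightarrow> t x \<in> tspace M x"
    and sm: "\<And>c. c \<in> atlas M \<Longrightarrow> smooth_fun M (S \<inter> fst c) (\<lambda>x. coord c (t x))"
    by (simp_all add: T_omega_def smooth_section_def)
  have top: "x \<in> topspace (topo M)" if "x \<in> S" for x using S that openin_subset by blast
  define s where "s x = inv_into (fibre (Wminus A) x) (spinor_to_T k A x) (t x)" for x
  have s: "s x \<in> fibre (Wminus A) x" "spinor_to_T k A x (s x) = t x" if "x \<in> S" for x
  proof -
    note b = unitary4_at.bij_spinor_to_T[OF at[OF top[OF that]] k]
    show "s x \<in> fibre (Wminus A) x" "spinor_to_T k A x (s x) = t x"
      unfolding s_def using bij_betw_apply[OF bij_betw_inv_into[OF b] t[OF that]]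
        bij_betw_inv_into_right[OF b t[OF that]] .
  qed
  have "smooth_fun M (S \<inter> fst F) (\<lambda>x. coord F (s x))" if F: "F \<in> A" for F
  proof (rule smooth_fun_chartwise)
    show "openin (topo M) (S \<inter> fst F)" using S frame_openin[OF F] by (rule openin_Int)
    fix c assume c: "c \<in> atlas M"
    let ?U = "S \<inter> fst F \<inter> fst c"
    have U: "openin (topo M) ?U" by (intro openin_Int S chart_openin[OF c] frame_openin[OF F])
    show "smooth_fun M ?U (\<lambda>x. coord F (s x))"
    proof (rule smooth_fun_cong[OF U])
      show "qmul (qof k) (inv (snd F x) (cls (TM M) c x (coord c (t x)))) = coord F (s x)"
        if xU: "x \<in> ?U" for x
      proof -
        have "x \<in> S" using xU by simp
        interpret unitary4_at M A x using top[OF \<open>x \<in> S\<close>] by (rule at)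
        have F': "F \<in> A \<and> x \<in> fst F" using F xU by simp
        have "t x = snd F x (qmul (qof (cnj k)) (coord F (s x)))"
          using spinor_to_T_frame[OF F', of "s x" k] s[OF \<open>x \<in> S\<close>] by simp
        moreover have "cls (TM M) c x (coord c (t x)) = t x"
          using T.cls_coord[of c "t x"] t[OF \<open>x \<in> S\<close>] c xU by simp
        ultimately show ?thesis
          by (simp add: iso_inv(1)[OF frame_iso[OF F']] qof_cnj_cancel[OF k])
      qed
      have "smooth_fun M ?U (\<lambda>x. coord c (t x))"
        by (rule smooth_fun_subset[OF sm[OF c]]) blast
      then show "smooth_fun M ?U (\<lambda>x. qmul (qof k) (inv (snd F x) (cls (TM M) c x (coord c (t x)))))"
        by (intro smooth_frame_inv[OF c F U]
            smooth_fun_bilinear[OF bounded_bilinear_qmul U smooth_fun_const]) auto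
    qed
  qed
  with s(1) show "hb_smooth (spinor_bundle M (Wminus A)) S
      (\<lambda>x. inv_into (hb_fibre (spinor_bundle M (Wminus A)) x) (spinor_to_T k A x) (t x))"
    by (simp add: spinor_bundle_def smooth_section_def s_def)
qed

lemma hermitian_iso_spinor_to_PSO:
  "hermitian_bundle_iso (topo M) (spinor_bundle M (Wplus A)) (PSO_omega M) (spinor_to_PSO M A)"
  unfolding hermitian_bundle_iso_def
proof (intro conjI ballI allI impI)
  fix x assume "x \<in> topspace (topo M)"
  then interpret unitary4_at M A x by (rule at)
  show "bij_betw (spinor_to_PSO M A x) (hb_fibre (spinor_bundle M (Wplus A)) x) (hb_fibre (PSO_omega M) x)"
    using bij_spinor_to_PSO by (simp add: spinor_bundle_def PSO_omega_def)
  fix a assume "a \<in> hb_fibre (spinor_bundle M (Wplus A)) x"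
  then have a: "a \<in> fibre (Wplus A) x" by (simp add: spinor_bundle_def)
  show "spinor_to_PSO M A x (hb_scale (spinor_bundle M (Wplus A)) x z a)
      = hb_scale (PSO_omega M) x z (spinor_to_PSO M A x a)" for z
    by (rule spinor_to_PSO_hermitian(3)[OF a a])
  fix b assume "b \<in> hb_fibre (spinor_bundle M (Wplus A)) x"
  then have b: "b \<in> fibre (Wplus A) x" by (simp add: spinor_bundle_def)
  show "spinor_to_PSO M A x (hb_plus (spinor_bundle M (Wplus A)) x a b)
      = hb_plus (PSO_omega M) x (spinor_to_PSO M A x a) (spinor_to_PSO M A x b)"
    "hb_herm (PSO_omega M) x (spinor_to_PSO M A x a) (spinor_to_PSO M A x b)
      = hb_herm (spinor_bundle M (Wplus A)) x a b"
    by (rule spinor_to_PSO_hermitian(1)[OF a b], rule spinor_to_PSO_hermitian(2)[OF a b])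
next
  fix S s assume *: "openin (topo M) S \<and> hb_smooth (spinor_bundle M (Wplus A)) S s"
  then have S: "openin (topo M) S" and s: "\<And>x. x \<in> S \<Longrightarrow> s x \<in> fibre (Wplus A) x"
    and sm: "\<And>F. F \<in> A \<Longrightarrow> smooth_fun M (S \<inter> fst F) (\<lambda>x. coord F (s x))"
    by (simp_all add: spinor_bundle_def smooth_section_def)
  have top: "x \<in> topspace (topo M)" if "x \<in> S" for x using S that openin_subset by blast
  have "spinor_to_PSO M A x (s x) \<in> pso_fibre M x" if "x \<in> S" for x
    using bij_betwE[OF unitary4_at.bij_spinor_to_PSO[OF at[OF top[OF that]]]] s[OF that] by blast
  moreover have "smooth_fun M (S \<inter> fst c) (\<lambda>x. coord c (spinor_to_PSO M A x (s x) (cls (TM M) c x a)))"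
    if c: "c \<in> atlas M" for c a
  proof (rule smooth_fun_framewise)
    show "openin (topo M) (S \<inter> fst c)" using S chart_openin[OF c] by (rule openin_Int)
    fix F assume F: "F \<in> A"
    let ?U = "S \<inter> fst c \<inter> fst F"
    have U: "openin (topo M) ?U" by (intro openin_Int S chart_openin[OF c] frame_openin[OF F])
    show "smooth_fun M ?U (\<lambda>x. coord c (spinor_to_PSO M A x (s x) (cls (TM M) c x a)))"
    proof (rule smooth_fun_cong[OF U])
      show "coord c (snd F x (qmul (coord F (s x)) (inv (snd F x) (cls (TM M) c x a))))
          = coord c (spinor_to_PSO M A x (s x) (cls (TM M) c x a))" if xU: "x \<in> ?U" for x
      proof -
        have "x \<in> S" using xU by simp
        interpret unitary4_at M A x using top[OF \<open>x \<in> S\<close>] by (rule at)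
        show ?thesis
          using spinor_to_PSO_frame[of F "s x"] F xU c s[OF \<open>x \<in> S\<close>] by (simp add: mult_map_def)
      qed
      have "smooth_fun M ?U (\<lambda>x. coord F (s x))"
        by (rule smooth_fun_subset[OF sm[OF F]]) blast
      then show "smooth_fun M ?U
          (\<lambda>x. coord c (snd F x (qmul (coord F (s x)) (inv (snd F x) (cls (TM M) c x a)))))"
        by (intro smooth_frame_apply[OF c F U] smooth_frame_inv[OF c F U] smooth_fun_const
            smooth_fun_bilinear[OF bounded_bilinear_qmul U]) auto
    qed
  qed
  ultimately show "hb_smooth (PSO_omega M) S (\<lambda>x. spinor_to_PSO M A x (s x))"
    by (simp add: PSO_omega_def)
next
  fix S t assume *: "openin (topo M) S \<and> hb_smooth (PSO_omega M) S t"
  then have S: "openin (topo M) S" and t: "\<And>x. x \<in> S \<Longrightarrow> t x \<in> pso_fibre M x"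
    and sm: "\<And>c a. c \<in> atlas M \<Longrightarrow> smooth_fun M (S \<inter> fst c) (\<lambda>x. coord c (t x (cls (TM M) c x a)))"
    by (simp_all add: PSO_omega_def)
  have top: "x \<in> topspace (topo M)" if "x \<in> S" for x using S that openin_subset by blast
  define s where "s x = inv_into (fibre (Wplus A) x) (spinor_to_PSO M A x) (t x)" for x
  have s: "s x \<in> fibre (Wplus A) x" "spinor_to_PSO M A x (s x) = t x" if "x \<in> S" for x
  proof -
    note b = unitary4_at.bij_spinor_to_PSO[OF at[OF top[OF that]]]
    show "s x \<in> fibre (Wplus A) x" "spinor_to_PSO M A x (s x) = t x"
      unfolding s_def using bij_betw_apply[OF bij_betw_inv_into[OF b] t[OF that]]
        bij_betw_inv_into_right[OF b t[OF that]] .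
  qed
  have "smooth_fun M (S \<inter> fst F) (\<lambda>x. coord F (s x))" if F: "F \<in> A" for F
  proof (rule smooth_fun_chartwise)
    show "openin (topo M) (S \<inter> fst F)" using S frame_openin[OF F] by (rule openin_Int)
    fix c assume c: "c \<in> atlas M"
    let ?U = "S \<inter> fst F \<inter> fst c"
    have U: "openin (topo M) ?U" by (intro openin_Int S chart_openin[OF c] frame_openin[OF F])
    \<comment> \<open>Left multiplication evaluated on the first frame vector returns the quaternion
      itself, so \<open>?L\<close> at \<open>?e\<close> recovers the spinor from the
      endomorphism.\<close>
    let ?e = "\<lambda>x. coord c (snd F x q1)"
    let ?L = "\<lambda>x y. coord c (t x (cls (TM M) c x y))"
    have tm: "t x = mult_map M x (snd F x) (coord F (s x))" if xU: "x \<in> ?U" for x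
    proof -
      have "x \<in> S" using xU by simp
      interpret unitary4_at M A x using top[OF \<open>x \<in> S\<close>] by (rule at)
      show ?thesis using spinor_to_PSO_frame[of F "s x"] F xU s[OF \<open>x \<in> S\<close>] by simp
    qed
    have L: "linear (?L x)" if xU: "x \<in> ?U" for x
    proof -
      have xS: "x \<in> S" using xU by simp
      interpret unitary4_at M A x using top[OF xS] by (rule at)
      have iF: "oriented_isometry M x (snd F x)" using frame_iso[of F] F xU by simp
      have v: "T.valid c" using c xU by simp
      note t' = T.cls_in_fibre[OF v]
      show ?thesis
        by (rule linearI)
          (simp_all add: tm[OF xU] mult_map_def T.cls_add[OF v, symmetric] T.cls_scale[OF v, symmetric] t'
            iso_inv_add[OF iF t' t'] iso_inv_scale[OF iF t'] qmul_simps iso_add[OF iF] iso_scale[OF iF]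
            T.coord_fplus[OF v iso_in[OF iF] iso_in[OF iF]] T.coord_fscale[OF v iso_in[OF iF]])
    qed
    show "smooth_fun M ?U (\<lambda>x. coord F (s x))"
    proof (rule smooth_fun_cong[OF U])
      show "inv (snd F x) (cls (TM M) c x (?L x (?e x))) = coord F (s x)" if xU: "x \<in> ?U" for x
      proof -
        have xS: "x \<in> S" using xU by simp
        interpret unitary4_at M A x using top[OF xS] by (rule at)
        have iF: "oriented_isometry M x (snd F x)" using frame_iso[of F] F xU by simp
        have v: "T.valid c" using c xU by simp
        show ?thesis
          by (simp add: T.cls_coord[OF v iso_in[OF iF]] tm[OF xU] mult_map_iso[OF iF] iso_inv(1)[OF iF])
      qed
      have "smooth_fun M ?U (\<lambda>x. ?L x a)" for a
        by (rule smooth_fun_subset[OF sm[OF c]]) blast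
      moreover have "smooth_fun M ?U ?e"
        by (rule smooth_frame_apply[OF c F U _ _ smooth_fun_const]) auto
      ultimately have "smooth_fun M ?U (\<lambda>x. ?L x (?e x))"
        using smooth_fun_linear_family[OF U, of ?L ?e] L by blast
      then show "smooth_fun M ?U (\<lambda>x. inv (snd F x) (cls (TM M) c x (?L x (?e x))))"
        by (intro smooth_frame_inv[OF c F U]) auto
    qed
  qed
  with s(1) show "hb_smooth (spinor_bundle M (Wplus A)) S
      (\<lambda>x. inv_into (hb_fibre (spinor_bundle M (Wplus A)) x) (spinor_to_PSO M A x) (t x))"
    by (simp add: spinor_bundle_def smooth_section_def s_def)
qed

end


section \<open>Naturality\<close>

locale unitary_map_at = M: unitary4_at M A x + N: unitary4_at N B "h x"
  for M :: "'m ah_manifold" and A x and N :: "'m ah_manifold" and B h +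
  assumes h: "ah_map M N h"
begin

abbreviation "D \<equiv> differential M N h x"

lemma D_in: "D v \<in> tspace N (h x)"
  using N.T.valid_idx_at by (simp add: differential_def Let_def)

lemma D_linear:
  assumes "u \<in> tspace M x" "v \<in> tspace M x"
  shows "D (fplus (TM M) x u v) = fplus (TM N) (h x) (D u) (D v)"
    "D (fscale (TM M) x r u) = fscale (TM N) (h x) r (D u)"
proof -
  let ?c = "idx_at (TM M) x" and ?d = "idx_at (TM N) (h x)"
  have c: "?c \<in> atlas M" "x \<in> fst ?c" and d: "?d \<in> atlas N" "h x \<in> fst ?d"
    using M.T.valid_idx_at N.T.valid_idx_at by simp_all
  have "Cinf_on (snd ?d \<circ> h \<circ> inv_into (fst ?c) (snd ?c)) (snd ?c ` {x \<in> fst ?c. h x \<in> fst ?d})"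
    using h c d unfolding ah_map_def smooth_map_def by blast
  then have "(snd ?d \<circ> h \<circ> inv_into (fst ?c) (snd ?c)) differentiable (at (snd ?c x))"
    by (rule Cinf_on_differentiable) (use c d in auto)
  then have L: "linear (frechet_derivative (snd ?d \<circ> h \<circ> inv_into (fst ?c) (snd ?c)) (at (snd ?c x)))"
    by (rule linear_frechet_derivative)
  show "D (fplus (TM M) x u v) = fplus (TM N) (h x) (D u) (D v)"
    "D (fscale (TM M) x r u) = fscale (TM N) (h x) r (D u)"
    unfolding differential_def Let_def N.T.cls_add[OF N.T.valid_idx_at] N.T.cls_scale[OF N.T.valid_idx_at]
      M.T.coord_fplus[OF M.T.valid_idx_at assms] M.T.coord_fscale[OF M.T.valid_idx_at assms(1)]
      linear_add[OF L] linear_scale[OF L]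
    by (rule refl)+
qed

lemma D_metric: "v \<in> tspace M x \<Longrightarrow> w \<in> tspace M x \<Longrightarrow> metric N (D v) (D w) = metric M v w"
  and D_cplx: "v \<in> tspace M x \<Longrightarrow> D (cplx M v) = cplx N (D v)"
  using h M.x unfolding ah_map_def by blast+

context
  fixes F G
  assumes F: "F \<in> A \<and> x \<in> fst F" and G: "G \<in> B \<and> h x \<in> fst G"
begin

text \<open>The frame over M carried along by the differential and the frame over N differ by a
  complex linear isometry, so \<open>U2_change\<close> applies as between two frames of one
  manifold.\<close>

lemma spinc_differential_eq:
  obtains u where "u \<in> U2" "spinc_differential M N h x F G = U2_to_SpinC u"
    "\<And>a. snd G (h x) (U2_act u a) = D (snd F x a)"
    "\<And>z a. U2_act u (qmul (qof z) a) = qmul (qof z) (U2_act u a)"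
proof -
  note iF = M.frame_iso[OF F] and iG = N.frame_iso[OF G]
  define R where "R a = inv (snd G (h x)) (D (snd F x a))" for a
  have GR: "snd G (h x) (R a) = D (snd F x a)" for a
    unfolding R_def by (rule N.iso_inv(2)[OF iG D_in])
  have R: "linear R"
    unfolding R_def
    by (rule linearI) (simp_all only: M.iso_add[OF iF] M.iso_scale[OF iF]
        D_linear[OF M.iso_in[OF iF] M.iso_in[OF iF]] N.iso_inv_add[OF iG D_in D_in] N.iso_inv_scale[OF iG D_in])
  have iso: "inner (R a) (R b) = inner a b" for a b
    unfolding R_def N.metric_iso_inv[OF iG D_in D_in, symmetric]
      D_metric[OF M.iso_in[OF iF] M.iso_in[OF iF]] by (rule M.iso_metric[OF iF])
  have Ri: "R (qmul qi a) = qmul qi (R a)" for a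
  proof -
    have "snd G (h x) (R (qmul qi a)) = snd G (h x) (qmul qi (R a))"
      unfolding N.frame_J[OF G] GR M.frame_J[OF F] by (rule D_cplx[OF M.iso_in[OF iF]])
    then show ?thesis unfolding N.iso_eq_iff[OF iG] .
  qed
  note u = U2_change[OF N.iso_inj[OF iG] GR R iso Ri]
  show ?thesis
  proof (rule that[OF u(1)])
    show "spinc_differential M N h x F G
        = U2_to_SpinC (U2_change (\<lambda>a. D (snd F x a)) (snd G (h x)))"
      by (simp add: spinc_differential_def)
    show "snd G (h x) (U2_act (U2_change (\<lambda>a. D (snd F x a)) (snd G (h x))) a) = D (snd F x a)" for a
      unfolding u(2) by (rule GR)
    show "U2_act (U2_change (\<lambda>a. D (snd F x a)) (snd G (h x))) (qmul (qof z) a)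
        = qmul (qof z) (U2_act (U2_change (\<lambda>a. D (snd F x a)) (snd G (h x))) a)" for z a
      unfolding u(2) by (rule commute_qof[OF R Ri])
  qed
qed

end

text \<open>The element of U(2) given by the differential commutes with complex scalars, so the
  factor \<open>cnj k\<close> passes through it.\<close>

lemma spinor_to_T_natural:
  "spinor_to_T k B (h x) (spinor_map_minus M A N B h x \<psi>) = D (spinor_to_T k A x \<psi>)"
proof -
  obtain u where u: "spinc_differential M N h x (frame_at A x) (frame_at B (h x)) = U2_to_SpinC u"
    "\<And>a. snd (frame_at B (h x)) (h x) (U2_act u a) = D (snd (frame_at A x) x a)"
    "\<And>z a. U2_act u (qmul (qof z) a) = qmul (qof z) (U2_act u a)"
    using spinc_differential_eq[OF M.frame_at N.frame_at] by metis
  show ?thesis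
    using N.frame_at
    by (simp add: spinor_to_T_def spinor_map_minus_def Let_def u(1) u(2)[symmetric] u(3))
qed

text \<open>The same cancellation as in the gluing, \<open>U2_plus_qmul\<close>, with the
  differential in place of a transition.\<close>

lemma spinor_to_PSO_natural:
  assumes v: "v \<in> tspace M x"
  shows "spinor_to_PSO N B (h x) (spinor_map_plus M A N B h x \<phi>) (D v) = D (spinor_to_PSO M A x \<phi> v)"
proof -
  let ?F = "frame_at A x" and ?G = "frame_at B (h x)"
  note iF = M.frame_iso[OF M.frame_at] and iG = N.frame_iso[OF N.frame_at]
  obtain u where u: "u \<in> U2" "spinc_differential M N h x ?F ?G = U2_to_SpinC u"
    "\<And>a. snd ?G (h x) (U2_act u a) = D (snd ?F x a)"
    using spinc_differential_eq[OF M.frame_at N.frame_at] by metis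
  let ?w = "inv (snd ?F x) v"
  have Dv: "D v = snd ?G (h x) (U2_act u ?w)"
    unfolding u(3) M.iso_inv(2)[OF iF v] ..
  have "spinor_to_PSO N B (h x) (spinor_map_plus M A N B h x \<phi>) (D v)
      = snd ?G (h x) (qmul (U2_act (SpinC_to_U2_plus (U2_to_SpinC u)) (coord ?F \<phi>)) (U2_act u ?w))"
    unfolding Dv spinor_to_PSO_def N.mult_map_iso[OF iG] spinor_map_plus_def Let_def u(2)
    using N.frame_at by simp
  also have "\<dots> = D (snd ?F x (qmul (coord ?F \<phi>) ?w))"
    unfolding U2_plus_qmul[OF u(1)] u(3) ..
  also have "\<dots> = D (spinor_to_PSO M A x \<phi> v)"
    using v by (simp add: spinor_to_PSO_def mult_map_def)
  finally show ?thesis .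
qed

end

section \<open>Assembly over all manifolds and frame covers\<close>

lemma unitary4I: "almost_hermitian_4manifold M \<and> unitary_frames M A \<Longrightarrow> unitary4 M A"
  by (simp add: unitary4_def unitary4_axioms_def almost_hermitian4_def)

lemma natural_spinor_isos: "natural_isos (\<lambda>M. spinor_to_T k) spinor_to_PSO"
  unfolding natural_isos_def
proof (intro allI impI ballI)
  fix M :: "'a ah_manifold" and A and N :: "'a ah_manifold" and B h x
  assume *: "almost_hermitian_4manifold M \<and> unitary_frames M A \<and>
      almost_hermitian_4manifold N \<and> unitary_frames N B \<and> ah_map M N h"
    and x: "x \<in> topspace (topo M)"
  then have "h x \<in> topspace (topo N)"
    using continuous_map_image_subset_topspace unfolding ah_map_def smooth_map_def by blast
  then have "unitary_map_at M A x N B h"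
    using * x unitary4.at[OF unitary4I[of M A]] unitary4.at[OF unitary4I[of N B]]
    by (simp add: unitary_map_at_def unitary_map_at_axioms_def)
  then interpret unitary_map_at M A x N B h .
  show "(\<forall>\<psi>\<in>fibre (Wminus A) x. spinor_to_T k B (h x) (spinor_map_minus M A N B h x \<psi>)
          = differential M N h x (spinor_to_T k A x \<psi>)) \<and>
        (\<forall>\<phi>\<in>fibre (Wplus A) x. \<forall>v\<in>tspace M x.
           spinor_to_PSO N B (h x) (spinor_map_plus M A N B h x \<phi>) (differential M N h x v)
            = differential M N h x (spinor_to_PSO M A x \<phi> v))"
    using spinor_to_T_natural spinor_to_PSO_natural by blast
qed

theorem theorem2p1:
  fixes cp cm :: "quat \<Rightarrow> quat \<Rightarrow> quat"
  assumes "clifford_model cp cm"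
  shows "\<exists>(\<Phi>m :: 'm ah_manifold \<Rightarrow> 'm lframe set \<Rightarrow> 'm \<Rightarrow> 'm spinor \<Rightarrow> 'm tvec)
          (\<Phi>p :: 'm ah_manifold \<Rightarrow> 'm lframe set \<Rightarrow> 'm \<Rightarrow> 'm spinor \<Rightarrow> 'm tvec \<Rightarrow> 'm tvec).
    natural_isos \<Phi>m \<Phi>p \<and>
    (\<forall>M A. almost_hermitian_4manifold M \<and> unitary_frames M A \<longrightarrow>
       hermitian_bundle_iso (topo M) (spinor_bundle M (Wminus A)) (T_omega M) (\<Phi>m M A) \<and>
       hermitian_bundle_iso (topo M) (spinor_bundle M (Wplus A)) (PSO_omega M) (\<Phi>p M A) \<and>
       (\<forall>x\<in>topspace (topo M). \<forall>v\<in>tspace M x. \<forall>\<phi>\<in>fibre (Wplus A) x.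
          \<Phi>m M A x (clifford_plus cp A x v \<phi>) = \<Phi>p M A x \<phi> v) \<and>
       (\<forall>x\<in>topspace (topo M). \<forall>\<phi>\<in>fibre (Wplus A) x. \<forall>v\<in>tspace M x. \<forall>w\<in>tspace M x.
          squaring cp cm M A x \<phi> v w
            = of_real (1/4 * omega M (\<Phi>p M A x \<phi> v) (\<Phi>p M A x \<phi> w))))"
proof -
  \<comment> \<open>\<open>k\<close> comes from the model alone, so one choice serves all manifolds
    and frame covers, as naturality demands.\<close>
  obtain k where k: "norm k = 1" and cp: "\<And>v \<phi>. cp v \<phi> = qmul (qof k) (qmul \<phi> v)"
    and cm: "\<And>v \<psi>. cm v \<psi> = - qmul (qof (cnj k)) (qmul \<psi> (qconj v))"
    by (rule clifford_model_unique[OF assms]) (rule that)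
  show ?thesis
  proof (rule exI[of _ "\<lambda>M. spinor_to_T k"], rule exI[of _ spinor_to_PSO],
      intro conjI allI impI ballI natural_spinor_isos)
    fix M :: "'m ah_manifold" and A
    assume "almost_hermitian_4manifold M \<and> unitary_frames M A"
    then interpret unitary4 M A by (rule unitary4I)
    show "hermitian_bundle_iso (topo M) (spinor_bundle M (Wminus A)) (T_omega M) (spinor_to_T k A)"
      by (rule hermitian_iso_spinor_to_T[OF k])
    show "hermitian_bundle_iso (topo M) (spinor_bundle M (Wplus A)) (PSO_omega M) (spinor_to_PSO M A)"
      by (rule hermitian_iso_spinor_to_PSO)
    fix x v \<phi> assume x: "x \<in> topspace (topo M)"
    interpret unitary4_at M A x by (rule at[OF x])
    show "spinor_to_T k A x (clifford_plus cp A x v \<phi>) = spinor_to_PSO M A x \<phi> v"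
      if "v \<in> tspace M x" using that by (rule spinor_to_T_clifford[OF k cp])
    show "squaring cp cm M A x \<phi> v w
        = of_real (1/4 * omega M (spinor_to_PSO M A x \<phi> v) (spinor_to_PSO M A x \<phi> w))"
      if "v \<in> tspace M x" "w \<in> tspace M x" for w
      using that by (rule squaring_eq[OF k cp cm])
  qed
qed

end
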